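(* Consider the stochastic contextual matching market described in the context, and run the BARB algorithm (described in the context) with parameter $\eta = R\sqrt{d\log\left(\frac{1+TB_x^2/\lambda}{\delta}\right)}+\lambda^{1/2}B_\theta$ where $\delta = T^{-2}$, ridge parameter $\lambda>0$ and any initial candidate gap $\Delta_1>0$. Then for every player $p_i$, $i\in[N]$, $$Reg_i(T) = O\!\left(\frac{\log^2 T}{\Delta_{\min}^2} + \frac{\log T}{\Delta_{\min}^2}\right) = O\!\left(\frac{\log^2 T}{\Delta_{\min}^2}\right),$$ where $\Delta_{\min}$ is the minimum preference gap defined in the context and the $O(\cdot)$ hides factors depending on the problem parameters $N,d,R,B_x,B_\theta,\lambda$ but not on $T$ or $\Delta_{\min}$.
   Context: Market: $N$ players $p_1,\dots,p_N$ and $K\ge N$ arms $a_1,\dots,a_K$, horizon $T$. Each arm $a_j$ has a fixed, strict, known preference order $\succ_{a_j}$ over players. Each player $p_i$ has an unknown parameter $\theta_i\in\mathbb{R}^d$ with $\|\theta_i\|_2\le B_\theta$. At each round $t$, every arm $a_j$ has a context $x_j(t)\in\mathbb{R}^d$ with $\|x_j(t)\|_2\le B_x$ almost surely, revealed before the matching decision; the utility of $p_i$ for $a_j$ is $U_{i,j}(t)=\theta_i^\top x_j(t)$. It is assumed $B_y:=2B_\theta B_x\le 1$. Stochastic contexts: the tuple $(x_1(t),\dots,x_K(t))$ is drawn independently across rounds from a fixed unknown distribution (arm $a_j$'s context has a fixed distribution $\mathcal{D}_{x_j}$). In each round a matching $\mu_t$ (each player matched to at most one arm and vice versa) is chosen;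 if $p_i$ is matched to $a_j$ one observes $y_i(t)=U_{i,j}(t)+\epsilon_{i,j}(t)$ where the noises are i.i.d., mean zero and conditionally $R$-subgaussian given the past; if $p_i$ is unmatched, $y_i(t)=0$. Stability: a matching $\mu$ is stable at time $t$ if there is no pair $(p_i,a_j)$ with $p_i\succ_{a_j}\mu(a_j)$ and $U_{i,j}(t)>U_{i,\mu(p_i)}(t)$. Let $\mathcal{S}_t$ be the set of stable matchings for $U(t)$ and the arms' preferences, and $U_i^*(t)=\max_{\mu\in\mathcal{S}_t}U_{i,\mu(i)}(t)$ (player-optimal stable share). Regret: $Reg_i(T)=\sum_{t=1}^T U_i^*(t)-\mathbb{E}\left[\sum_{t=1}^T y_i(t)\right]$. Minimum difference: $\delta_{\min}=\min_{i\in[N]}\min_{j\neq j'\in[K]}|\theta_i^\top(x_j-x_{j'})|$ for a context realization (a random variable, identically distributed each round). Minimum preference gap: $\Delta_{\min}:=\sup\{\Delta:\ \mathbb{P}(\delta_{\min}\ge\Delta)\ge 1-\frac{\log T}{T\Delta^2}\}$. BARB algorithm (inputs $T$, arm preferences, $d$, $\eta$, $\Delta_1$, $\lambda$): a global round counter $t$ starts at $1$. For batches $k=1,2,\dots$: set $\xi_k=\Delta_k/\eta$, reset $V_i=\lambda I_d$, $\hat\theta_i=0$ for all $i$, and a counter $N_k=0$. In each round of batch $k$, observe all contexts $x_j$. (Exploration) If some $(i,j)$ has $\|x_j\|_{V_i^{-1}}>\xi_k$ (where $\|x\|_A=\sqrt{x^\top A x}$), form the bipartite graph of all such pairs, compute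 a maximum cardinality matching on it, match the players it covers accordingly (others unmatched), and for each matched player update $V_i=\lambda I+\sum_s x_{i_s}x_{i_s}^\top$ and $\hat\theta_i=V_i^{-1}\sum_s x_{i_s}y_{i,i_s}$, the sums over this player's exploration rounds of the current batch ($i_s$ the arm it was matched to in round $s$). (Exploitation) Otherwise, set $\hat U_{i,j}=\hat\theta_i^\top x_j$, run player-proposing Gale–Shapley with $\hat U$ and the arms' preferences and use its output matching; for each player sort $\hat U_{i,\cdot}$ decreasingly and let $\Delta_{i,\min}$ be the minimal difference between consecutive entries among the top $N+1$ sorted values; if some player has $\Delta_{i,\min}\le 2\Delta_k$, increment $N_k$. After each round increment $t$ and stop if $t>T$; if $N_k>\frac{3\log T}{16\Delta_k^2}$, set $\Delta_{k+1}=\Delta_k/\sqrt2$ and start batch $k+1$.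
   Formalization: The factor hidden in O(·) may also depend on the initial candidate gap Δ₁; with a factor uniform in Δ₁ the claim fails, since for Δ₁ small relative to T the algorithm explores in every round and the regret is linear in T. *)

theory Defs
  imports "HOL-Probability.Probability"
begin

text \<open>Players are the naturals below N, arms the naturals below K.
  A matching is a map from players to an optional arm.  The arms' strict
  preferences are given by ranks: player i is preferred by arm j to player i'
  iff rk j i < rk j i'.  An unmatched player has utility 0 (observation 0)
  and prefers every arm to being unmatched; an arm prefers every player to
  being unmatched.\<close>

definition matching_on :: "nat \<Rightarrow> nat \<Rightarrow> (nat \<Rightarrow> nat option) \<Rightarrow> bool" where
  "matching_on N K \<mu> \<longleftrightarrow>
     (\<forall>i. \<mu> i \<noteq> None \<longrightarrow> i < N) \<and>
     (\<forall>i j. \<mu> i = Some j \<longrightarrow> j < K) \<and>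
     (\<forall>i i' j. \<mu> i = Some j \<longrightarrow> \<mu> i' = Some j \<longrightarrow> i = i')"

definition blocking_pair ::
  "nat \<Rightarrow> (nat \<Rightarrow> nat \<Rightarrow> nat) \<Rightarrow> (nat \<Rightarrow> nat \<Rightarrow> real) \<Rightarrow> (nat \<Rightarrow> nat option) \<Rightarrow> nat \<Rightarrow> nat \<Rightarrow> bool" where
  "blocking_pair N rk U \<mu> i j \<longleftrightarrow>
     (\<forall>i'<N. \<mu> i' = Some j \<longrightarrow> rk j i < rk j i') \<and>
     (case \<mu> i of None \<Rightarrow> True | Some j' \<Rightarrow> U i j > U i j')"

definition stable_matching ::
  "nat \<Rightarrow> nat \<Rightarrow> (nat \<Rightarrow> nat \<Rightarrow> nat) \<Rightarrow> (nat \<Rightarrow> nat \<Rightarrow> real) \<Rightarrow> (nat \<Rightarrow> nat option) \<Rightarrow> bool" where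
  "stable_matching N K rk U \<mu> \<longleftrightarrow>
     matching_on N K \<mu> \<and> \<not> (\<exists>i<N. \<exists>j<K. blocking_pair N rk U \<mu> i j)"

definition match_util :: "(nat \<Rightarrow> nat \<Rightarrow> real) \<Rightarrow> (nat \<Rightarrow> nat option) \<Rightarrow> nat \<Rightarrow> real" where
  "match_util U \<mu> i = (case \<mu> i of None \<Rightarrow> 0 | Some j \<Rightarrow> U i j)"

definition opt_stable_util ::
  "nat \<Rightarrow> nat \<Rightarrow> (nat \<Rightarrow> nat \<Rightarrow> nat) \<Rightarrow> (nat \<Rightarrow> nat \<Rightarrow> real) \<Rightarrow> nat \<Rightarrow> real" where
  "opt_stable_util N K rk U i = Max {match_util U \<mu> i | \<mu>. stable_matching N K rk U \<mu>}"

definition is_max_matching :: "nat \<Rightarrow> nat \<Rightarrow> (nat \<times> nat) set \<Rightarrow> (nat \<Rightarrow> nat option) \<Rightarrow> bool" where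
  "is_max_matching N K E \<mu> \<longleftrightarrow>
     matching_on N K \<mu> \<and> (\<forall>i j. \<mu> i = Some j \<longrightarrow> (i, j) \<in> E) \<and>
     (\<forall>\<mu>'. matching_on N K \<mu>' \<and> (\<forall>i j. \<mu>' i = Some j \<longrightarrow> (i, j) \<in> E) \<longrightarrow>
        card {i. \<mu>' i \<noteq> None} \<le> card {i. \<mu> i \<noteq> None})"

definition mm_oracle :: "nat \<Rightarrow> nat \<Rightarrow> ((nat \<times> nat) set \<Rightarrow> (nat \<Rightarrow> nat option)) \<Rightarrow> bool" where
  "mm_oracle N K mm \<longleftrightarrow> (\<forall>E. E \<subseteq> {..<N} \<times> {..<K} \<longrightarrow> is_max_matching N K E (mm E))"

text \<open>An (arbitrary) tie-breaking rule turning estimated utilities into the players'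
  proposal lists: each list enumerates all arms in weakly decreasing order of utility.\<close>
definition pref_lists_ok :: "nat \<Rightarrow> nat \<Rightarrow> ((nat \<Rightarrow> nat \<Rightarrow> real) \<Rightarrow> nat \<Rightarrow> nat list) \<Rightarrow> bool" where
  "pref_lists_ok N K plist \<longleftrightarrow>
     (\<forall>Uh i. i < N \<longrightarrow> distinct (plist Uh i) \<and> set (plist Uh i) = {..<K} \<and>
        sorted_wrt (\<lambda>a b. Uh i b \<le> Uh i a) (plist Uh i))"

text \<open>Player-proposing Gale--Shapley. State: number of proposals made by each
  player, and the tentative partner of each arm.\<close>
definition gs_free :: "nat \<Rightarrow> nat \<Rightarrow> (nat \<Rightarrow> nat) \<times> (nat \<Rightarrow> nat option) \<Rightarrow> nat \<Rightarrow> bool" where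
  "gs_free N K st i \<longleftrightarrow> i < N \<and> (\<forall>j. snd st j \<noteq> Some i) \<and> fst st i < K"

definition gs_step ::
  "nat \<Rightarrow> nat \<Rightarrow> (nat \<Rightarrow> nat \<Rightarrow> nat) \<Rightarrow> (nat \<Rightarrow> nat list) \<Rightarrow>
   (nat \<Rightarrow> nat) \<times> (nat \<Rightarrow> nat option) \<Rightarrow> (nat \<Rightarrow> nat) \<times> (nat \<Rightarrow> nat option)" where
  "gs_step N K rk P st =
     (if \<exists>i. gs_free N K st i then
        (let i = (LEAST i. gs_free N K st i);
             nxt = fst st; eng = snd st;
             j = P i ! nxt i
         in (nxt(i := Suc (nxt i)),
             (case eng j of None \<Rightarrow> eng(j := Some i)
              | Some i' \<Rightarrow> if rk j i < rk j i' then eng(j := Some i) else eng)))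
      else st)"

definition gale_shapley ::
  "nat \<Rightarrow> nat \<Rightarrow> (nat \<Rightarrow> nat \<Rightarrow> nat) \<Rightarrow> (nat \<Rightarrow> nat list) \<Rightarrow> (nat \<Rightarrow> nat option)" where
  "gale_shapley N K rk P =
     (let eng = snd ((gs_step N K rk P ^^ (N * K)) (\<lambda>_. 0, \<lambda>_. None))
      in (\<lambda>i. if \<exists>j. eng j = Some i then Some (THE j. eng j = Some i) else None))"

record 'd barb_state =
  st_Delta :: real
  st_V :: "nat \<Rightarrow> real^'d^'d"
  st_b :: "nat \<Rightarrow> real^'d"
  st_Nk :: nat

definition vnorm_inv :: "real^'d^'d \<Rightarrow> real^'d \<Rightarrow> real" where
  "vnorm_inv V x = sqrt (x \<bullet> (matrix_inv V *v x))"

definition outer_prod :: "real^'d \<Rightarrow> real^'d^'d" where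
  "outer_prod x = (\<chi> a b. x $ a * x $ b)"

definition batch_init :: "real \<Rightarrow> real \<Rightarrow> ('d::finite) barb_state" where
  "batch_init lam D = \<lparr>st_Delta = D, st_V = (\<lambda>_. mat lam), st_b = (\<lambda>_. 0), st_Nk = 0\<rparr>"

text \<open>One round of BARB: given the current state, the contexts c and the noise
  realisations e (used only for the matched pairs), return the played matching
  and the new state (including the end-of-batch test).\<close>
definition barb_round ::
  "nat \<Rightarrow> nat \<Rightarrow> (nat \<Rightarrow> nat \<Rightarrow> nat) \<Rightarrow> (nat \<Rightarrow> real^'d) \<Rightarrow>
   ((nat \<times> nat) set \<Rightarrow> (nat \<Rightarrow> nat option)) \<Rightarrow> ((nat \<Rightarrow> nat \<Rightarrow> real) \<Rightarrow> nat \<Rightarrow> nat list) \<Rightarrow>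
   nat \<Rightarrow> real \<Rightarrow> real \<Rightarrow> ('d::finite) barb_state \<Rightarrow> (nat \<Rightarrow> real^'d) \<Rightarrow> (nat \<times> nat \<Rightarrow> real) \<Rightarrow>
   (nat \<Rightarrow> nat option) \<times> 'd barb_state" where
  "barb_round N K rk \<theta> mm plist T eta lam s c e =
     (let \<xi> = st_Delta s / eta;
          Ex = {(i, j). i < N \<and> j < K \<and> vnorm_inv (st_V s i) (c j) > \<xi>};
          (\<mu>, s') =
            (if Ex \<noteq> {} then
               (let \<mu> = mm Ex;
                    y = (\<lambda>i j. \<theta> i \<bullet> c j + e (i, j))
                in (\<mu>, s\<lparr>st_V := (\<lambda>i. case \<mu> i of None \<Rightarrow> st_V s i
                                              | Some j \<Rightarrow> st_V s i + outer_prod (c j)),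
                        st_b := (\<lambda>i. case \<mu> i of None \<Rightarrow> st_b s i
                                              | Some j \<Rightarrow> st_b s i + y i j *\<^sub>R c j)\<rparr>))
             else
               (let Uh = (\<lambda>i j. (matrix_inv (st_V s i) *v st_b s i) \<bullet> c j);
                    \<mu> = gale_shapley N K rk (plist Uh);
                    close = (\<exists>i<N. let L = rev (sort (map (Uh i) [0..<K])) in
                               \<exists>m. Suc m < min (Suc N) K \<and> L ! m - L ! Suc m \<le> 2 * st_Delta s)
                in (\<mu>, if close then s\<lparr>st_Nk := Suc (st_Nk s)\<rparr> else s)))
      in (\<mu>, if real (st_Nk s') > 3 * ln (real T) / (16 * (st_Delta s')\<^sup>2)
             then batch_init lam (st_Delta s' / sqrt 2) else s'))"

text \<open>A realisation \<omega> gives, for every round t (1-based), the contexts fst (\<omega> t)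
  and the noise matrix snd (\<omega> t).  barb_states \<dots> n is the state after n rounds.\<close>
primrec barb_states ::
  "nat \<Rightarrow> nat \<Rightarrow> (nat \<Rightarrow> nat \<Rightarrow> nat) \<Rightarrow> (nat \<Rightarrow> real^'d) \<Rightarrow>
   ((nat \<times> nat) set \<Rightarrow> (nat \<Rightarrow> nat option)) \<Rightarrow> ((nat \<Rightarrow> nat \<Rightarrow> real) \<Rightarrow> nat \<Rightarrow> nat list) \<Rightarrow>
   nat \<Rightarrow> real \<Rightarrow> real \<Rightarrow> real \<Rightarrow> (nat \<Rightarrow> (nat \<Rightarrow> real^'d) \<times> (nat \<times> nat \<Rightarrow> real)) \<Rightarrow>
   nat \<Rightarrow> ('d::finite) barb_state" where
  "barb_states N K rk \<theta> mm plist T eta lam D1 \<omega> 0 = batch_init lam D1"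
| "barb_states N K rk \<theta> mm plist T eta lam D1 \<omega> (Suc n) =
     snd (barb_round N K rk \<theta> mm plist T eta lam
            (barb_states N K rk \<theta> mm plist T eta lam D1 \<omega> n) (fst (\<omega> (Suc n))) (snd (\<omega> (Suc n))))"

definition barb_matching ::
  "nat \<Rightarrow> nat \<Rightarrow> (nat \<Rightarrow> nat \<Rightarrow> nat) \<Rightarrow> (nat \<Rightarrow> real^'d) \<Rightarrow>
   ((nat \<times> nat) set \<Rightarrow> (nat \<Rightarrow> nat option)) \<Rightarrow> ((nat \<Rightarrow> nat \<Rightarrow> real) \<Rightarrow> nat \<Rightarrow> nat list) \<Rightarrow>
   nat \<Rightarrow> real \<Rightarrow> real \<Rightarrow> real \<Rightarrow> (nat \<Rightarrow> (nat \<Rightarrow> real^'d) \<times> (nat \<times> nat \<Rightarrow> real)) \<Rightarrow>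
   nat \<Rightarrow> (nat \<Rightarrow> nat option)" where
  "barb_matching N K rk \<theta> mm plist T eta lam D1 \<omega> t =
     fst (barb_round N K rk \<theta> mm plist T eta lam
            (barb_states N K rk \<theta> mm plist T eta lam D1 \<omega> (t - 1)) (fst (\<omega> t)) (snd (\<omega> t)))"

definition barb_obs ::
  "nat \<Rightarrow> nat \<Rightarrow> (nat \<Rightarrow> nat \<Rightarrow> nat) \<Rightarrow> (nat \<Rightarrow> real^'d) \<Rightarrow>
   ((nat \<times> nat) set \<Rightarrow> (nat \<Rightarrow> nat option)) \<Rightarrow> ((nat \<Rightarrow> nat \<Rightarrow> real) \<Rightarrow> nat \<Rightarrow> nat list) \<Rightarrow>
   nat \<Rightarrow> real \<Rightarrow> real \<Rightarrow> real \<Rightarrow> (nat \<Rightarrow> (nat \<Rightarrow> real^'d) \<times> (nat \<times> nat \<Rightarrow> real)) \<Rightarrow>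
   nat \<Rightarrow> nat \<Rightarrow> real" where
  "barb_obs N K rk \<theta> mm plist T eta lam D1 \<omega> t i =
     (case barb_matching N K rk \<theta> mm plist T eta lam D1 \<omega> t i of
        None \<Rightarrow> 0
      | Some j \<Rightarrow> \<theta> i \<bullet> fst (\<omega> t) j + snd (\<omega> t) (i, j))"

definition subgaussian :: "real \<Rightarrow> real measure \<Rightarrow> bool" where
  "subgaussian R D \<longleftrightarrow>
     (\<forall>s. integrable D (\<lambda>x. exp (s * x)) \<and> (\<integral>x. exp (s * x) \<partial>D) \<le> exp (s\<^sup>2 * R\<^sup>2 / 2))"

definition round_space :: "nat \<Rightarrow> nat \<Rightarrow> (nat \<Rightarrow> real^'d) measure \<Rightarrow> real measure \<Rightarrow>
    ((nat \<Rightarrow> real^'d) \<times> (nat \<times> nat \<Rightarrow> real)) measure" where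
  "round_space N K Dx De = Dx \<Otimes>\<^sub>M (\<Pi>\<^sub>M ij\<in>{..<N} \<times> {..<K}. De)"

definition sample_space :: "nat \<Rightarrow> nat \<Rightarrow> nat \<Rightarrow> (nat \<Rightarrow> real^'d) measure \<Rightarrow> real measure \<Rightarrow>
    (nat \<Rightarrow> (nat \<Rightarrow> real^'d) \<times> (nat \<times> nat \<Rightarrow> real)) measure" where
  "sample_space T N K Dx De = (\<Pi>\<^sub>M t\<in>{1..T}. round_space N K Dx De)"

definition barb_regret ::
  "nat \<Rightarrow> nat \<Rightarrow> (nat \<Rightarrow> nat \<Rightarrow> nat) \<Rightarrow> (nat \<Rightarrow> real^'d) \<Rightarrow>
   ((nat \<times> nat) set \<Rightarrow> (nat \<Rightarrow> nat option)) \<Rightarrow> ((nat \<Rightarrow> nat \<Rightarrow> real) \<Rightarrow> nat \<Rightarrow> nat list) \<Rightarrow>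
   nat \<Rightarrow> real \<Rightarrow> real \<Rightarrow> real \<Rightarrow> (nat \<Rightarrow> real^'d) measure \<Rightarrow> real measure \<Rightarrow> nat \<Rightarrow> real" where
  "barb_regret N K rk \<theta> mm plist T eta lam D1 Dx De i =
     (\<integral>\<omega>. (\<Sum>t\<in>{1..T}. opt_stable_util N K rk (\<lambda>i' j. \<theta> i' \<bullet> fst (\<omega> t) j) i
                          - barb_obs N K rk \<theta> mm plist T eta lam D1 \<omega> t i)
        \<partial>sample_space T N K Dx De)"

definition min_pref_gap :: "nat \<Rightarrow> nat \<Rightarrow> (nat \<Rightarrow> real^'d) \<Rightarrow> (nat \<Rightarrow> real^'d) measure \<Rightarrow> nat \<Rightarrow> real" where
  "min_pref_gap N K \<theta> Dx T =
     Sup {\<Delta>. \<Delta> > 0 \<and>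
            measure Dx {c \<in> space Dx. \<forall>i<N. \<forall>j<K. \<forall>j'<K. j \<noteq> j' \<longrightarrow> \<bar>\<theta> i \<bullet> (c j - c j')\<bar> \<ge> \<Delta>}
              \<ge> 1 - ln (real T) / (real T * \<Delta>\<^sup>2)}"

end

theory Submission
  imports Defs
begin

text \<open>
  Within a batch, the exploration pattern depends on the contexts only, and the ridge estimates
  obey a self-normalised confidence bound. It is obtained by the method of mixtures: the Gaussian
  integral of \<open>exp (x \<bullet> S / R - x \<bullet> V x / 2)\<close> is a supermartingale, and adding to it the number of
  batches still to come keeps it a supermartingale across the resets. Gaussian integrals of
  quadratic forms also replace determinants in the elliptical potential argument, which bounds the
  number of exploration rounds of a batch by \<open>O(log T / \<xi>\<^sup>2)\<close>. On the confidence event, an exploitation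
  round without a small estimated gap among the top \<open>N + 1\<close> arms incurs no regret, because
  Gale--Shapley never makes a player propose beyond its first \<open>N\<close> arms. A round with a small
  estimated gap has a true gap of at most \<open>4 \<Delta>\<^sub>k\<close>; by a Chernoff bound the rounds whose true gap is
  below the minimum preference gap are too few to end a batch with \<open>4 \<Delta>\<^sub>k < \<Delta>\<^sub>m\<^sub>i\<^sub>n\<close>. The costs of the
  batches thus form a geometric series with largest term of order \<open>log\<^sup>2 T / \<Delta>\<^sub>m\<^sub>i\<^sub>n\<^sup>2\<close>.
\<close>


section \<open>Gaussian integrals of quadratic forms\<close>

definition quad :: "real^'d^'d \<Rightarrow> real^'d \<Rightarrow> real" where
  "quad V x = x \<bullet> (V *v x)"

text \<open>Symmetry together with \<open>l I \<le> V \<le> u I\<close>. The eigenvalue bounds are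
  stated through the quadratic form, so that no diagonalisation enters.\<close>

definition sym_between :: "real \<Rightarrow> real \<Rightarrow> real^'d^'d \<Rightarrow> bool" where
  "sym_between l u V \<longleftrightarrow> 0 < l \<and> (\<forall>x y. x \<bullet> (V *v y) = (V *v x) \<bullet> y) \<and>
     (\<forall>x. l * (x \<bullet> x) \<le> quad V x \<and> quad V x \<le> u * (x \<bullet> x))"

text \<open>For positive definite \<open>V\<close> this is
  \<open>(2 pi)^(d/2) / sqrt (det V)\<close>; comparing integrands replaces comparing
  determinants.\<close>

definition gauss_integral :: "real^'d^'d \<Rightarrow> ennreal" where
  "gauss_integral V = (\<integral>\<^sup>+x. ennreal (exp (- quad V x / 2)) \<partial>lborel)"

text \<open>For \<open>V = l I + A\<close> this is, up to normalisation, the average of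
  \<open>exp (x \<bullet> S - quad A x / 2)\<close> over a centred Gaussian \<open>x\<close> with
  covariance \<open>I / l\<close>; the prior is absorbed into \<open>V\<close>.\<close>

definition gauss_mix :: "real^'d^'d \<Rightarrow> real^'d \<Rightarrow> ennreal" where
  "gauss_mix V S = (\<integral>\<^sup>+x. ennreal (exp (x \<bullet> S - quad V x / 2)) \<partial>lborel)"

lemma quad_measurable [measurable]: "quad V \<in> borel_measurable borel"
  unfolding quad_def
  by (intro borel_measurable_continuous_onI continuous_intros linear_continuous_on
      matrix_vector_mul_bounded_linear)

text \<open>The two power series in \<open>z^2\<close> are compared term by term, with coefficients
  \<open>1 / (2n)!\<close> and \<open>1 / (2^n n!)\<close>.\<close>

lemma cosh_le_exp_half_square: "(exp z + exp (- z)) / 2 \<le> exp (z\<^sup>2 / 2)" for z :: real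
proof -
  have s1: "(\<lambda>n. if even n then z ^ n / fact n else 0) sums cosh z"
    using cosh_converges[of z] by (simp add: divide_inverse mult.commute cong: if_cong)
  have "strict_mono (\<lambda>n::nat. 2 * n)"
    by (simp add: strict_mono_def)
  moreover have "(if even n then z ^ n / fact n else 0) = 0" if "n \<notin> range (\<lambda>n::nat. 2 * n)" for n
    using that by (auto elim!: evenE)
  ultimately have s1': "(\<lambda>n. (if even (2*n) then z ^ (2*n) / fact (2*n) else 0)) sums cosh z"
    using s1 sums_mono_reindex[of "\<lambda>n::nat. 2 * n" "\<lambda>n. if even n then z ^ n / fact n else 0"] by blast
  have s2: "(\<lambda>n. (z\<^sup>2 / 2) ^ n / fact n) sums exp (z\<^sup>2 / 2)"
    using exp_converges[of "z\<^sup>2 / 2"] by (simp add: field_simps)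
  have f: "2 ^ n * fact n \<le> (fact (2*n) :: real)" for n
  proof (induction n)
    case (Suc n)
    have "2 ^ Suc n * fact (Suc n) = (2 * real (Suc n)) * (2 ^ n * fact n)"
      by (simp add: algebra_simps)
    also have "\<dots> \<le> (2 * real (Suc n)) * fact (2*n)"
      by (rule mult_left_mono[OF Suc.IH]) simp
    also have "\<dots> \<le> (2 * real (Suc n) * (2 * real n + 1)) * fact (2*n)"
      by (rule mult_right_mono) (auto simp: algebra_simps)
    also have "\<dots> = fact (2 * Suc n)" by (simp add: algebra_simps)
    finally show ?case .
  qed simp
  have "cosh z \<le> exp (z\<^sup>2 / 2)"
  proof (rule sums_le[OF _ s1' s2])
    fix n
    have "z ^ (2*n) / fact (2*n) \<le> z ^ (2*n) / (2 ^ n * fact n)"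
      by (rule divide_left_mono[OF f]) (auto simp: power_mult)
    then show "(if even (2*n) then z ^ (2*n) / fact (2*n) else 0) \<le> (z\<^sup>2 / 2) ^ n / fact n"
      by (simp add: power_divide power_mult)
  qed
  then show ?thesis by (simp add: cosh_def scaleR_conv_of_real)
qed

lemma gauss_1d:
  assumes "a > 0"
  shows "(\<integral>\<^sup>+x. ennreal (exp (- a * x\<^sup>2 / 2)) \<partial>lborel) = ennreal (sqrt (2 * pi / a))"
proof -
  define \<sigma> where "\<sigma> = 1 / sqrt a"
  have \<sigma>: "\<sigma> > 0" "\<sigma>\<^sup>2 = 1 / a" using assms by (auto simp: \<sigma>_def power_divide)
  have eq: "exp (- a * x\<^sup>2 / 2) = sqrt (2 * pi / a) * normal_density 0 \<sigma> x" for x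
    using assms \<sigma> by (simp add: normal_density_def real_sqrt_divide real_sqrt_mult)
  have "(\<integral>\<^sup>+x. ennreal (exp (- a * x\<^sup>2 / 2)) \<partial>lborel)
      = (\<integral>\<^sup>+x. ennreal (sqrt (2 * pi / a)) * ennreal (normal_density 0 \<sigma> x) \<partial>lborel)"
    unfolding eq using assms \<sigma>(1) by (simp add: ennreal_mult')
  also have "\<dots> = ennreal (sqrt (2 * pi / a)) * (\<integral>\<^sup>+x. ennreal (normal_density 0 \<sigma> x) \<partial>lborel)"
    by (rule nn_integral_cmult) simp
  also have "(\<integral>\<^sup>+x. ennreal (normal_density 0 \<sigma> x) \<partial>lborel) = 1"
    using prob_space.emeasure_space_1[OF prob_space_normal_density[OF \<sigma>(1), of 0]]
    by (simp add: emeasure_density)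
  finally show ?thesis by simp
qed

lemma gauss_iso:
  assumes "a > 0"
  shows "(\<integral>\<^sup>+x. ennreal (exp (- (a * (x \<bullet> x)) / 2)) \<partial>(lborel :: (real^'d) measure))
    = ennreal (sqrt (2 * pi / a) ^ CARD('d))"
proof -
  have eq: "ennreal (exp (- (a * (x \<bullet> x)) / 2))
      = (\<Prod>b\<in>Basis. ennreal (exp (- a * (x \<bullet> b)\<^sup>2 / 2)))" for x :: "real^'d"
    by (subst euclidean_inner)
       (simp add: prod_ennreal exp_sum[symmetric] sum_negf sum_distrib_left sum_divide_distrib
         power2_eq_square)
  have "(\<integral>\<^sup>+x. ennreal (exp (- (a * (x \<bullet> x)) / 2)) \<partial>(lborel :: (real^'d) measure))
     = (\<Prod>b\<in>(Basis :: (real^'d) set). \<integral>\<^sup>+x. ennreal (exp (- a * x\<^sup>2 / 2)) \<partial>lborel)"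
    unfolding eq by (rule nn_integral_lborel_prod) auto
  also have "\<dots> = ennreal (sqrt (2 * pi / a) ^ CARD('d))"
    using assms by (simp add: gauss_1d[OF assms, simplified] ennreal_power)
  finally show ?thesis .
qed

lemma gauss_integral_bounds:
  assumes "sym_between l u (V :: real^'d^'d)"
  shows "gauss_integral V \<le> ennreal (sqrt (2 * pi / l) ^ CARD('d))"
    and "u > 0 \<Longrightarrow> ennreal (sqrt (2 * pi / u) ^ CARD('d)) \<le> gauss_integral V"
proof -
  from assms have l: "0 < l" and b: "\<And>x. l * (x \<bullet> x) \<le> quad V x" "\<And>x. quad V x \<le> u * (x \<bullet> x)"
    by (auto simp: sym_between_def)
  show "gauss_integral V \<le> ennreal (sqrt (2 * pi / l) ^ CARD('d))"
    unfolding gauss_integral_def gauss_iso[OF l, symmetric]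
    by (rule nn_integral_mono) (use b(1) in auto)
  show "ennreal (sqrt (2 * pi / u) ^ CARD('d)) \<le> gauss_integral V" if u: "u > 0"
    unfolding gauss_integral_def gauss_iso[OF u, symmetric]
    by (rule nn_integral_mono) (use b(2) in auto)
qed

lemma mat_mult_vec: "mat l *v x = l *\<^sub>R x" for x :: "real^'d"
  by (simp add: vec_eq_iff matrix_vector_mult_def mat_def if_distrib[where f="\<lambda>c. c * _"] cong: if_cong)

lemma gauss_integral_mat:
  "gauss_integral (mat l :: real^'d^'d) = ennreal (sqrt (2 * pi / l) ^ CARD('d))" if "l > 0"
  unfolding gauss_integral_def quad_def using gauss_iso[OF that, where 'd='d] by (simp add: mat_mult_vec)

lemma matrix_inv_inverse:
  fixes A :: "real^'n^'n"
  assumes "invertible A"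
  shows "A ** matrix_inv A = mat 1" "matrix_inv A ** A = mat 1"
proof -
  from assms have "\<exists>A'. A ** A' = mat 1 \<and> A' ** A = mat 1" by (simp add: invertible_def)
  from someI_ex[OF this] show "A ** matrix_inv A = mat 1" "matrix_inv A ** A = mat 1"
    unfolding matrix_inv_def by blast+
qed

text \<open>\<open>matrix_inv\<close> is defined by choice, so invertibility has to come first. The
  lower bound on the quadratic form makes the kernel trivial.\<close>

lemma sym_between_inverse:
  fixes V :: "real^'d^'d"
  assumes "sym_between l u V"
  shows "V *v (matrix_inv V *v x) = x" and "matrix_inv V *v (V *v x) = x"
    and "x \<bullet> (matrix_inv V *v y) = (matrix_inv V *v x) \<bullet> y"
proof -
  from assms have l: "0 < l" and b: "\<And>x. l * (x \<bullet> x) \<le> quad V x"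
    and s: "\<And>x y. x \<bullet> (V *v y) = (V *v x) \<bullet> y"
    by (auto simp: sym_between_def)
  have "V *v x = 0 \<Longrightarrow> x = 0" for x
    using b[of x] mult_pos_pos[OF l, of "x \<bullet> x"] by (auto simp: quad_def inner_gt_zero_iff not_less[symmetric])
  then have "invertible V"
    by (metis invertible_left_inverse matrix_left_invertible_ker)
  then have inv: "V ** matrix_inv V = mat 1" "matrix_inv V ** V = mat 1"
    by (rule matrix_inv_inverse)+
  show a: "V *v (matrix_inv V *v x) = x" for x by (simp add: matrix_vector_mul_assoc inv)
  show "matrix_inv V *v (V *v x) = x" for x by (simp add: matrix_vector_mul_assoc inv)
  show "x \<bullet> (matrix_inv V *v y) = (matrix_inv V *v x) \<bullet> y"
    using s[of "matrix_inv V *v x" "matrix_inv V *v y"] by (simp add: a)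
qed

text \<open>Completing the square: the integration variable is shifted by the maximiser
  \<open>m\<close> of the exponent, which Lebesgue measure does not notice.\<close>

lemma gauss_mix_eq:
  assumes "sym_between l u (V :: real^'d^'d)"
  shows "gauss_mix V S = ennreal (exp (S \<bullet> (matrix_inv V *v S) / 2)) * gauss_integral V"
proof -
  note inv = sym_between_inverse[OF assms]
  from assms have s: "\<And>x y. x \<bullet> (V *v y) = (V *v x) \<bullet> y" by (auto simp: sym_between_def)
  define m where "m = matrix_inv V *v S"
  have sq: "(m + x) \<bullet> S - quad V (m + x) / 2 = S \<bullet> m / 2 - quad V x / 2" for x
    using s[of m x] s[of x m] inv(1)[of S]
    by (simp add: quad_def m_def[symmetric] matrix_vector_right_distrib inner_add_left
        inner_add_right inner_commute algebra_simps)
  have "gauss_mix V S = (\<integral>\<^sup>+x. ennreal (exp (x \<bullet> S - quad V x / 2)) \<partial>distr lborel borel ((+) m))"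
    unfolding gauss_mix_def lborel_distr_plus ..
  also have "\<dots> = (\<integral>\<^sup>+x. ennreal (exp ((m + x) \<bullet> S - quad V (m + x) / 2)) \<partial>lborel)"
    by (subst nn_integral_distr) auto
  also have "\<dots> = (\<integral>\<^sup>+x. ennreal (exp (S \<bullet> m / 2)) * ennreal (exp (- quad V x / 2)) \<partial>lborel)"
    by (simp add: sq ennreal_mult'[symmetric] exp_add[symmetric])
  also have "\<dots> = ennreal (exp (S \<bullet> m / 2)) * gauss_integral V"
    unfolding gauss_integral_def by (rule nn_integral_cmult) auto
  finally show ?thesis by (simp add: m_def)
qed

lemma outer_prod_mult_vec: "outer_prod x *v y = (x \<bullet> y) *\<^sub>R x"
  by (simp add: vec_eq_iff outer_prod_def matrix_vector_mult_def inner_vec_def sum_distrib_left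
      sum_distrib_right algebra_simps)

lemma quad_add_outer: "quad (V + outer_prod x) y = quad V y + (x \<bullet> y)\<^sup>2"
  by (simp add: quad_def matrix_vector_mult_add_rdistrib outer_prod_mult_vec inner_add_right
      power2_eq_square inner_commute)

lemma sym_between_add_outer:
  assumes "sym_between l u V" "norm x \<le> B"
  shows "sym_between l (u + B\<^sup>2) (V + outer_prod x)"
proof -
  have "(x \<bullet> y)\<^sup>2 \<le> B\<^sup>2 * (y \<bullet> y)" for y
  proof -
    have "(x \<bullet> y)\<^sup>2 \<le> (x \<bullet> x) * (y \<bullet> y)" by (rule Cauchy_Schwarz_ineq)
    also have "\<dots> \<le> B\<^sup>2 * (y \<bullet> y)"
      by (rule mult_right_mono) (use assms(2) in \<open>auto simp: dot_square_norm intro: power_mono\<close>)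
    finally show ?thesis .
  qed
  moreover have "p \<bullet> ((V + outer_prod x) *v q) = ((V + outer_prod x) *v p) \<bullet> q" for p q
    using assms(1)
    by (simp add: sym_between_def matrix_vector_mult_add_rdistrib outer_prod_mult_vec
        inner_add_left inner_add_right inner_commute)
  moreover from calculation(1) have "l * (y \<bullet> y) \<le> quad V y + (x \<bullet> y)\<^sup>2"
    "quad V y + (x \<bullet> y)\<^sup>2 \<le> (u + B\<^sup>2) * (y \<bullet> y)" for y
    using assms(1) unfolding sym_between_def distrib_right
    by (auto intro: add_increasing2 add_mono)
  ultimately show ?thesis
    using assms(1) unfolding sym_between_def quad_add_outer by blast
qed

lemma sym_between_mat: "l > 0 \<Longrightarrow> sym_between l l (mat l :: real^'d^'d)"
  by (simp add: sym_between_def quad_def mat_mult_vec)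

lemma sym_between_mono: "sym_between l u V \<Longrightarrow> u \<le> u' \<Longrightarrow> sym_between l u' V"
  unfolding sym_between_def by (meson inner_ge_zero mult_right_mono order_trans)

text \<open>Stands in for \<open>det (V + x x^T) = (1 + a) det V\<close>, with the slightly weaker
  \<open>a / (1 + a)\<close> in place of \<open>ln (1 + a)\<close>. The mean of
  \<open>gauss_mix\<close> at \<open>x\<close> and \<open>- x\<close> has the integrand
  \<open>cosh (x \<bullet> y) * exp (- quad (V + x x^T) y / 2)\<close>. The bound on
  \<open>cosh\<close> gives back exactly the square by which the two quadratic forms differ.\<close>

lemma gauss_integral_add_outer:
  fixes V :: "real^'d^'d" and x :: "real^'d"
  assumes V: "sym_between l u V"
  defines "a \<equiv> x \<bullet> (matrix_inv V *v x)"
  shows "ennreal (exp (a / (1 + a) / 2)) * gauss_integral (V + outer_prod x) \<le> gauss_integral V"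
    and "a \<ge> 0"
proof -
  let ?W = "V + outer_prod x"
  note inv = sym_between_inverse[OF V]
  from V have s: "\<And>x y. x \<bullet> (V *v y) = (V *v x) \<bullet> y" and l: "l > 0"
    and b: "\<And>x. l * (x \<bullet> x) \<le> quad V x" by (auto simp: sym_between_def)
  have W: "sym_between l (u + (norm x)\<^sup>2) ?W" by (rule sym_between_add_outer[OF V]) simp
  note invW = sym_between_inverse[OF W]
  have "a = quad V (matrix_inv V *v x)" unfolding a_def quad_def by (simp add: inv(1) inner_commute)
  moreover have "0 \<le> l * ((matrix_inv V *v x) \<bullet> (matrix_inv V *v x))" using l by simp
  ultimately show a0: "a \<ge> 0" using b[of "matrix_inv V *v x"] by linarith
  \<comment> \<open>Sherman--Morrison, needed only for the vector \<open>x\<close> itself: the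
    updated inverse maps it to a multiple of its image under the old inverse.\<close>
  have "?W *v (matrix_inv V *v x) = (1 + a) *\<^sub>R x"
    by (simp add: matrix_vector_mult_add_rdistrib outer_prod_mult_vec inv(1) a_def algebra_simps)
  then have "matrix_inv ?W *v ((1 + a) *\<^sub>R x) = matrix_inv V *v x"
    by (metis invW(2))
  then have "(1 + a) *\<^sub>R (matrix_inv ?W *v x) = matrix_inv V *v x"
    by (metis matrix_vector_mult_scaleR)
  then have "(1 + a) * (x \<bullet> (matrix_inv ?W *v x)) = a"
    by (metis a_def inner_scaleR_right)
  with a0 have a': "x \<bullet> (matrix_inv ?W *v x) = a / (1 + a)" by (simp add: field_simps)
  have m1: "gauss_mix ?W x = ennreal (exp (a / (1 + a) / 2)) * gauss_integral ?W"
    using gauss_mix_eq[OF W, of x] by (simp add: a')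
  have m2: "gauss_mix ?W (- x) = ennreal (exp (a / (1 + a) / 2)) * gauss_integral ?W"
    using gauss_mix_eq[OF W, of "- x"] using matrix_vector_mult_diff_distrib[of "matrix_inv ?W" 0 x] by (simp add: a')
  have pt: "ennreal (exp (y \<bullet> x - quad ?W y / 2)) + ennreal (exp (y \<bullet> (- x) - quad ?W y / 2))
      \<le> 2 * ennreal (exp (- quad V y / 2))" for y
  proof -
    have e: "exp (y \<bullet> x - quad ?W y / 2) = exp (x \<bullet> y) * exp (- quad ?W y / 2)"
      "exp (y \<bullet> (- x) - quad ?W y / 2) = exp (- (x \<bullet> y)) * exp (- quad ?W y / 2)"
      by (simp_all add: exp_add[symmetric] inner_commute)
    have "exp (y \<bullet> x - quad ?W y / 2) + exp (y \<bullet> (- x) - quad ?W y / 2)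
      = 2 * ((exp (x \<bullet> y) + exp (- (x \<bullet> y))) / 2 * exp (- quad ?W y / 2))"
      unfolding e by (simp add: distrib_right)
    also have "\<dots> \<le> 2 * (exp ((x \<bullet> y)\<^sup>2 / 2) * exp (- quad ?W y / 2))"
      by (intro mult_left_mono mult_right_mono cosh_le_exp_half_square) auto
    also have "\<dots> = 2 * exp (- quad V y / 2)"
      by (simp add: quad_add_outer exp_add[symmetric] add_divide_distrib diff_divide_distrib)
    finally show ?thesis
      by (subst ennreal_plus[symmetric]) (auto simp: ennreal_mult'[symmetric] simp del: ennreal_plus
          simp flip: ennreal_numeral)
  qed
  have "gauss_mix ?W x + gauss_mix ?W (- x)
    = (\<integral>\<^sup>+y. (ennreal (exp (y \<bullet> x - quad ?W y / 2)) + ennreal (exp (y \<bullet> (- x) - quad ?W y / 2))) \<partial>lborel)"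
    unfolding gauss_mix_def by (rule nn_integral_add[symmetric]) auto
  also have "\<dots> \<le> (\<integral>\<^sup>+y. 2 * ennreal (exp (- quad V y / 2)) \<partial>lborel)"
    by (rule nn_integral_mono) (rule pt)
  also have "\<dots> = 2 * gauss_integral V"
    unfolding gauss_integral_def by (rule nn_integral_cmult) auto
  finally have "2 * (ennreal (exp (a / (1 + a) / 2)) * gauss_integral ?W) \<le> 2 * gauss_integral V"
    unfolding m1 m2 by (simp add: mult_2)
  then show "ennreal (exp (a / (1 + a) / 2)) * gauss_integral ?W \<le> gauss_integral V"
    by (subst (asm) ennreal_mult_le_mult_iff) auto
qed

text \<open>The last bound is \<open>vnorm_inv V x \<le> norm x / sqrt l\<close> multiplied by
  \<open>l\<close>, the form in which the ridge bias uses it.\<close>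

lemma sym_between_Cauchy_Schwarz:
  assumes V: "sym_between l u V"
  shows "\<bar>x \<bullet> (matrix_inv V *v y)\<bar> \<le> vnorm_inv V x * vnorm_inv V y"
    and "vnorm_inv V x \<ge> 0"
    and "(vnorm_inv V x)\<^sup>2 = x \<bullet> (matrix_inv V *v x)"
    and "l * vnorm_inv V x \<le> sqrt l * norm x"
proof -
  note inv = sym_between_inverse[OF V]
  from V have s: "\<And>x y. x \<bullet> (V *v y) = (V *v x) \<bullet> y" and l: "l > 0"
    and b: "\<And>x. l * (x \<bullet> x) \<le> quad V x" by (auto simp: sym_between_def)
  let ?I = "\<lambda>x y. x \<bullet> (matrix_inv V *v y)"
  have nn: "?I x x \<ge> 0" for x using gauss_integral_add_outer(2)[OF V] .
  show sq: "(vnorm_inv V x)\<^sup>2 = ?I x x" for x unfolding vnorm_inv_def using nn by simp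
  show v0: "vnorm_inv V x \<ge> 0" for x unfolding vnorm_inv_def using nn by simp
  have comm: "?I x y = ?I y x" for x y by (metis inv(3) inner_commute)
  have CS: "(?I x y)\<^sup>2 \<le> ?I x x * ?I y y" for x y
  proof (cases "y = 0")
    case False
    then have "matrix_inv V *v y \<noteq> 0" by (metis inv(1) matrix_vector_mult_0_right)
    moreover have "?I y y = quad V (matrix_inv V *v y)" by (simp add: quad_def inv(1) inner_commute)
    moreover have "0 < l * ((matrix_inv V *v y) \<bullet> (matrix_inv V *v y))"
      using l calculation(1) by simp
    ultimately have p: "?I y y > 0" using b[of "matrix_inv V *v y"] by linarith
    define t where "t = ?I x y / ?I y y"
    have "0 \<le> ?I (x - t *\<^sub>R y) (x - t *\<^sub>R y)" by (rule nn)
    also have "\<dots> = ?I x x - t * ?I x y - t * (?I y x - t * ?I y y)"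
      by (simp only: inner_diff_left matrix_vector_mult_diff_distrib inner_diff_right
          matrix_vector_mult_scaleR inner_scaleR_left inner_scaleR_right right_diff_distrib)
    also have "\<dots> = ?I x x - 2 * t * ?I x y + t\<^sup>2 * ?I y y"
      unfolding comm[of y x] by (simp add: power2_eq_square algebra_simps)
    also have "\<dots> = ?I x x - (?I x y)\<^sup>2 / ?I y y"
      using p by (simp add: t_def power2_eq_square field_simps)
    finally show ?thesis using p by (simp add: field_simps)
  qed simp
  show C: "\<bar>?I x y\<bar> \<le> vnorm_inv V x * vnorm_inv V y" for x y
    by (rule abs_le_square_iff[THEN iffD2, of _ "vnorm_inv V x * vnorm_inv V y", simplified abs_of_nonneg[OF mult_nonneg_nonneg[OF v0 v0]]])
       (use CS[of x y] in \<open>simp add: power_mult_distrib sq\<close>)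
  show "l * vnorm_inv V x \<le> sqrt l * norm x"
  proof (rule power2_le_imp_le)
    let ?y = "matrix_inv V *v x"
    have 1: "l * (norm ?y)\<^sup>2 \<le> ?I x x" using b[of ?y] by (simp add: quad_def inv(1) dot_square_norm inner_commute)
    have 2: "?I x x \<le> norm x * norm ?y" by (rule norm_cauchy_schwarz)
    have "l * norm ?y \<le> norm x"
    proof (cases "norm ?y = 0")
      case False
      then have "norm ?y > 0" by simp
      moreover have "norm ?y * (l * norm ?y) \<le> norm ?y * norm x"
        using 1 2 by (simp add: power2_eq_square algebra_simps)
      ultimately show ?thesis by (rule mult_left_le_imp_le[rotated])
    qed simp
    then have "norm x * (l * norm ?y) \<le> norm x * norm x" by (rule mult_left_mono) simp
    moreover have "l * ?I x x \<le> l * (norm x * norm ?y)" using 2 l by (intro mult_left_mono) auto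
    ultimately have "l * ?I x x \<le> (norm x)\<^sup>2" by (simp add: power2_eq_square mult.left_commute)
    then have "l * (l * ?I x x) \<le> l * (norm x)\<^sup>2" using l by (intro mult_left_mono) auto
    then show "(l * vnorm_inv V x)\<^sup>2 \<le> (sqrt l * norm x)\<^sup>2"
      using l unfolding power_mult_distrib sq by (simp add: power2_eq_square algebra_simps)
  qed (use l in simp)
qed

text \<open>If \<open>V = l I + sum x x^T\<close> and \<open>b = sum y x\<close>, then
  \<open>b - V \<theta> + l \<theta>\<close> is the sum of noise times context. The error is
  therefore a noise part plus the bias \<open>- l V^-1 \<theta>\<close>, each bounded by
  Cauchy--Schwarz in the inverse norm.\<close>

lemma ridge_estimate_error:
  assumes V: "sym_between l u V"
  shows "\<bar>(matrix_inv V *v b) \<bullet> x - \<theta> \<bullet> x\<bar>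
    \<le> vnorm_inv V x * (vnorm_inv V (b - V *v \<theta> + l *\<^sub>R \<theta>) + sqrt l * norm \<theta>)"
proof -
  note inv = sym_between_inverse[OF V] and CS = sym_between_Cauchy_Schwarz[OF V]
  from V have l: "l > 0" by (auto simp: sym_between_def)
  let ?S = "b - V *v \<theta> + l *\<^sub>R \<theta>"
  have "matrix_inv V *v ?S - l *\<^sub>R (matrix_inv V *v \<theta>) = matrix_inv V *v b - \<theta>"
    by (simp add: matrix_vector_right_distrib matrix_vector_mult_diff_distrib inv(2) matrix_vector_mult_scaleR)
  then have "(matrix_inv V *v b) \<bullet> x - \<theta> \<bullet> x = x \<bullet> (matrix_inv V *v ?S) - l * (x \<bullet> (matrix_inv V *v \<theta>))"
    by (metis inner_commute inner_diff_right inner_scaleR_right)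
  also have "\<bar>\<dots>\<bar> \<le> \<bar>x \<bullet> (matrix_inv V *v ?S)\<bar> + l * \<bar>x \<bullet> (matrix_inv V *v \<theta>)\<bar>"
    using l by (simp add: abs_triangle_ineq4[THEN order_trans] abs_mult)
  also have "\<dots> \<le> vnorm_inv V x * vnorm_inv V ?S + l * (vnorm_inv V x * vnorm_inv V \<theta>)"
    using l by (intro add_mono mult_left_mono CS) auto
  also have "\<dots> = vnorm_inv V x * (vnorm_inv V ?S + l * vnorm_inv V \<theta>)" by (simp add: algebra_simps)
  also have "\<dots> \<le> vnorm_inv V x * (vnorm_inv V ?S + sqrt l * norm \<theta>)"
    by (intro mult_left_mono add_left_mono CS)
  finally show ?thesis .
qed

section \<open>Gale--Shapley\<close>

locale gs_market =
  fixes N K :: nat and rk :: "nat \<Rightarrow> nat \<Rightarrow> nat" and P :: "nat \<Rightarrow> nat list"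
  assumes N_le_K: "N \<le> K" and rk_inj: "\<And>j. j < K \<Longrightarrow> inj_on (rk j) {..<N}"
    and P_distinct: "\<And>i. i < N \<Longrightarrow> distinct (P i)"
    and P_set: "\<And>i. i < N \<Longrightarrow> set (P i) = {..<K}"
begin

lemma P_length: "i < N \<Longrightarrow> length (P i) = K"
  using distinct_card[OF P_distinct, of i] P_set[of i] by simp

lemma P_nth_less: "i < N \<Longrightarrow> m < K \<Longrightarrow> P i ! m < K"
  using P_set[of i] P_length[of i] nth_mem[of m "P i"] by auto

lemma P_nth_inject: "i < N \<Longrightarrow> m < K \<Longrightarrow> m' < K \<Longrightarrow> P i ! m = P i ! m' \<longleftrightarrow> m = m'"
  using nth_eq_iff_index_eq[OF P_distinct, of i m m'] P_length[of i] by simp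

lemma P_index: assumes "i < N" "j < K" obtains m where "m < K" "P i ! m = j"
  using assms P_set[of i] P_length[of i] by (metis in_set_conv_nth lessThan_iff)

text \<open>The last clause is the unusual one: it confines all proposals to the first
  \<open>N\<close> entries of each list. It survives a step because a player about to propose has
  made fewer than \<open>N\<close> proposals.\<close>

definition gs_inv :: "(nat \<Rightarrow> nat) \<times> (nat \<Rightarrow> nat option) \<Rightarrow> bool" where
  "gs_inv st \<longleftrightarrow>
     (\<forall>i j. snd st j = Some i \<longrightarrow> i < N \<and> 0 < fst st i \<and> j = P i ! (fst st i - 1)) \<and>
     (\<forall>i<N. \<forall>m<fst st i. snd st (P i ! m) \<noteq> None \<and>
        (\<forall>i'. snd st (P i ! m) = Some i' \<longrightarrow> i' = i \<or> rk (P i ! m) i' < rk (P i ! m) i)) \<and>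
     (\<forall>i<N. fst st i \<le> N)"

text \<open>Pigeonhole: every arm that \<open>i\<close> has proposed to is engaged, to a player
  other than \<open>i\<close>. Distinct arms hold distinct players, because an engaged player is
  held by the arm of its last proposal.\<close>

lemma gs_inv_unengaged:
  assumes inv: "gs_inv st" and i: "i < N" and un: "\<And>j. snd st j \<noteq> Some i"
  shows "fst st i < N"
proof -
  have le: "fst st i \<le> N" using inv i by (auto simp: gs_inv_def)
  have some: "\<exists>i'. snd st (P i ! m) = Some i'" if "m < fst st i" for m
    using inv i that unfolding gs_inv_def by auto
  define f where "f m = the (snd st (P i ! m))" for m
  have f: "snd st (P i ! m) = Some (f m)" if "m < fst st i" for m
    using some[OF that] by (auto simp: f_def)
  have "inj_on f {..<fst st i}"
  proof (rule inj_onI)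
    fix m m' assume m: "m \<in> {..<fst st i}" "m' \<in> {..<fst st i}" "f m = f m'"
    then have "P i ! m = P i ! m'"
      using f[of m] f[of m'] inv unfolding gs_inv_def by (metis lessThan_iff)
    then show "m = m'" using m le N_le_K P_nth_inject[OF i, of m m'] by simp
  qed
  moreover have "f ` {..<fst st i} \<subseteq> {..<N} - {i}"
    using f un inv unfolding gs_inv_def by force
  ultimately have "card {..<fst st i} \<le> card ({..<N} - {i})"
    by (intro card_inj_on_le) auto
  then show ?thesis using i by simp
qed

lemma gs_inv_init: "gs_inv (\<lambda>_. 0, \<lambda>_. None)"
  by (simp add: gs_inv_def)

lemma gs_step_cases:
  assumes inv: "gs_inv st"
  obtains (stop) "gs_step N K rk P st = st" "\<And>i. \<not> gs_free N K st i"
  | (single) i j where "i < N" "fst st i < N" "\<And>j. snd st j \<noteq> Some i" "j = P i ! fst st i" "j < K"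
      "snd st j = None" "gs_step N K rk P st = ((fst st)(i := Suc (fst st i)), (snd st)(j := Some i))"
  | (swap) i j i' where "i < N" "fst st i < N" "\<And>j. snd st j \<noteq> Some i" "j = P i ! fst st i" "j < K"
      "snd st j = Some i'" "i' < N" "i \<noteq> i'" "rk j i < rk j i'"
      "gs_step N K rk P st = ((fst st)(i := Suc (fst st i)), (snd st)(j := Some i))"
  | (reject) i j i' where "i < N" "fst st i < N" "\<And>j. snd st j \<noteq> Some i" "j = P i ! fst st i" "j < K"
      "snd st j = Some i'" "i' < N" "i \<noteq> i'" "rk j i' < rk j i"
      "gs_step N K rk P st = ((fst st)(i := Suc (fst st i)), snd st)"
proof (cases "\<exists>i. gs_free N K st i")
  case False
  then show ?thesis by (intro stop) (auto simp: gs_step_def)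
next
  case True
  define i where "i = (LEAST i. gs_free N K st i)"
  define j where "j = P i ! fst st i"
  from True have fr: "gs_free N K st i" unfolding i_def by (auto intro: LeastI)
  then have i: "i < N" "\<And>j. snd st j \<noteq> Some i" by (auto simp: gs_free_def)
  then have n: "fst st i < N" using gs_inv_unengaged[OF inv] by blast
  then have j: "j < K" using N_le_K P_nth_less[OF i(1)] by (simp add: j_def)
  have st: "gs_step N K rk P st = ((fst st)(i := Suc (fst st i)),
     (case snd st j of None \<Rightarrow> (snd st)(j := Some i)
              | Some i' \<Rightarrow> if rk j i < rk j i' then (snd st)(j := Some i) else snd st))"
    using True unfolding gs_step_def i_def[symmetric] j_def Let_def by simp
  show ?thesis
  proof (cases "snd st j")
    case None
    then show ?thesis using single[OF i(1) n i(2) j_def j] st by simp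
  next
    case (Some i')
    then have i': "i' < N" using inv unfolding gs_inv_def by blast
    have ne: "i \<noteq> i'" using i Some by blast
    show ?thesis
    proof (cases "rk j i < rk j i'")
      case True
      then show ?thesis using swap[OF i(1) n i(2) j_def j Some i' ne] st Some by simp
    next
      case False
      moreover have "rk j i \<noteq> rk j i'" using rk_inj[OF j] i(1) i' ne by (auto dest: inj_onD)
      ultimately show ?thesis using reject[OF i(1) n i(2) j_def j Some i' ne] st Some by simp
    qed
  qed
qed

lemma gs_inv_step:
  assumes inv: "gs_inv st"
  shows "gs_inv (gs_step N K rk P st)"
  using inv
proof (cases rule: gs_step_cases)
  case stop
  then show ?thesis using inv by simp
next
  case (single i j)
  have "P i'' ! m \<noteq> j" if "i'' < N" "m < fst st i''" for i'' m
    using that inv single unfolding gs_inv_def by metis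
  then show ?thesis using inv single unfolding gs_inv_def
    by (auto simp: less_Suc_eq)
next
  case (swap i j i')
  then show ?thesis using inv unfolding gs_inv_def
    by (auto simp: less_Suc_eq split: if_splits) (metis less_trans option.inject)+
next
  case (reject i j i')
  then show ?thesis using inv unfolding gs_inv_def
    by (auto simp: less_Suc_eq split: if_splits)
qed

definition gs_final :: "(nat \<Rightarrow> nat) \<times> (nat \<Rightarrow> nat option)" where
  "gs_final = (gs_step N K rk P ^^ (N * K)) (\<lambda>_. 0, \<lambda>_. None)"

lemma gs_inv_iter: "gs_inv ((gs_step N K rk P ^^ n) (\<lambda>_. 0, \<lambda>_. None))"
  by (induction n) (auto intro: gs_inv_init gs_inv_step)

text \<open>While somebody is free, every step makes exactly one proposal, and once nobody is free
  the state no longer changes. This shows that \<open>N * K\<close> iterations are enough.\<close>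

lemma gs_step_progress:
  "(\<exists>i. gs_free N K ((gs_step N K rk P ^^ n) (\<lambda>_. 0, \<lambda>_. None)) i) \<Longrightarrow>
   (\<Sum>i<N. fst ((gs_step N K rk P ^^ n) (\<lambda>_. 0, \<lambda>_. None)) i) \<ge> n"
proof (induction n)
  case (Suc n)
  let ?s = "(gs_step N K rk P ^^ n) (\<lambda>_. 0, \<lambda>_. None)"
  have sum: "(\<Sum>k<N. ((fst ?s)(i := Suc (fst ?s i))) k) = Suc (\<Sum>k<N. fst ?s k)" if "i < N" for i
    using that by (simp add: sum.remove[of "{..<N}" i])
  show ?case using gs_inv_iter[of n]
  proof (cases rule: gs_step_cases)
    case stop
    then show ?thesis using Suc.prems by simp
  next
    case (single i j)
    moreover from this have "gs_free N K ?s i" using N_le_K by (auto simp: gs_free_def)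
    ultimately show ?thesis using Suc.IH sum[of i] by auto
  next
    case (swap i j i')
    moreover from this have "gs_free N K ?s i" using N_le_K by (auto simp: gs_free_def)
    ultimately show ?thesis using Suc.IH sum[of i] by auto
  next
    case (reject i j i')
    moreover from this have "gs_free N K ?s i" using N_le_K by (auto simp: gs_free_def)
    ultimately show ?thesis using Suc.IH sum[of i] by auto
  qed
qed simp

lemma gs_final_inv: "gs_inv gs_final"
  unfolding gs_final_def by (rule gs_inv_iter)

lemma gs_final_engaged:
  assumes "i < N" shows "\<exists>j. snd gs_final j = Some i"
proof (rule ccontr)
  assume *: "\<not> (\<exists>j. snd gs_final j = Some i)"
  then have "fst gs_final i < N" using gs_inv_unengaged[OF gs_final_inv assms] by blast
  with * assms N_le_K have fr: "gs_free N K gs_final i" by (auto simp: gs_free_def)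
  then have "N * K \<le> (\<Sum>i<N. fst gs_final i)"
    using gs_step_progress[of "N * K"] unfolding gs_final_def[symmetric] by blast
  moreover have "(\<Sum>i<N. fst gs_final i) < (\<Sum>i<N. K)"
  proof (rule sum_strict_mono_ex1)
    show "\<forall>i\<in>{..<N}. fst gs_final i \<le> K"
      using gs_final_inv N_le_K unfolding gs_inv_def by auto
    show "\<exists>i\<in>{..<N}. fst gs_final i < K" using fr assms by (auto simp: gs_free_def)
  qed simp
  ultimately show False by simp
qed

lemma gs_final_unique: "snd gs_final j = Some i \<Longrightarrow> snd gs_final j' = Some i \<Longrightarrow> j = j'"
  using gs_final_inv unfolding gs_inv_def by metis

lemma gale_shapley_eq_Some:
  "gale_shapley N K rk P i = Some j \<longleftrightarrow> snd gs_final j = Some i"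
proof -
  have "snd gs_final j = Some i \<Longrightarrow> (THE j. snd gs_final j = Some i) = j" for j
    using gs_final_unique by blast
  then show ?thesis unfolding gale_shapley_def Let_def gs_final_def[symmetric] by auto
qed

lemma gale_shapley_last_proposal:
  assumes "i < N"
  obtains m where "m < N" "fst gs_final i = Suc m" "gale_shapley N K rk P i = Some (P i ! m)"
proof -
  obtain j where j: "snd gs_final j = Some i" using gs_final_engaged[OF assms] by blast
  then have "0 < fst gs_final i" "j = P i ! (fst gs_final i - 1)" "fst gs_final i \<le> N"
    using gs_final_inv assms unfolding gs_inv_def by blast+
  with j that[of "fst gs_final i - 1"] gale_shapley_eq_Some show thesis by simp
qed

lemma gale_shapley_matching: "matching_on N K (gale_shapley N K rk P)"
proof -
  have "i < N" "j < K" if "gale_shapley N K rk P i = Some j" for i j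
  proof -
    from that have j: "snd gs_final j = Some i" by (simp add: gale_shapley_eq_Some)
    then show "i < N" using gs_final_inv unfolding gs_inv_def by blast
    from gale_shapley_last_proposal[OF this] that N_le_K P_nth_less[OF this] show "j < K"
      by (metis less_le_trans option.inject)
  qed
  then show ?thesis unfolding matching_on_def
    by (auto simp: gale_shapley_eq_Some) 
qed

text \<open>The arm of a blocking pair would stand earlier in the list of \<open>i\<close> than its
  final arm. It has then received a proposal from \<open>i\<close>, so by the invariant it holds
  \<open>i\<close> or somebody it prefers.\<close>

lemma gale_shapley_stable:
  assumes sorted: "\<And>i m m'. i < N \<Longrightarrow> m < m' \<Longrightarrow> m' < K \<Longrightarrow> U i (P i ! m') \<le> U i (P i ! m)"
  shows "stable_matching N K rk U (gale_shapley N K rk P)"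
  unfolding stable_matching_def
proof (intro conjI gale_shapley_matching notI)
  assume "\<exists>i<N. \<exists>j<K. blocking_pair N rk U (gale_shapley N K rk P) i j"
  then obtain i j where ij: "i < N" "j < K" and b: "blocking_pair N rk U (gale_shapley N K rk P) i j"
    by blast
  obtain m where m: "m < N" "fst gs_final i = Suc m" "gale_shapley N K rk P i = Some (P i ! m)"
    using gale_shapley_last_proposal[OF ij(1)] .
  obtain q where q: "q < K" "P i ! q = j" using P_index[OF ij] .
  have U: "U i (P i ! q) > U i (P i ! m)" using b m(3) q by (simp add: blocking_pair_def)
  then have "q < m" using sorted[OF ij(1), of m q] q m(1) N_le_K
    by (metis linorder_neqE_nat not_less order_less_irrefl)
  then obtain i' where i': "snd gs_final j = Some i'" "i' = i \<or> rk j i' < rk j i"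
    using gs_final_inv ij(1) m(2) q(2) unfolding gs_inv_def by (metis less_SucI option.exhaust)
  have "i' \<noteq> i"
    using i' m(3) U q(2) gale_shapley_eq_Some gs_final_unique[of "P i ! q" i "P i ! m"] by auto
  moreover have "i' < N" using gs_final_inv i'(1) unfolding gs_inv_def by blast
  ultimately show False using b i' gale_shapley_eq_Some by (auto simp: blocking_pair_def)
qed

text \<open>Player-optimality by induction over the steps. The lists will come from estimates while
  \<open>U\<close> is the true utility, so the link between them is a hypothesis about the first
  \<open>N\<close> positions only; no proposal goes beyond these.\<close>

lemma gs_never_rejected_by_stable_partner:
  assumes strict: "\<And>i m m'. i < N \<Longrightarrow> m < N \<Longrightarrow> m < m' \<Longrightarrow> m' < K \<Longrightarrow> U i (P i ! m') < U i (P i ! m)"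
    and stable: "stable_matching N K rk U \<nu>"
  shows "i < N \<Longrightarrow> m < fst ((gs_step N K rk P ^^ n) (\<lambda>_. 0, \<lambda>_. None)) i \<Longrightarrow>
    snd ((gs_step N K rk P ^^ n) (\<lambda>_. 0, \<lambda>_. None)) (P i ! m) \<noteq> Some i \<Longrightarrow> \<nu> i \<noteq> Some (P i ! m)"
proof (induction n arbitrary: i m)
  case (Suc n)
  let ?s = "(gs_step N K rk P ^^ n) (\<lambda>_. 0, \<lambda>_. None)"
  note inv = gs_inv_iter[of n]
  have mu: "matching_on N K \<nu>" and nb: "\<And>i j. i < N \<Longrightarrow> j < K \<Longrightarrow> \<not> blocking_pair N rk U \<nu> i j"
    using stable by (auto simp: stable_matching_def)
  \<comment> \<open>If \<open>k\<close> has been rejected by every arm before position \<open>q\<close> of its list, then the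
    arm at position \<open>q\<close> cannot be matched by \<open>\<nu>\<close> to a player it likes less than \<open>k\<close>.\<close>
  have key: "\<nu> l \<noteq> Some (P k ! q)"
    if k: "k < N" "q < N" "l \<noteq> k" "rk (P k ! q) k < rk (P k ! q) l"
      and rej: "\<And>q'. q' < q \<Longrightarrow> \<nu> k \<noteq> Some (P k ! q')" for k q l
  proof
    assume l: "\<nu> l = Some (P k ! q)"
    have uni: "i' = l" if "\<nu> i' = Some (P k ! q)" for i' using mu l that unfolding matching_on_def by blast
    have "blocking_pair N rk U \<nu> k (P k ! q)"
    proof (cases "\<nu> k")
      case None
      then show ?thesis using uni k(4) by (auto simp: blocking_pair_def)
    next
      case (Some j')
      then have "j' < K" using mu by (auto simp: matching_on_def)
      then obtain q' where q': "q' < K" "P k ! q' = j'" using P_index[OF k(1)] by blast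
      have "q' \<noteq> q" using uni Some q' k(3) by auto
      moreover have "\<not> q' < q" using rej Some q' by auto
      ultimately have "U k (P k ! q') < U k (P k ! q)" using strict[OF k(1,2), of q'] q' by simp
      then show ?thesis using Some q' uni k(4) by (auto simp: blocking_pair_def)
    qed
    then show False using nb[OF k(1)] P_nth_less[OF k(1)] k(2) N_le_K by (meson less_le_trans)
  qed
  have IH': "\<nu> k \<noteq> Some (P k ! q)" if "k < N" "q < fst ?s k" "snd ?s (P k ! q) \<noteq> Some k" for k q
    using Suc.IH that by blast
  show ?case using inv
  proof (cases rule: gs_step_cases)
    case stop
    then show ?thesis using Suc by simp
  next
    case (single k j)
    have "P i ! m \<noteq> j" if "m < fst ?s i"
      using that inv single Suc.prems(1) unfolding gs_inv_def by metis
    then show ?thesis using Suc.prems single IH'[OF Suc.prems(1), of m]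
      by (auto simp: less_Suc_eq split: if_splits)
  next
    case (swap k j l)
    \<comment> \<open>The newcomer \<open>k\<close> was lost by all its earlier arms, so it would
      block any stable matching that gives \<open>j\<close> to the displaced
      \<open>l\<close>.\<close>
    have "\<nu> l \<noteq> Some j"
      unfolding swap(4) by (rule key) (use swap IH' in auto)
    then show ?thesis using Suc.prems swap IH'[OF Suc.prems(1), of m]
      by (auto simp: less_Suc_eq split: if_splits)
  next
    case (reject k j l)
    have l: "0 < fst ?s l" "j = P l ! (fst ?s l - 1)" "fst ?s l \<le> N"
      using inv reject unfolding gs_inv_def by blast+
    \<comment> \<open>The roles are exchanged: now the holder \<open>l\<close> would block. Its last
      proposal went to \<open>j\<close>, and it is no longer held by any arm before \<open>j\<close>
      in its list.\<close>
    have "\<nu> k \<noteq> Some (P l ! (fst ?s l - 1))"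
    proof (rule key)
      fix q' assume q': "q' < fst ?s l - 1"
      have "snd ?s (P l ! q') \<noteq> Some l"
      proof
        assume "snd ?s (P l ! q') = Some l"
        then have "P l ! q' = P l ! (fst ?s l - 1)" using inv unfolding gs_inv_def by blast
        then show False using P_nth_inject[OF reject(7), of q' "fst ?s l - 1"] q' l N_le_K by simp
      qed
      then show "\<nu> l \<noteq> Some (P l ! q')" using IH' reject(7) q' by simp
    qed (use reject l in auto)
    then show ?thesis using Suc.prems reject IH'[OF Suc.prems(1), of m] l
      by (auto simp: less_Suc_eq split: if_splits)
  qed
qed simp

end

text \<open>Makes the set under the maximum in \<open>opt_stable_util\<close> nonempty.\<close>

lemma stable_matching_exists:
  fixes U :: "nat \<Rightarrow> nat \<Rightarrow> real" and rk :: "nat \<Rightarrow> nat \<Rightarrow> nat"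
  assumes "N \<le> K" "\<And>j. j < K \<Longrightarrow> inj_on (rk j) {..<N}"
  shows "\<exists>\<mu>. stable_matching N K rk U \<mu>"
proof -
  define P where "P i = rev (sort_key (U i) [0..<K])" for i
  interpret gs_market N K rk P
    by unfold_locales (use assms in \<open>auto simp: P_def\<close>)
  have "sorted_wrt (\<lambda>a b. U i b \<le> U i a) (P i)" for i
    using sorted_sort_key[of "U i" "[0..<K]"]
    by (simp add: P_def sorted_wrt_rev sorted_map)
  then have "U i (P i ! m') \<le> U i (P i ! m)" if "i < N" "m < m'" "m' < K" for i m m'
    using that P_length[of i] by (auto simp: sorted_wrt_iff_nth_less)
  then have "stable_matching N K rk U (gale_shapley N K rk P)" by (rule gale_shapley_stable)
  from exI[of "stable_matching N K rk U", OF this] show ?thesis .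
qed

text \<open>The other \<open>N - 1\<close> players cannot occupy all of the at least
  \<open>N\<close> arms, so an unmatched player would block together with a vacant arm.\<close>

lemma stable_matching_total:
  assumes "N \<le> K" "stable_matching N K rk U \<mu>" "i < N"
  obtains j where "\<mu> i = Some j" "j < K"
proof -
  have mu: "matching_on N K \<mu>" and nb: "\<And>i j. i < N \<Longrightarrow> j < K \<Longrightarrow> \<not> blocking_pair N rk U \<mu> i j"
    using assms(2) by (auto simp: stable_matching_def)
  have "\<mu> i \<noteq> None"
  proof
    assume None: "\<mu> i = None"
    let ?A = "{i'. i' < N \<and> i' \<noteq> i}"
    have "?A = {..<N} - {i}" by auto
    then have "card ((\<lambda>i'. the (\<mu> i')) ` ?A) \<le> N - 1"
      using card_image_le[of ?A "\<lambda>i'. the (\<mu> i')"] assms(3) by simp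
    then have "\<not> {..<K} \<subseteq> (\<lambda>i'. the (\<mu> i')) ` ?A"
      using card_mono[of "(\<lambda>i'. the (\<mu> i')) ` ?A" "{..<K}"] assms(1,3) by auto
    then obtain j where j: "j < K" "j \<notin> (\<lambda>i'. the (\<mu> i')) ` ?A" by blast
    have "\<mu> i' \<noteq> Some j" if "i' < N" for i'
      using that j(2) None by (cases "i' = i") force+
    then have "blocking_pair N rk U \<mu> i j" using None by (auto simp: blocking_pair_def)
    then show False using nb j(1) assms(3) by blast
  qed
  then show thesis using that mu by (auto simp: matching_on_def)
qed

text \<open>The maximum is attained: the shares of \<open>i\<close> lie among its \<open>K\<close>
  utilities, and some stable matching exists.\<close>

lemma opt_stable_util_le:
  fixes U :: "nat \<Rightarrow> nat \<Rightarrow> real" and rk :: "nat \<Rightarrow> nat \<Rightarrow> nat"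
  assumes "N \<le> K" "\<And>j. j < K \<Longrightarrow> inj_on (rk j) {..<N}" "i < N"
    and le: "\<And>\<mu> j. stable_matching N K rk U \<mu> \<Longrightarrow> \<mu> i = Some j \<Longrightarrow> j < K \<Longrightarrow> U i j \<le> B"
  shows "opt_stable_util N K rk U i \<le> B"
proof -
  let ?A = "{match_util U \<mu> i | \<mu>. stable_matching N K rk U \<mu>}"
  have sub: "a \<in> U i ` {..<K} \<and> a \<le> B" if "a \<in> ?A" for a
  proof -
    from that obtain \<mu> where \<mu>: "a = match_util U \<mu> i" "stable_matching N K rk U \<mu>" by blast
    obtain j where "\<mu> i = Some j" "j < K" by (rule stable_matching_total[OF assms(1) \<mu>(2) assms(3)])
    then show ?thesis using le[OF \<mu>(2)] \<mu>(1) by (simp add: match_util_def)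
  qed
  then have fin: "finite ?A" by (intro finite_subset[of ?A "U i ` {..<K}"]) auto
  from stable_matching_exists[where U = U and rk = rk, OF assms(1,2)]
  obtain \<mu> where "stable_matching N K rk U \<mu>" ..
  then have "?A \<noteq> {}" by auto
  with fin have "Max ?A \<in> ?A" by (rule Max_in)
  from sub[OF this] show ?thesis unfolding opt_stable_util_def ..
qed

text \<open>Arms before the final one in the list of \<open>i\<close> were proposed to and lost, so
  no stable matching provides them; the arms behind it are worse for \<open>U\<close>.\<close>

lemma (in gs_market) opt_stable_util_le_gale_shapley:
  assumes strict: "\<And>i m m'. i < N \<Longrightarrow> m < N \<Longrightarrow> m < m' \<Longrightarrow> m' < K \<Longrightarrow> U i (P i ! m') < U i (P i ! m)"
    and i: "i < N"
  shows "opt_stable_util N K rk U i \<le> match_util U (gale_shapley N K rk P) i"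
proof (rule opt_stable_util_le[OF N_le_K rk_inj i])
  fix \<nu> j assume \<nu>: "stable_matching N K rk U \<nu>" "\<nu> i = Some j" "j < K"
  obtain m where m: "m < N" "fst gs_final i = Suc m" "gale_shapley N K rk P i = Some (P i ! m)"
    using gale_shapley_last_proposal[OF i] .
  obtain q where q: "q < K" "P i ! q = j" using P_index[OF i \<nu>(3)] .
  have "\<not> q < m"
  proof
    assume "q < m"
    then have "snd gs_final (P i ! q) \<noteq> Some i"
      using m(3) gale_shapley_eq_Some P_nth_inject[OF i, of q m] m(1) N_le_K q(1)
        gs_final_unique[of "P i ! q" i "P i ! m"] by auto
    then have "\<nu> i \<noteq> Some (P i ! q)"
      using gs_never_rejected_by_stable_partner[where U = U and \<nu> = \<nu> and n = "N * K" and i = i and m = q]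
        strict \<nu>(1) i \<open>q < m\<close> m(2)
      unfolding gs_final_def[symmetric] by simp
    then show False using \<nu>(2) q(2) by simp
  qed
  then show "U i j \<le> match_util U (gale_shapley N K rk P) i"
    using strict[OF i m(1), of q] m q by (cases "q = m") (auto simp: match_util_def)
qed

section \<open>Measurability of the BARB state\<close>

lemma borel_measurable_vecI:
  fixes f :: "'a \<Rightarrow> 'b::euclidean_space^'n"
  assumes "\<And>i. (\<lambda>x. f x $ i) \<in> borel_measurable M"
  shows "f \<in> borel_measurable M"
proof (subst borel_measurable_euclidean_space, intro ballI)
  fix b :: "'b^'n" assume "b \<in> Basis"
  then obtain i u where "b = axis i u" by (auto simp: Basis_vec_def)
  then show "(\<lambda>x. f x \<bullet> b) \<in> borel_measurable M"
    using borel_measurable_inner[OF assms[of i] borel_measurable_const[of u]] by (simp add: inner_axis)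
qed

lemma borel_measurable_vec_component:
  fixes f :: "'a \<Rightarrow> 'b::euclidean_space^'n"
  assumes "f \<in> borel_measurable M"
  shows "(\<lambda>x. f x $ i) \<in> borel_measurable M"
  by (rule borel_measurable_continuous_on[OF _ assms]) (intro continuous_intros)

lemma borel_measurable_matrix_vector_mult:
  fixes A :: "'a \<Rightarrow> real^'n^'m"
  assumes "A \<in> borel_measurable M" "x \<in> borel_measurable M"
  shows "(\<lambda>w. A w *v x w) \<in> borel_measurable M"
  by (rule borel_measurable_vecI)
     (auto simp: matrix_vector_mult_def intro!: borel_measurable_sum borel_measurable_times
       borel_measurable_vec_component assms)

lemma borel_measurable_det:
  fixes A :: "'a \<Rightarrow> real^'n^'n"
  assumes "A \<in> borel_measurable M"
  shows "(\<lambda>w. det (A w)) \<in> borel_measurable M"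
  unfolding det_def
  by (intro borel_measurable_sum borel_measurable_times borel_measurable_const borel_measurable_prod
      borel_measurable_vec_component assms)

text \<open>Cramer's rule writes the entries as quotients of determinants. For a singular matrix,
  \<open>matrix_inv\<close> chooses from a predicate that is always false, hence is one fixed
  matrix.\<close>

lemma borel_measurable_matrix_inv:
  fixes A :: "'a \<Rightarrow> real^'n^'n"
  assumes [measurable]: "A \<in> borel_measurable M"
  shows "(\<lambda>w. matrix_inv (A w)) \<in> borel_measurable M"
proof -
  note [measurable] = borel_measurable_det
  define B :: "real^'n^'n \<Rightarrow> real^'n^'n" where
    "B A = (\<chi> k l. det (\<chi> i j. if j = k then axis l 1 $ i else A $ i $ j) / det A)" for A
  define c :: "real^'n^'n" where "c = (SOME _. False)"
  have eq: "matrix_inv A = (if det A \<noteq> 0 then B A else c)" for A :: "real^'n^'n"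
  proof (cases "det A = 0")
    case True
    then have "(\<lambda>A'. A ** A' = mat 1 \<and> A' ** A = mat 1) = (\<lambda>_. False)"
      using invertible_det_nz[of A] unfolding invertible_def by blast
    then show ?thesis using True unfolding matrix_inv_def c_def by simp
  next
    case False
    then have "invertible A" by (simp add: invertible_det_nz)
    then have "A ** matrix_inv A = mat 1" by (rule matrix_inv_inverse)
    then have "A *v (matrix_inv A *v axis l 1) = axis l 1" for l
      by (simp add: matrix_vector_mul_assoc)
    then have "matrix_inv A *v axis l 1 =
       (\<chi> k. det (\<chi> i j. if j = k then axis l 1 $ i else A $ i $ j) / det A)" for l
      using cramer[OF False, of "matrix_inv A *v axis l 1" "axis l 1"] by blast
    then have "matrix_inv A $ k $ l = B A $ k $ l" for k l
      by (simp add: B_def vec_eq_iff matrix_vector_mult_basis column_def)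
    then show ?thesis using False by (simp add: vec_eq_iff)
  qed
  have comp: "(\<lambda>w. A w $ i $ j) \<in> borel_measurable M" for i j
    by (intro borel_measurable_vec_component assms)
  have "(\<lambda>w. (\<chi> i j. if j = k then axis l 1 $ i else A w $ i $ j) :: real^'n^'n)
      \<in> borel_measurable M" for k l
  proof (intro borel_measurable_vecI)
    fix i j
    have "(\<lambda>w. if j = k then axis l 1 $ i else A w $ i $ j) \<in> borel_measurable M"
      by (cases "j = k") (auto simp: comp)
    then show "(\<lambda>w. ((\<chi> i j. if j = k then axis l 1 $ i else A w $ i $ j) :: real^'n^'n) $ i $ j)
      \<in> borel_measurable M" by simp
  qed
  then have "(\<lambda>w. B (A w)) \<in> borel_measurable M"
    unfolding B_def
    by (intro borel_measurable_vecI) (simp add: borel_measurable_det borel_measurable_divide assms)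
  then show ?thesis unfolding eq by measurable
qed

lemma borel_measurable_outer_prod:
  assumes "x \<in> borel_measurable M"
  shows "(\<lambda>w. outer_prod (x w)) \<in> borel_measurable M"
  by (intro borel_measurable_vecI)
     (simp add: outer_prod_def borel_measurable_vec_component[OF assms] borel_measurable_times)

lemma borel_measurable_vnorm_inv:
  assumes "A \<in> borel_measurable M" "x \<in> borel_measurable M"
  shows "(\<lambda>w. vnorm_inv (A w) (x w)) \<in> borel_measurable M"
  unfolding vnorm_inv_def
  by (intro measurable_compose[OF _ borel_measurable_sqrt] borel_measurable_inner borel_measurable_matrix_vector_mult
      borel_measurable_matrix_inv assms)

lemma sorted_desc_nth_greater_iff:
  fixes L :: "real list"
  shows "sorted_wrt (\<ge>) L \<Longrightarrow> m < length L \<Longrightarrow> L ! m > a \<longleftrightarrow> m < length (filter (\<lambda>x. a < x) L)"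
proof (induction L arbitrary: m)
  case (Cons x L)
  show ?case
  proof (cases "a < x")
    case True
    have "L ! k > a \<longleftrightarrow> k < length (filter (\<lambda>x. a < x) L)" if "k < length L" for k
      using Cons.prems(1) that by (intro Cons.IH) simp_all
    then show ?thesis using True Cons.prems(2) by (cases m) simp_all
  next
    case False
    have le: "y \<le> x" if "y \<in> set (x # L)" for y using Cons.prems(1) that by auto
    then have "\<not> a < y" if "y \<in> set L" for y using False that by (meson le_less_trans less_le_trans list.set_intros(2) not_less)
    then have "filter (\<lambda>x. a < x) L = []" by (simp add: filter_empty_conv)
    moreover have "\<not> a < (x # L) ! m"
      using le[OF nth_mem[OF Cons.prems(2)]] False by linarith
    ultimately show ?thesis using False by simp
  qed
qed simp

text \<open>The entry at position \<open>m\<close> in decreasing order exceeds \<open>a\<close> iff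
  more than \<open>m\<close> of the values do, and this count is a sum of indicators.\<close>

lemma borel_measurable_sorted_nth:
  fixes f :: "'a \<Rightarrow> nat \<Rightarrow> real"
  assumes f: "\<And>j. j < K \<Longrightarrow> (\<lambda>w. f w j) \<in> borel_measurable M" and m: "m < K"
  shows "(\<lambda>w. rev (sort (map (f w) [0..<K])) ! m) \<in> borel_measurable M"
proof (subst borel_measurable_iff_greater, intro allI)
  fix a
  have eq: "a < rev (sort (map g [0..<K])) ! m \<longleftrightarrow> real m < (\<Sum>j<K. if a < g j then 1 else 0)"
    for g :: "nat \<Rightarrow> real"
  proof -
    let ?L = "rev (sort (map g [0..<K]))"
    have "sorted_wrt (\<ge>) ?L" by (simp only: sorted_wrt_rev sorted_sort)
    then have "a < ?L ! m \<longleftrightarrow> m < length (filter (\<lambda>x. a < x) ?L)"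
      using m by (intro sorted_desc_nth_greater_iff) simp_all
    also have "length (filter (\<lambda>x. a < x) ?L) = length (filter (\<lambda>x. a < x) (map g [0..<K]))"
      by (simp only: size_mset[symmetric] mset_filter mset_rev mset_sort)
    also have "\<dots> = card {j. j < K \<and> a < g j}"
      unfolding length_filter_conv_card by (intro arg_cong[where f = card]) auto
    also have "m < \<dots> \<longleftrightarrow> real m < (\<Sum>j<K. if a < g j then 1 else 0)"
      by (simp add: sum.If_cases Int_def)
    finally show ?thesis .
  qed
  have "(\<lambda>w. \<Sum>j<K. if a < f w j then 1 else 0 :: real) \<in> borel_measurable M"
  proof (intro borel_measurable_sum)
    fix j assume "j \<in> {..<K}"
    then have [measurable]: "(\<lambda>w. f w j) \<in> borel_measurable M" using f by simp
    show "(\<lambda>w. if a < f w j then 1 else 0 :: real) \<in> borel_measurable M" by measurable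
  qed
  then show "{w \<in> space M. a < rev (sort (map (f w) [0..<K])) ! m} \<in> sets M"
    unfolding eq by measurable
qed

section \<open>The BARB recursion and its componentwise measurability\<close>

type_synonym 'd ctx = "nat \<Rightarrow> real^'d"

type_synonym 'd outcome = "nat \<Rightarrow> (nat \<Rightarrow> real^'d) \<times> (nat \<times> nat \<Rightarrow> real)"

locale barb =
  fixes N K :: nat and rk :: "nat \<Rightarrow> nat \<Rightarrow> nat" and \<theta> :: "nat \<Rightarrow> real^'d"
    and mm :: "(nat \<times> nat) set \<Rightarrow> (nat \<Rightarrow> nat option)"
    and plist :: "(nat \<Rightarrow> nat \<Rightarrow> real) \<Rightarrow> nat \<Rightarrow> nat list"
    and T :: nat and eta lam \<Delta>1 :: real
  assumes N_le_K: "N \<le> K" and rk_inj: "\<And>j. j < K \<Longrightarrow> inj_on (rk j) {..<N}"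
    and mm: "mm_oracle N K mm" and plist: "pref_lists_ok N K plist"
    and T2: "2 \<le> T" and lam: "lam > 0" and \<Delta>1: "\<Delta>1 > 0"
begin

definition expl :: "'d barb_state \<Rightarrow> 'd ctx \<Rightarrow> (nat \<times> nat) set" where
  "expl s c = {(i, j). i < N \<and> j < K \<and> vnorm_inv (st_V s i) (c j) > st_Delta s / eta}"

definition est_util :: "'d barb_state \<Rightarrow> 'd ctx \<Rightarrow> nat \<Rightarrow> nat \<Rightarrow> real" where
  "est_util s c i j = (matrix_inv (st_V s i) *v st_b s i) \<bullet> c j"

definition close :: "'d barb_state \<Rightarrow> 'd ctx \<Rightarrow> bool" where
  "close s c \<longleftrightarrow> (\<exists>i<N. \<exists>m. Suc m < min (Suc N) K \<and>
     rev (sort (map (est_util s c i) [0..<K])) ! m - rev (sort (map (est_util s c i) [0..<K])) ! Suc m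
       \<le> 2 * st_Delta s)"

definition play :: "'d barb_state \<Rightarrow> 'd ctx \<Rightarrow> nat \<Rightarrow> nat option" where
  "play s c = (if expl s c \<noteq> {} then mm (expl s c) else gale_shapley N K rk (plist (est_util s c)))"

text \<open>The state just before the end-of-batch test. Bounds within a batch are proved for it,
  and the possible reset is treated afterwards.\<close>

definition mid :: "'d barb_state \<Rightarrow> 'd ctx \<Rightarrow> (nat \<times> nat \<Rightarrow> real) \<Rightarrow> 'd barb_state" where
  "mid s c e = (if expl s c \<noteq> {} then
      s\<lparr>st_V := (\<lambda>i. case mm (expl s c) i of None \<Rightarrow> st_V s i | Some j \<Rightarrow> st_V s i + outer_prod (c j)),
        st_b := (\<lambda>i. case mm (expl s c) i of None \<Rightarrow> st_b s i
                     | Some j \<Rightarrow> st_b s i + (\<theta> i \<bullet> c j + e (i, j)) *\<^sub>R c j)\<rparr>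
    else if close s c then s\<lparr>st_Nk := Suc (st_Nk s)\<rparr> else s)"

abbreviation logT :: real where
  "logT \<equiv> ln (real T)"

definition threshold :: "real \<Rightarrow> real" where
  "threshold D = 3 * logT / (16 * D\<^sup>2)"

definition step :: "'d barb_state \<Rightarrow> 'd ctx \<Rightarrow> (nat \<times> nat \<Rightarrow> real) \<Rightarrow> 'd barb_state" where
  "step s c e = (if real (st_Nk (mid s c e)) > threshold (st_Delta s)
     then batch_init lam (st_Delta s / sqrt 2) else mid s c e)"

lemma mid_Delta [simp]: "st_Delta (mid s c e) = st_Delta s"
  by (simp add: mid_def)

lemma barb_round_eq: "barb_round N K rk \<theta> mm plist T eta lam s c e = (play s c, step s c e)"
proof -
  have ex: "{(i, j). i < N \<and> j < K \<and> st_Delta s / eta < vnorm_inv (st_V s i) (c j)} = expl s c"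
    by (simp add: expl_def)
  have es: "(\<lambda>i j. (matrix_inv (st_V s i) *v st_b s i) \<bullet> c j) = est_util s c"
    by (simp add: est_util_def fun_eq_iff)
  show ?thesis
    unfolding barb_round_def Let_def ex es step_def threshold_def
    by (simp add: mid_def play_def close_def split: if_split)
qed

abbreviation state :: "'d outcome \<Rightarrow> nat \<Rightarrow> 'd barb_state" where
  "state w n \<equiv> barb_states N K rk \<theta> mm plist T eta lam \<Delta>1 w n"

lemma state_Suc: "state w (Suc n) = step (state w n) (fst (w (Suc n))) (snd (w (Suc n)))"
  by (simp add: barb_round_eq)

lemma barb_matching_eq:
  "barb_matching N K rk \<theta> mm plist T eta lam \<Delta>1 w t = play (state w (t - 1)) (fst (w t))"
  by (simp add: barb_matching_def barb_round_eq)

lemma mm_Some: "mm (expl s c) i = Some j \<Longrightarrow> (i, j) \<in> expl s c"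
  and mm_matching: "matching_on N K (mm (expl s c))"
  and mm_nonempty: "expl s c \<noteq> {} \<Longrightarrow> \<exists>i j. mm (expl s c) i = Some j"
proof -
  have sub: "expl s c \<subseteq> {..<N} \<times> {..<K}" by (auto simp: expl_def)
  then have m: "is_max_matching N K (expl s c) (mm (expl s c))" using mm by (auto simp: mm_oracle_def)
  then show "mm (expl s c) i = Some j \<Longrightarrow> (i, j) \<in> expl s c" by (simp add: is_max_matching_def)
  show "matching_on N K (mm (expl s c))" using m by (simp add: is_max_matching_def)
  show "\<exists>i j. mm (expl s c) i = Some j" if "expl s c \<noteq> {}"
  proof -
    from that obtain i j where ij: "(i, j) \<in> expl s c" by auto
    let ?\<mu> = "(\<lambda>_. None)(i := Some j)"
    have "matching_on N K ?\<mu>" "\<forall>i' j'. ?\<mu> i' = Some j' \<longrightarrow> (i', j') \<in> expl s c"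
      using ij sub by (auto simp: matching_on_def split: if_splits)
    then have "card {i'. ?\<mu> i' \<noteq> None} \<le> card {i. mm (expl s c) i \<noteq> None}"
      using m unfolding is_max_matching_def by blast
    moreover have "{i'. ?\<mu> i' \<noteq> None} = {i}" by auto
    ultimately have "{i. mm (expl s c) i \<noteq> None} \<noteq> {}" by (metis One_nat_def card.empty card.insert empty_iff finite.emptyI not_one_le_zero)
    then show ?thesis by auto
  qed
qed

lemma gs_market_plist: "gs_market N K rk (plist u)"
  by unfold_locales (use N_le_K rk_inj plist in \<open>auto simp: pref_lists_ok_def\<close>)

lemma play_lessK: "play s c i = Some j \<Longrightarrow> j < K"
proof -
  interpret gs_market N K rk "plist (est_util s c)" by (rule gs_market_plist)
  show "play s c i = Some j \<Longrightarrow> j < K"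
    using mm_matching[of s c] gale_shapley_matching by (auto simp: play_def matching_on_def split: if_splits)
qed

text \<open>The record type carries no sigma-algebra, so measurability is required of each
  component.\<close>

definition state_measurable :: "'a measure \<Rightarrow> ('a \<Rightarrow> 'd barb_state) \<Rightarrow> bool" where
  "state_measurable M X \<longleftrightarrow> (\<lambda>w. st_Delta (X w)) \<in> borel_measurable M \<and>
     (\<forall>i. (\<lambda>w. st_V (X w) i) \<in> borel_measurable M) \<and> (\<forall>i. (\<lambda>w. st_b (X w) i) \<in> borel_measurable M) \<and>
     (\<lambda>w. st_Nk (X w)) \<in> measurable M (count_space UNIV)"

lemma state_measurableD:
  assumes "state_measurable M X"
  shows "(\<lambda>w. st_Delta (X w)) \<in> borel_measurable M" "(\<lambda>w. st_V (X w) i) \<in> borel_measurable M"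
    "(\<lambda>w. st_b (X w) i) \<in> borel_measurable M" "(\<lambda>w. st_Nk (X w)) \<in> measurable M (count_space UNIV)"
  using assms by (auto simp: state_measurable_def)

lemma state_measurable_If:
  assumes [measurable]: "Measurable.pred M P" and "state_measurable M X" "state_measurable M Y"
  shows "state_measurable M (\<lambda>w. if P w then X w else Y w)"
  using assms(2,3) unfolding state_measurable_def
    if_distrib[where f = st_Delta] if_distrib[where f = st_Nk]
    if_distrib[where f = "\<lambda>s. st_V s _"] if_distrib[where f = "\<lambda>s. st_b s _"]
  by (auto intro!: measurable_If simp: pred_def[symmetric])

lemma state_measurable_batch_init:
  "f \<in> borel_measurable M \<Longrightarrow> state_measurable M (\<lambda>w. batch_init lam (f w))"
  by (simp add: state_measurable_def batch_init_def)

text \<open>The target is a finite discrete space, so composing with \<open>mm\<close> preserves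
  measurability for every oracle.\<close>

lemma expl_measurable:
  assumes "state_measurable M X" "\<And>j. j < K \<Longrightarrow> (\<lambda>w. C w j) \<in> borel_measurable M"
  shows "(\<lambda>w. expl (X w) (C w)) \<in> measurable M (count_space (Pow ({..<N} \<times> {..<K})))"
proof (subst measurable_count_space_eq2, simp, intro conjI ballI)
  show "(\<lambda>w. expl (X w) (C w)) \<in> space M \<rightarrow> Pow ({..<N} \<times> {..<K})"
    by (auto simp: expl_def)
  fix A assume A: "A \<in> Pow ({..<N} \<times> {..<K})"
  have lt: "Measurable.pred M (\<lambda>w. st_Delta (X w) / eta < vnorm_inv (st_V (X w) i) (C w j))"
    if "j < K" for i j
  proof -
    have [measurable]: "(\<lambda>w. vnorm_inv (st_V (X w) i) (C w j)) \<in> borel_measurable M"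
      using that assms(2) by (intro borel_measurable_vnorm_inv state_measurableD[OF assms(1)])
    note [measurable] = state_measurableD(1)[OF assms(1)]
    show ?thesis by measurable
  qed
  have "(\<lambda>w. expl (X w) (C w)) -` {A} \<inter> space M = {w\<in>space M. \<forall>i\<in>{..<N}. \<forall>j\<in>{..<K}.
      st_Delta (X w) / eta < vnorm_inv (st_V (X w) i) (C w j) \<longleftrightarrow> (i, j) \<in> A}"
    using A by (auto simp: expl_def set_eq_iff)
  also have "\<dots> \<in> sets M"
    unfolding pred_def[symmetric]
    by (intro pred_intros_finite(3) pred_intros_logic lt) auto
  finally show "(\<lambda>w. expl (X w) (C w)) -` {A} \<inter> space M \<in> sets M" .
qed

lemma expl_nonempty_measurable:
  assumes "state_measurable M X" "\<And>j. j < K \<Longrightarrow> (\<lambda>w. C w j) \<in> borel_measurable M"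
  shows "Measurable.pred M (\<lambda>w. expl (X w) (C w) \<noteq> {})"
  by (rule measurable_compose[OF expl_measurable[where X = X and C = C, OF assms]]) auto

lemma est_util_measurable:
  assumes "state_measurable M X" "(\<lambda>w. C w j) \<in> borel_measurable M"
  shows "(\<lambda>w. est_util (X w) (C w) i j) \<in> borel_measurable M"
  unfolding est_util_def using assms
  by (intro borel_measurable_inner borel_measurable_matrix_vector_mult borel_measurable_matrix_inv
      state_measurableD)

lemma close_measurable:
  assumes "state_measurable M X" "\<And>j. j < K \<Longrightarrow> (\<lambda>w. C w j) \<in> borel_measurable M"
  shows "Measurable.pred M (\<lambda>w. close (X w) (C w))"
proof -
  have L: "(\<lambda>w. rev (sort (map (est_util (X w) (C w) i) [0..<K])) ! m) \<in> borel_measurable M"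
    if "m < K" for i m
    by (intro borel_measurable_sorted_nth that est_util_measurable assms)
  have eq: "close (X w) (C w) \<longleftrightarrow> (\<exists>i\<in>{..<N}. \<exists>m\<in>{m. Suc m < min (Suc N) K}.
     rev (sort (map (est_util (X w) (C w) i) [0..<K])) ! m
     - rev (sort (map (est_util (X w) (C w) i) [0..<K])) ! Suc m \<le> 2 * st_Delta (X w))" for w
    unfolding close_def by auto
  have fin: "finite {m. Suc m < min (Suc N) K}" by (rule finite_subset[of _ "{..<K}"]) auto
  have le: "Measurable.pred M (\<lambda>w. rev (sort (map (est_util (X w) (C w) i) [0..<K])) ! m
     - rev (sort (map (est_util (X w) (C w) i) [0..<K])) ! Suc m \<le> 2 * st_Delta (X w))"
    if "Suc m < K" for i m
  proof -
    note [measurable] = state_measurableD(1)[OF assms(1)]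
    have [measurable]: "(\<lambda>w. rev (sort (map (est_util (X w) (C w) i) [0..<K])) ! m) \<in> borel_measurable M"
      "(\<lambda>w. rev (sort (map (est_util (X w) (C w) i) [0..<K])) ! Suc m) \<in> borel_measurable M"
      using that by (auto intro!: L)
    show ?thesis by measurable
  qed
  show ?thesis unfolding eq
    by (rule pred_intros_finite(4), simp, rule pred_intros_finite(4), rule fin, rule le, simp)
qed

lemma mid_measurable:
  assumes X: "state_measurable M X" and C: "\<And>j. j < K \<Longrightarrow> (\<lambda>w. C w j) \<in> borel_measurable M"
    and E: "\<And>i j. i < N \<Longrightarrow> j < K \<Longrightarrow> (\<lambda>w. E w (i, j)) \<in> borel_measurable M"
  shows "state_measurable M (\<lambda>w. mid (X w) (C w) (E w))"
proof -
  note ne = expl_nonempty_measurable[where X = X and C = C, OF X C]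
  note cl = close_measurable[where X = X and C = C, OF X C]
  note eX = expl_measurable[where X = X and C = C, OF X C]
  \<comment> \<open>The finite set of possible partners of \<open>i\<close>; over it the case
    distinction on the matching becomes a countable composition.\<close>
  define I where "I i = (if i < N then insert None (Some ` {..<K}) else {None})" for i
  have mmI: "(\<lambda>w. mm (expl (X w) (C w)) i) \<in> measurable M (count_space (I i))" for i
  proof (rule measurable_compose[OF eX])
    have "mm A i \<in> I i" if "A \<subseteq> {..<N} \<times> {..<K}" for A
    proof -
      from that have "is_max_matching N K A (mm A)" using mm by (simp add: mm_oracle_def)
      then have "matching_on N K (mm A)" by (simp only: is_max_matching_def)
      then show ?thesis by (cases "mm A i") (auto simp: matching_on_def I_def)
    qed
    then show "(\<lambda>x. mm x i) \<in> count_space (Pow ({..<N} \<times> {..<K})) \<rightarrow>\<^sub>M count_space (I i)" by simp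
  qed
  have cI: "countable (I i)" for i by (simp add: I_def)
  have V: "(\<lambda>w. case mm (expl (X w) (C w)) i of None \<Rightarrow> st_V (X w) i
      | Some j \<Rightarrow> st_V (X w) i + outer_prod (C w j)) \<in> borel_measurable M" for i
  proof (rule measurable_compose_countable'[where f = "\<lambda>o' w. case o' of None \<Rightarrow> st_V (X w) i
      | Some j \<Rightarrow> st_V (X w) i + outer_prod (C w j)" and g = "\<lambda>w. mm (expl (X w) (C w)) i" and I = "I i"])
    fix o' assume "o' \<in> I i"
    then show "(\<lambda>w. case o' of None \<Rightarrow> st_V (X w) i
      | Some j \<Rightarrow> st_V (X w) i + outer_prod (C w j)) \<in> borel_measurable M"
    proof (cases o')
      case (Some j)
      with \<open>o' \<in> I i\<close> have "j < K" by (auto simp: I_def split: if_splits)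
      have "(\<lambda>w. st_V (X w) i + outer_prod (C w j)) \<in> borel_measurable M"
        by (rule borel_measurable_add[OF state_measurableD(2)[OF X]
              borel_measurable_outer_prod[OF C[OF \<open>j < K\<close>]]])
      then show ?thesis by (simp only: Some option.case)
    qed (simp only: option.case state_measurableD(2)[OF X])
  qed (rule mmI cI)+
  have B: "(\<lambda>w. case mm (expl (X w) (C w)) i of None \<Rightarrow> st_b (X w) i
      | Some j \<Rightarrow> st_b (X w) i + (\<theta> i \<bullet> C w j + E w (i, j)) *\<^sub>R C w j) \<in> borel_measurable M" for i
  proof (rule measurable_compose_countable'[where f = "\<lambda>o' w. case o' of None \<Rightarrow> st_b (X w) i
      | Some j \<Rightarrow> st_b (X w) i + (\<theta> i \<bullet> C w j + E w (i, j)) *\<^sub>R C w j" and g = "\<lambda>w. mm (expl (X w) (C w)) i" and I = "I i"])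
    fix o' assume "o' \<in> I i"
    then show "(\<lambda>w. case o' of None \<Rightarrow> st_b (X w) i
      | Some j \<Rightarrow> st_b (X w) i + (\<theta> i \<bullet> C w j + E w (i, j)) *\<^sub>R C w j) \<in> borel_measurable M"
    proof (cases o')
      case (Some j)
      with \<open>o' \<in> I i\<close> have j: "i < N" "j < K" by (auto simp: I_def split: if_splits)
      note [measurable] = C[OF j(2)] E[OF j] state_measurableD(3)[OF X]
      have "(\<lambda>w. st_b (X w) i + (\<theta> i \<bullet> C w j + E w (i, j)) *\<^sub>R C w j) \<in> borel_measurable M"
        by measurable
      then show ?thesis by (simp only: Some option.case)
    qed (simp only: option.case state_measurableD(3)[OF X])
  qed (rule mmI cI)+
  show ?thesis
    unfolding mid_def
  proof (rule state_measurable_If[OF ne _ state_measurable_If[OF cl _ X]])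
    show "state_measurable M (\<lambda>w. (X w)\<lparr>
        st_V := (\<lambda>i. case mm (expl (X w) (C w)) i of None \<Rightarrow> st_V (X w) i
            | Some j \<Rightarrow> st_V (X w) i + outer_prod (C w j)),
        st_b := (\<lambda>i. case mm (expl (X w) (C w)) i of None \<Rightarrow> st_b (X w) i
            | Some j \<Rightarrow> st_b (X w) i + (\<theta> i \<bullet> C w j + E w (i, j)) *\<^sub>R C w j)\<rparr>)"
      using X V B by (simp add: state_measurable_def)
    show "state_measurable M (\<lambda>w. (X w)\<lparr>st_Nk := Suc (st_Nk (X w))\<rparr>)"
      using X measurable_compose[OF state_measurableD(4)[OF X], of Suc "count_space UNIV"]
      by (simp add: state_measurable_def)
  qed
qed

lemma step_measurable:
  assumes X: "state_measurable M X" and C: "\<And>j. j < K \<Longrightarrow> (\<lambda>w. C w j) \<in> borel_measurable M"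
    and E: "\<And>i j. i < N \<Longrightarrow> j < K \<Longrightarrow> (\<lambda>w. E w (i, j)) \<in> borel_measurable M"
  shows "state_measurable M (\<lambda>w. step (X w) (C w) (E w))"
proof -
  note mid = mid_measurable[where X = X and C = C and E = E, OF X C E]
  note [measurable] = state_measurableD[OF X] state_measurableD[OF mid]
  have "Measurable.pred M (\<lambda>w. real (st_Nk (mid (X w) (C w) (E w))) > threshold (st_Delta (X w)))"
    unfolding threshold_def by measurable
  then show ?thesis unfolding step_def
    using state_measurableD(1)[OF X]
    by (intro state_measurable_If state_measurable_batch_init mid borel_measurable_divide
        borel_measurable_const)
qed

lemma state_measurable_state:
  assumes C: "\<And>t j. t \<in> {1..n} \<Longrightarrow> j < K \<Longrightarrow> (\<lambda>w. fst (W w t) j) \<in> borel_measurable M"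
    and E: "\<And>t i j. t \<in> {1..n} \<Longrightarrow> i < N \<Longrightarrow> j < K \<Longrightarrow> (\<lambda>w. snd (W w t) (i, j)) \<in> borel_measurable M"
  shows "state_measurable M (\<lambda>w. state (W w) n)"
  using assms
proof (induction n)
  case 0
  then show ?case by (simp add: state_measurable_batch_init)
next
  case (Suc n)
  have "state_measurable M (\<lambda>w. state (W w) n)" by (rule Suc.IH; rule Suc.prems; simp)
  then show ?case unfolding state_Suc
    by (rule step_measurable) (simp_all add: Suc.prems)
qed

end

section \<open>One round of BARB\<close>

context barb
begin

abbreviation V0 :: "real^'d^'d" where
  "V0 \<equiv> mat lam"

definition util :: "'d ctx \<Rightarrow> nat \<Rightarrow> nat \<Rightarrow> real" where
  "util c i j = \<theta> i \<bullet> c j"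

definition gap :: "'d barb_state \<Rightarrow> 'd ctx \<Rightarrow> nat \<Rightarrow> real" where
  "gap s c i = opt_stable_util N K rk (util c) i - match_util (util c) (play s c) i"

abbreviation total_gap :: "nat \<Rightarrow> 'd outcome \<Rightarrow> real" where
  "total_gap i w \<equiv> \<Sum>t\<in>{1..T}. gap (state w (t - 1)) (fst (w t)) i"

end

text \<open>Positivity of \<open>eta\<close> keeps the exploration threshold
  \<open>st_Delta s / eta\<close> meaningful. It can fail only for \<open>B\<theta>\<close> = 0,
  which the final proof treats separately.\<close>

locale barb_bounded = barb N K rk \<theta> mm plist T eta lam \<Delta>1
  for N K rk and \<theta> :: "nat \<Rightarrow> real^'d" and mm plist T eta lam \<Delta>1 +
  fixes R Bx B\<theta> :: real
  assumes R: "R \<ge> 0" and Bx: "Bx \<ge> 0" and B\<theta>: "B\<theta> \<ge> 0" and BB: "2 * B\<theta> * Bx \<le> 1"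
    and \<theta>_le: "\<And>i. i < N \<Longrightarrow> norm (\<theta> i) \<le> B\<theta>" and eta_pos: "eta > 0"
    and eta_eq: "eta = R * sqrt (real CARD('d) * ln ((1 + real T * Bx\<^sup>2 / lam) * (real T)\<^sup>2)) + sqrt lam * B\<theta>"
begin

abbreviation growth :: real where
  "growth \<equiv> 1 + real T * Bx\<^sup>2 / lam"

definition radius :: real where
  "radius = sqrt (real CARD('d) * ln (growth * (real T)\<^sup>2))"

text \<open>The sum of noise times context over the exploration rounds of player \<open>i\<close> in
  the current batch, recovered from the state alone.\<close>

definition noise_sum :: "'d barb_state \<Rightarrow> nat \<Rightarrow> real^'d" where
  "noise_sum s i = st_b s i - st_V s i *v \<theta> i + lam *\<^sub>R \<theta> i"

definition confident :: "'d barb_state \<Rightarrow> bool" where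
  "confident s \<longleftrightarrow> (\<forall>i<N. vnorm_inv (st_V s i) (noise_sum s i) \<le> R * radius)"

definition bounded_ctx :: "'d ctx \<Rightarrow> bool" where
  "bounded_ctx c \<longleftrightarrow> (\<forall>j<K. norm (c j) \<le> Bx)"

definition cost :: "'d barb_state \<Rightarrow> 'd ctx \<Rightarrow> real" where
  "cost s c = (if expl s c \<noteq> {} \<or> close s c then 1 else 0)"

definition near :: "real \<Rightarrow> 'd ctx \<Rightarrow> bool" where
  "near D c \<longleftrightarrow> (\<exists>i<N. \<exists>j<K. \<exists>j'<K. j \<noteq> j' \<and> \<bar>\<theta> i \<bullet> (c j - c j')\<bar> < D)"

text \<open>The lower bound on \<open>st_Delta\<close> limits the number of batches. A batch ends
  only after more than \<open>3 log T / (16 \<Delta>^2)\<close> close rounds, of which there are at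
  most \<open>T\<close>, and the reset then halves \<open>\<Delta>^2\<close>: hence the 32.\<close>

definition valid :: "nat \<Rightarrow> 'd barb_state \<Rightarrow> bool" where
  "valid n s \<longleftrightarrow> 0 < st_Delta s \<and> st_Delta s \<le> \<Delta>1 \<and>
     (st_Delta s)\<^sup>2 \<ge> min (\<Delta>1\<^sup>2) (3 * logT / (32 * real T)) \<and>
     real (st_Nk s) \<le> threshold (st_Delta s) \<and> st_Nk s \<le> n"

definition valid_V :: "nat \<Rightarrow> 'd barb_state \<Rightarrow> bool" where
  "valid_V n s \<longleftrightarrow> (\<forall>i. sym_between lam (lam + real n * Bx\<^sup>2) (st_V s i))"

lemma lnT: "logT > 0" using T2 by simp

lemma threshold_nonneg: "threshold D \<ge> 0"
  using lnT by (simp add: threshold_def)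

lemma valid_init: "valid n (batch_init lam \<Delta>1)"
  using \<Delta>1 threshold_nonneg by (simp add: valid_def batch_init_def)

lemma sqrt2_div_le: "x / sqrt 2 \<le> x" if "x \<ge> 0" for x :: real
  using that by (auto simp: divide_le_eq mult_le_cancel_left1)

lemma valid_step:
  assumes s: "valid n s" and n: "n < T"
  shows "valid (Suc n) (step s c e)"
proof (cases "real (st_Nk (mid s c e)) > threshold (st_Delta s)")
  case False
  moreover have "st_Nk (mid s c e) \<le> Suc n" using s by (auto simp: mid_def valid_def)
  ultimately show ?thesis using s by (simp add: step_def valid_def)
next
  case True
  have D: "0 < st_Delta s" "st_Delta s \<le> \<Delta>1" using s by (auto simp: valid_def)
  have "real (st_Nk (mid s c e)) \<le> real T" using s n by (auto simp: mid_def valid_def)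
  with True have "3 * logT / (16 * (st_Delta s)\<^sup>2) \<le> real T" by (simp add: threshold_def)
  then have "3 * logT \<le> real T * (16 * (st_Delta s)\<^sup>2)"
    using D(1) by (subst (asm) pos_divide_le_eq) simp_all
  then have "3 * logT / (32 * real T) \<le> (st_Delta s)\<^sup>2 / 2"
    using T2 by (subst pos_divide_le_eq) simp_all
  also have "\<dots> = (st_Delta s / sqrt 2)\<^sup>2" by (simp add: power_divide)
  finally have sq: "3 * logT / (32 * real T) \<le> (st_Delta s / sqrt 2)\<^sup>2" .
  have pos: "0 < st_Delta s / sqrt 2" using D(1) by simp
  have le: "st_Delta s / sqrt 2 \<le> \<Delta>1" using D sqrt2_div_le[of "st_Delta s"] by linarith
  have "step s c e = batch_init lam (st_Delta s / sqrt 2)" using True by (simp only: step_def if_True)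
  then show ?thesis using sq pos le threshold_nonneg
    unfolding valid_def by (simp only: batch_init_def barb_state.simps) (simp add: min.coboundedI2)
qed

lemma valid_state: "n \<le> T \<Longrightarrow> valid n (state w n)"
  by (induction n) (simp_all add: valid_init valid_step state_Suc del: barb_states.simps(2))

lemma valid_V_batch_init: "valid_V n (batch_init lam D)"
  unfolding valid_V_def batch_init_def
  using sym_between_mono[OF sym_between_mat[OF lam], of "lam + real n * Bx\<^sup>2"] by simp

lemma valid_V_mid:
  assumes s: "valid_V n s" and c: "bounded_ctx c"
  shows "valid_V (Suc n) (mid s c e)"
  unfolding valid_V_def
proof
  fix i
  have V: "sym_between lam (lam + real n * Bx\<^sup>2) (st_V s i)" using s by (simp add: valid_V_def)
  have V': "sym_between lam (lam + real (Suc n) * Bx\<^sup>2) (st_V s i)"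
    by (rule sym_between_mono[OF V]) (simp add: distrib_right)
  have W: "sym_between lam (lam + real (Suc n) * Bx\<^sup>2) (st_V s i + outer_prod (c j))"
    if "mm (expl s c) i = Some j" for j
  proof -
    have "norm (c j) \<le> Bx" using c mm_Some[OF that] by (simp add: bounded_ctx_def expl_def)
    from sym_between_add_outer[OF V this] have "sym_between lam (lam + real n * Bx\<^sup>2 + Bx\<^sup>2) (st_V s i + outer_prod (c j))" .
    also have "lam + real n * Bx\<^sup>2 + Bx\<^sup>2 = lam + real (Suc n) * Bx\<^sup>2" by (simp add: algebra_simps)
    finally show ?thesis .
  qed
  show "sym_between lam (lam + real (Suc n) * Bx\<^sup>2) (st_V (mid s c e) i)"
    using V' W by (auto simp: mid_def split: option.split)
qed

lemma valid_V_step: "valid_V n s \<Longrightarrow> bounded_ctx c \<Longrightarrow> valid_V (Suc n) (step s c e)"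
  by (simp add: step_def valid_V_mid valid_V_batch_init)

lemma valid_V_state:
  assumes "\<And>t. t \<in> {1..T} \<Longrightarrow> bounded_ctx (fst (w t))"
  shows "n \<le> T \<Longrightarrow> valid_V n (state w n)"
  by (induction n)
     (simp_all add: valid_V_batch_init valid_V_step state_Suc assms del: barb_states.simps(2))

text \<open>Without exploration every context has inverse norm at most
  \<open>st_Delta s / eta\<close>. On the confidence event the other factor of the ridge error is at
  most \<open>R * radius + sqrt lam * B\<theta> = eta\<close>.\<close>

lemma estimate_accurate:
  assumes s: "valid_V n s" "confident s" and ex: "expl s c = {}" and ij: "i < N" "j < K"
  shows "\<bar>est_util s c i j - util c i j\<bar> \<le> st_Delta s"
proof -
  have V: "sym_between lam (lam + real n * Bx\<^sup>2) (st_V s i)" using s by (simp add: valid_V_def)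
  have v: "vnorm_inv (st_V s i) (c j) \<le> st_Delta s / eta"
    using ex ij by (auto simp: expl_def not_less[symmetric])
  have "\<bar>est_util s c i j - util c i j\<bar>
      \<le> vnorm_inv (st_V s i) (c j) * (vnorm_inv (st_V s i) (noise_sum s i) + sqrt lam * norm (\<theta> i))"
    unfolding est_util_def util_def noise_sum_def by (rule ridge_estimate_error[OF V])
  also have "\<dots> \<le> vnorm_inv (st_V s i) (c j) * eta"
    using s(2) ij(1) \<theta>_le[OF ij(1)] lam unfolding eta_eq radius_def[symmetric] confident_def
    by (intro mult_left_mono add_mono sym_between_Cauchy_Schwarz(2)[OF V]) auto
  also have "\<dots> \<le> st_Delta s / eta * eta"
    by (rule mult_right_mono[OF v]) (use eta_pos in simp)
  finally show ?thesis using eta_pos by simp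
qed

lemma plist_sorted:
  assumes "i < N"
  shows "rev (sort (map (u i) [0..<K])) = map (u i) (plist u i)"
proof -
  have P: "distinct (plist u i)" "set (plist u i) = {..<K}" "sorted_wrt (\<lambda>a b. u i b \<le> u i a) (plist u i)"
    using plist assms unfolding pref_lists_ok_def by blast+
  have "mset (plist u i) = mset [0..<K]"
    using P(1,2) by (subst set_eq_iff_mset_eq_distinct[symmetric]) (simp_all add: atLeast0LessThan)
  then have "mset (rev (map (u i) (plist u i))) = mset (map (u i) [0..<K])" by (simp only: mset_map mset_rev)
  moreover have "sorted (rev (map (u i) (plist u i)))"
    using P(3) by (simp add: sorted_wrt_rev sorted_wrt_map)
  ultimately have "sort (map (u i) [0..<K]) = rev (map (u i) (plist u i))"
    by (intro properties_for_sort)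
  then show ?thesis by simp
qed

text \<open>Restates the closeness test along the proposal list, where it can be combined with the
  positions that Gale--Shapley visits.\<close>

lemma close_iff:
  "close s c \<longleftrightarrow> (\<exists>i<N. \<exists>m. Suc m < min (Suc N) K \<and>
     est_util s c i (plist (est_util s c) i ! m) - est_util s c i (plist (est_util s c) i ! Suc m)
       \<le> 2 * st_Delta s)"
proof -
  interpret gs_market N K rk "plist (est_util s c)" by (rule gs_market_plist)
  have eq: "rev (sort (map (est_util s c i) [0..<K])) ! m = est_util s c i (plist (est_util s c) i ! m)"
    if "i < N" "m < K" for i m
    using that by (simp add: plist_sorted P_length)
  have eqs: "rev (sort (map (est_util s c i) [0..<K])) ! m = est_util s c i (plist (est_util s c) i ! m)"
    "rev (sort (map (est_util s c i) [0..<K])) ! Suc m = est_util s c i (plist (est_util s c) i ! Suc m)"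
    if "i < N" "Suc m < min (Suc N) K" for i m
    using that by (auto simp: eq)
  show ?thesis
    unfolding close_def by (simp only: eqs cong: conj_cong)
qed

text \<open>An estimated gap above twice \<open>st_Delta\<close> survives the errors of both
  estimates. The true utilities therefore strictly separate each of the first \<open>N\<close>
  positions from all later ones, as required for \<open>opt_stable_util_le_gale_shapley\<close>.
  Separating position \<open>N\<close> from the next is why \<open>N + 1\<close> values are
  tested.\<close>

lemma exploit_no_regret:
  assumes s: "valid_V n s" "confident s" and ex: "expl s c = {}" "\<not> close s c" and i: "i < N"
  shows "gap s c i \<le> 0"
proof -
  let ?u = "est_util s c" and ?P = "plist (est_util s c)"
  interpret gs_market N K rk ?P by (rule gs_market_plist)
  have "opt_stable_util N K rk (util c) i \<le> match_util (util c) (gale_shapley N K rk ?P) i"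
  proof (rule opt_stable_util_le_gale_shapley[OF _ i])
    fix i m m' assume h: "i < N" "m < N" "m < m'" "m' < K"
    have sd: "sorted_wrt (\<lambda>a b. ?u i b \<le> ?u i a) (?P i)"
      using plist h(1) unfolding pref_lists_ok_def by blast
    have "?u i (?P i ! m) - ?u i (?P i ! Suc m) > 2 * st_Delta s"
      using ex(2) h unfolding close_iff by (auto simp: not_le)
    moreover have "?u i (?P i ! m') \<le> ?u i (?P i ! Suc m)"
      using sd h P_length[OF h(1)] by (cases "Suc m = m'") (auto simp: sorted_wrt_iff_nth_less)
    moreover have "\<bar>?u i (?P i ! q) - util c i (?P i ! q)\<bar> \<le> st_Delta s" if "q < K" for q
      by (rule estimate_accurate[OF s ex(1) h(1) P_nth_less[OF h(1) that]])
    from this[of m] this[of m'] have "\<bar>?u i (?P i ! m) - util c i (?P i ! m)\<bar> \<le> st_Delta s"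
      "\<bar>?u i (?P i ! m') - util c i (?P i ! m')\<bar> \<le> st_Delta s" using h by auto
    ultimately show "util c i (?P i ! m') < util c i (?P i ! m)" by linarith
  qed
  then show ?thesis using ex by (simp add: gap_def play_def)
qed

text \<open>The 4 is 2 from the closeness test plus 1 for the error of each of the two
  estimates.\<close>

lemma close_near:
  assumes s: "valid_V n s" "confident s" and ex: "expl s c = {}" "close s c"
    and D: "4 * st_Delta s < D"
  shows "near D c"
proof -
  let ?u = "est_util s c" and ?P = "plist (est_util s c)"
  interpret gs_market N K rk ?P by (rule gs_market_plist)
  from ex(2) obtain i m where i: "i < N" and m: "Suc m < min (Suc N) K"
    and le: "?u i (?P i ! m) - ?u i (?P i ! Suc m) \<le> 2 * st_Delta s"
    unfolding close_iff by blast
  have sd: "sorted_wrt (\<lambda>a b. ?u i b \<le> ?u i a) (?P i)"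
    using plist i unfolding pref_lists_ok_def by blast
  have ge: "?u i (?P i ! Suc m) \<le> ?u i (?P i ! m)"
    using sd m P_length[OF i] by (auto simp: sorted_wrt_iff_nth_less)
  have K: "?P i ! m < K" "?P i ! Suc m < K" "?P i ! m \<noteq> ?P i ! Suc m"
    using m P_nth_less[OF i] P_nth_inject[OF i, of m "Suc m"] by auto
  have "\<bar>util c i (?P i ! m) - util c i (?P i ! Suc m)\<bar> < D"
    using estimate_accurate[OF s ex(1) i K(1)] estimate_accurate[OF s ex(1) i K(2)] le ge D by linarith
  then have "\<bar>\<theta> i \<bullet> (c (?P i ! m) - c (?P i ! Suc m))\<bar> < D"
    by (simp add: util_def inner_diff_right)
  then show ?thesis unfolding near_def using i K by blast
qed

lemma util_le: "bounded_ctx c \<Longrightarrow> i < N \<Longrightarrow> j < K \<Longrightarrow> \<bar>util c i j\<bar> \<le> B\<theta> * Bx"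
  unfolding util_def bounded_ctx_def
  by (rule order_trans[OF Cauchy_Schwarz_ineq2]) (use \<theta>_le B\<theta> in \<open>auto intro!: mult_mono\<close>)

lemma gap_le_1:
  assumes c: "bounded_ctx c" and i: "i < N"
  shows "gap s c i \<le> 1"
proof -
  have "opt_stable_util N K rk (util c) i \<le> B\<theta> * Bx"
    by (rule opt_stable_util_le[OF N_le_K rk_inj i]) (use util_le[OF c i] in \<open>auto simp: abs_le_iff\<close>)
  moreover have "- (B\<theta> * Bx) \<le> match_util (util c) (play s c) i"
  proof (cases "play s c i")
    case None
    then show ?thesis using B\<theta> Bx by (simp add: match_util_def)
  next
    case (Some j)
    then show ?thesis using util_le[OF c i play_lessK[OF Some]] by (simp add: match_util_def)
  qed
  ultimately show ?thesis using BB unfolding gap_def by linarith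
qed

lemma gap_le_cost:
  assumes "valid_V n s" "confident s" "bounded_ctx c" "i < N"
  shows "gap s c i \<le> cost s c"
  using exploit_no_regret[OF assms(1,2) _ _ assms(4)] gap_le_1[OF assms(3,4)] by (auto simp: cost_def)

text \<open>Up to an additive constant this is \<open>ln (det V)\<close>.\<close>

definition vol :: "real^'d^'d \<Rightarrow> real" where
  "vol V = - 2 * ln (enn2real (gauss_integral V))"

lemma gauss_integral_finite:
  fixes V :: "real^'d^'d"
  assumes "sym_between lam u V" "u > 0"
  shows "gauss_integral V = ennreal (enn2real (gauss_integral V))"
    "sqrt (2 * pi / u) ^ CARD('d) \<le> enn2real (gauss_integral V)"
    "enn2real (gauss_integral V) > 0"
proof -
  have p: "sqrt (2 * pi / u) ^ CARD('d) > 0" using assms(2) by simp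
  note b = gauss_integral_bounds(1)[OF assms(1)] gauss_integral_bounds(2)[OF assms]
  have "gauss_integral V < top"
    using b(1) by (rule order_le_less_trans) simp
  then show e: "gauss_integral V = ennreal (enn2real (gauss_integral V))" by simp
  define g where "g = enn2real (gauss_integral V)"
  have g: "gauss_integral V = ennreal g" "g \<ge> 0" using e by (simp_all add: g_def)
  have "sqrt (2 * pi / u) ^ CARD('d) \<le> g"
    using b(2) g(2) by (simp only: g(1) ennreal_le_iff)
  then show l: "sqrt (2 * pi / u) ^ CARD('d) \<le> enn2real (gauss_integral V)" by (simp only: g_def)
  show "enn2real (gauss_integral V) > 0" using l p by linarith
qed

text \<open>In terms of determinants this is \<open>det V \<le> u^d\<close>.\<close>

lemma vol_le:
  fixes V :: "real^'d^'d"
  assumes V: "sym_between lam u V" and u: "u \<ge> lam"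
  shows "vol V - vol V0 \<le> real CARD('d) * ln (u / lam)"
proof -
  have u0: "u > 0" using u lam by simp
  note f = gauss_integral_finite[OF V u0]
  have l: "enn2real (gauss_integral V0) = sqrt (2 * pi / lam) ^ CARD('d)"
    using lam by (simp add: gauss_integral_mat)
  have lnp: "ln (sqrt (2 * pi / x) ^ CARD('d)) = real CARD('d) * (ln (2 * pi / x) / 2)" if "x > 0" for x
    using that by (simp add: ln_realpow ln_sqrt)
  have pos: "sqrt (2 * pi / u) ^ CARD('d) > 0" using u0 by simp
  have "ln (sqrt (2 * pi / u) ^ CARD('d)) \<le> ln (enn2real (gauss_integral V))"
    by (rule ln_mono) (use f pos in auto)
  then have "vol V - vol V0 \<le> real CARD('d) * (ln (2 * pi / lam) - ln (2 * pi / u))"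
    unfolding lnp[OF u0] vol_def l lnp[OF lam] by (simp add: algebra_simps)
  also have "ln (2 * pi / lam) - ln (2 * pi / u) = ln (u / lam)"
    using u0 lam by (simp add: ln_div)
  finally show "vol V - vol V0 \<le> real CARD('d) * ln (u / lam)" .
qed

text \<open>The increment is \<open>a / (1 + a)\<close> for the squared norm \<open>a\<close> of
  \<open>x\<close>, and this is increasing in \<open>a\<close>.\<close>

lemma vol_add_outer:
  fixes x :: "real^'d"
  assumes V: "sym_between lam u V" and u: "u > 0" and x: "vnorm_inv V x > \<xi>" and \<xi>: "\<xi> > 0"
  shows "vol (V + outer_prod x) \<ge> vol V + \<xi>\<^sup>2 / (1 + \<xi>\<^sup>2)"
proof -
  define a where "a = x \<bullet> (matrix_inv V *v x)"
  define r where "r = a / (1 + a)"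
  have W: "sym_between lam (u + (norm x)\<^sup>2) (V + outer_prod x)"
    by (rule sym_between_add_outer[OF V]) simp
  have u': "u + (norm x)\<^sup>2 > 0" using u by (simp add: add_pos_nonneg)
  note f = gauss_integral_finite[OF V u] and f' = gauss_integral_finite[OF W u']
  have a: "a = (vnorm_inv V x)\<^sup>2" by (simp add: a_def sym_between_Cauchy_Schwarz(3)[OF V])
  have "\<xi>\<^sup>2 \<le> a" unfolding a using x \<xi> by (intro power_mono) auto
  then have "\<xi>\<^sup>2 / (1 + \<xi>\<^sup>2) \<le> r"
  proof -
    have p: "1 + \<xi>\<^sup>2 > 0" "1 + a > 0" using \<open>\<xi>\<^sup>2 \<le> a\<close> \<xi> zero_less_power[OF \<xi>, of 2] by linarith+
    have "\<xi>\<^sup>2 * (1 + a) \<le> a * (1 + \<xi>\<^sup>2)" using \<open>\<xi>\<^sup>2 \<le> a\<close> by (simp add: algebra_simps)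
    then show ?thesis using p unfolding r_def by (simp add: pos_divide_le_eq pos_le_divide_eq)
  qed
  moreover have "exp (r / 2) * enn2real (gauss_integral (V + outer_prod x)) \<le> enn2real (gauss_integral V)"
  proof -
    have "ennreal (exp (r / 2)) * ennreal (enn2real (gauss_integral (V + outer_prod x)))
        \<le> ennreal (enn2real (gauss_integral V))"
      using gauss_integral_add_outer(1)[OF V, of x]
      by (simp only: a_def[symmetric] r_def[symmetric] f(1)[symmetric] f'(1)[symmetric])
    then show ?thesis
      by (simp only: ennreal_mult'[OF exp_ge_zero, symmetric] ennreal_le_iff[OF enn2real_nonneg])
  qed
  then have "ln (exp (r / 2) * enn2real (gauss_integral (V + outer_prod x))) \<le> ln (enn2real (gauss_integral V))"
    by (rule ln_mono) (use f(3) f'(3) in simp_all)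
  then have "r / 2 + ln (enn2real (gauss_integral (V + outer_prod x))) \<le> ln (enn2real (gauss_integral V))"
    using f'(3) by (simp add: ln_mult)
  ultimately show ?thesis unfolding vol_def by linarith
qed

end

section \<open>Regret along a good path\<close>

context barb_bounded
begin

definition log_dim :: real where
  "log_dim = real N * (real CARD('d) * ln growth)"

text \<open>Chosen so that \<open>budget / \<Delta>^2\<close> pays for a whole batch: the threshold,
  the overshoot of the counter by one, and the exploration rounds. The factors
  \<open>\<Delta>1^2\<close> turn constants into multiples of \<open>1 / \<Delta>^2\<close>, since
  \<open>\<Delta> \<le> \<Delta>1\<close>.\<close>

definition budget :: real where
  "budget = 3 * logT / 16 + \<Delta>1\<^sup>2 + (\<Delta>1\<^sup>2 + eta\<^sup>2) * log_dim"

text \<open>The factor is the reciprocal of the guaranteed increment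
  \<open>\<xi>^2 / (1 + \<xi>^2)\<close> at \<open>\<xi> = st_Delta s / eta\<close>, so every
  exploration round adds at least 1.\<close>

definition used :: "'d barb_state \<Rightarrow> real" where
  "used s = (1 + eta\<^sup>2 / (st_Delta s)\<^sup>2) * (\<Sum>i<N. vol (st_V s i) - vol V0)"

text \<open>The first term pays for the finished batches, as \<open>1 / \<Delta>\<^sub>k\<^sup>2\<close> doubles from batch to batch; the
  other two pay for the close exploitation rounds and the exploration rounds of the current one.\<close>

definition potential :: "'d barb_state \<Rightarrow> real" where
  "potential s = budget * (1 / (st_Delta s)\<^sup>2 - 1 / \<Delta>1\<^sup>2) + real (st_Nk s) + used s"

lemma log_dim_nonneg: "log_dim \<ge> 0"
  using lam by (simp add: log_dim_def)

lemma budget_nonneg: "budget \<ge> 0"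
  using lnT log_dim_nonneg by (simp add: budget_def)

lemma batch_total:
  assumes D: "0 < st_Delta s" "st_Delta s \<le> \<Delta>1" and V: "valid_V n s" "n \<le> T"
    and Nk: "real (st_Nk s) \<le> threshold (st_Delta s) + 1"
  shows "real (st_Nk s) + used s \<le> budget / (st_Delta s)\<^sup>2"
proof -
  have D2: "(st_Delta s)\<^sup>2 \<le> \<Delta>1\<^sup>2" "0 < (st_Delta s)\<^sup>2" using D by (auto intro: power_mono)
  have "vol (st_V s i) - vol V0 \<le> real CARD('d) * ln growth" for i
  proof -
    have Vi: "sym_between lam (lam + real n * Bx\<^sup>2) (st_V s i)" using V by (simp add: valid_V_def)
    have "vol (st_V s i) - vol V0 \<le> real CARD('d) * ln ((lam + real n * Bx\<^sup>2) / lam)"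
      by (rule vol_le[OF Vi]) simp
    also have "\<dots> \<le> real CARD('d) * ln growth"
    proof (intro mult_left_mono ln_mono)
      show "0 < (lam + real n * Bx\<^sup>2) / lam" using lam by (simp add: add_pos_nonneg)
      have "real n * Bx\<^sup>2 \<le> real T * Bx\<^sup>2" using V(2) by (intro mult_right_mono) auto
      then show "(lam + real n * Bx\<^sup>2) / lam \<le> growth"
        using lam by (simp add: add_divide_distrib divide_right_mono)
    qed simp
    finally show ?thesis .
  qed
  then have "(\<Sum>i<N. vol (st_V s i) - vol V0) \<le> (\<Sum>i<N. real CARD('d) * ln growth)"
    by (intro sum_mono)
  also have "\<dots> = log_dim" by (simp add: log_dim_def)
  finally have "used s \<le> (1 + eta\<^sup>2 / (st_Delta s)\<^sup>2) * log_dim"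
    unfolding used_def by (intro mult_left_mono) (auto intro: add_nonneg_nonneg)
  also have "1 + eta\<^sup>2 / (st_Delta s)\<^sup>2 = ((st_Delta s)\<^sup>2 + eta\<^sup>2) / (st_Delta s)\<^sup>2"
    using D by (simp add: add_divide_distrib)
  also have "\<dots> * log_dim \<le> (\<Delta>1\<^sup>2 + eta\<^sup>2) / (st_Delta s)\<^sup>2 * log_dim"
    using D2 log_dim_nonneg by (intro mult_right_mono divide_right_mono) auto
  finally have u: "used s \<le> (\<Delta>1\<^sup>2 + eta\<^sup>2) * log_dim / (st_Delta s)\<^sup>2" by simp
  \<comment> \<open>The 1 absorbed here is the overshoot: the counter that ends a batch exceeds the
    threshold by at most one.\<close>
  have "1 \<le> \<Delta>1\<^sup>2 / (st_Delta s)\<^sup>2" using D2 by simp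
  with Nk have "real (st_Nk s) \<le> 3 * logT / 16 / (st_Delta s)\<^sup>2 + \<Delta>1\<^sup>2 / (st_Delta s)\<^sup>2"
    by (simp add: threshold_def)
  with u show ?thesis by (simp add: budget_def add_divide_distrib)
qed

lemma mid_potential:
  assumes s: "valid n s" "valid_V n s" and c: "bounded_ctx c"
  shows "cost s c + potential s \<le> potential (mid s c e)"
proof (cases "expl s c = {}")
  case True
  then show ?thesis by (auto simp: mid_def cost_def potential_def used_def)
next
  case False
  let ?\<xi> = "st_Delta s / eta"
  have D: "0 < st_Delta s" using s by (simp add: valid_def)
  have \<xi>: "?\<xi> > 0" using D eta_pos by simp
  have V: "sym_between lam (lam + real n * Bx\<^sup>2) (st_V s i)" for i using s by (simp add: valid_V_def)
  have u: "lam + real n * Bx\<^sup>2 > 0" using lam by (simp add: add_pos_nonneg)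
  have inc: "vol (st_V (mid s c e) i) \<ge> vol (st_V s i) + ?\<xi>\<^sup>2 / (1 + ?\<xi>\<^sup>2)"
    if "mm (expl s c) i = Some j" for i j
  proof -
    have "vnorm_inv (st_V s i) (c j) > ?\<xi>" using mm_Some[OF that] by (simp add: expl_def)
    from vol_add_outer[OF V u this \<xi>] show ?thesis using False that by (simp add: mid_def)
  qed
  have nn: "?\<xi>\<^sup>2 / (1 + ?\<xi>\<^sup>2) \<ge> 0" by simp
  have mono: "vol (st_V (mid s c e) i) \<ge> vol (st_V s i)" for i
  proof (cases "mm (expl s c) i")
    case None
    then show ?thesis using False by (simp add: mid_def)
  next
    case (Some j)
    from inc[OF this] nn show ?thesis by linarith
  qed
  \<comment> \<open>A maximum matching of a nonempty edge set is nonempty, so at least one player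
    makes full progress; by \<open>mono\<close> no other player loses any.\<close>
  obtain i j where ij: "mm (expl s c) i = Some j" using mm_nonempty[OF False] by blast
  have i: "i < N" using mm_Some[OF ij] by (simp add: expl_def)
  let ?S = "\<lambda>s. \<Sum>i<N. vol (st_V s i) - vol V0"
  have split: "?S s' = (vol (st_V s' i) - vol V0) + (\<Sum>i\<in>{..<N} - {i}. vol (st_V s' i) - vol V0)" for s'
    using i by (intro sum.remove) auto
  have "(\<Sum>i\<in>{..<N} - {i}. vol (st_V s i) - vol V0)
      \<le> (\<Sum>i\<in>{..<N} - {i}. vol (st_V (mid s c e) i) - vol V0)"
    by (intro sum_mono diff_right_mono mono)
  then have "?S s + ?\<xi>\<^sup>2 / (1 + ?\<xi>\<^sup>2) \<le> ?S (mid s c e)"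
    unfolding split using inc[OF ij] by linarith
  then have le1: "(1 + eta\<^sup>2 / (st_Delta s)\<^sup>2) * (?S s + ?\<xi>\<^sup>2 / (1 + ?\<xi>\<^sup>2)) \<le> (1 + eta\<^sup>2 / (st_Delta s)\<^sup>2) * ?S (mid s c e)"
    by (intro mult_left_mono) (auto intro: add_nonneg_nonneg)
  have eq1: "(1 + eta\<^sup>2 / (st_Delta s)\<^sup>2) * (?\<xi>\<^sup>2 / (1 + ?\<xi>\<^sup>2)) = 1"
  proof -
    have x: "?\<xi>\<^sup>2 > 0" by (rule zero_less_power[OF \<xi>])
    have "eta\<^sup>2 / (st_Delta s)\<^sup>2 = 1 / ?\<xi>\<^sup>2" by (simp add: power_divide)
    moreover have "(1 + 1 / x) * (x / (1 + x)) = 1" if "x > 0" for x :: real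
    proof -
      have "1 + 1 / x = (1 + x) / x" using that by (simp add: add_divide_distrib)
      moreover have "1 + x \<noteq> 0" using that by linarith
      ultimately show ?thesis using that by simp
    qed
    ultimately show ?thesis using x by metis
  qed
  from le1 have "used s + 1 \<le> used (mid s c e)"
    unfolding used_def mid_Delta distrib_left[of _ "?S s"] eq1 .
  moreover have "st_Nk (mid s c e) = st_Nk s" using False by (simp add: mid_def)
  ultimately show ?thesis using False by (simp add: potential_def cost_def)
qed

lemma step_potential:
  assumes s: "valid n s" "valid_V n s" and c: "bounded_ctx c" and n: "n < T"
  shows "cost s c + potential s \<le> potential (step s c e)"
proof (cases "real (st_Nk (mid s c e)) > threshold (st_Delta s)")
  case False
  then show ?thesis using mid_potential[OF s c] by (simp add: step_def)
next
  case True
  let ?D = "st_Delta s"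
  have D: "0 < ?D" "?D \<le> \<Delta>1" "real (st_Nk s) \<le> threshold ?D" using s by (auto simp: valid_def)
  have "real (st_Nk (mid s c e)) \<le> threshold ?D + 1" using D(3) by (auto simp: mid_def)
  then have "real (st_Nk (mid s c e)) + used (mid s c e) \<le> budget / ?D\<^sup>2"
    using batch_total[of "mid s c e" "Suc n"] D valid_V_mid[OF s(2) c] n by simp
  then have "potential (mid s c e) \<le> budget * (1 / ?D\<^sup>2 - 1 / \<Delta>1\<^sup>2) + budget / ?D\<^sup>2"
    by (simp add: potential_def)
  also have "\<dots> = budget * (1 / (?D / sqrt 2)\<^sup>2 - 1 / \<Delta>1\<^sup>2)"
    by (simp add: power_divide algebra_simps)
  also have "\<dots> = potential (step s c e)"
    using True by (simp add: step_def potential_def batch_init_def used_def)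
  finally show ?thesis using mid_potential[OF s c, of e] by linarith
qed

definition ctx_bounded :: "'d outcome \<Rightarrow> bool" where
  "ctx_bounded w \<longleftrightarrow> (\<forall>t\<in>{1..T}. bounded_ctx (fst (w t)))"

lemma sum_cost_le_potential:
  assumes "ctx_bounded w"
  shows "n \<le> T \<Longrightarrow> (\<Sum>t\<in>{1..n}. cost (state w (t - 1)) (fst (w t))) \<le> potential (state w n)"
proof (induction n)
  case 0
  then show ?case by (simp add: potential_def used_def batch_init_def)
next
  case (Suc n)
  have b: "bounded_ctx (fst (w t))" if "t \<in> {1..T}" for t using assms that by (simp add: ctx_bounded_def)
  have "(\<Sum>t\<in>{1..Suc n}. cost (state w (t - 1)) (fst (w t)))
      = cost (state w n) (fst (w (Suc n))) + (\<Sum>t\<in>{1..n}. cost (state w (t - 1)) (fst (w t)))"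
    by (simp del: barb_states.simps(2))
  also have "\<dots> \<le> cost (state w n) (fst (w (Suc n))) + potential (state w n)"
    using Suc by simp
  also have "\<dots> \<le> potential (state w (Suc n))"
    unfolding state_Suc using Suc.prems valid_state[of n w] valid_V_state[of w n] b
    by (intro step_potential[of n]) auto
  finally show ?case .
qed

lemma sum_cost_le:
  assumes "ctx_bounded w"
  shows "(\<Sum>t\<in>{1..T}. cost (state w (t - 1)) (fst (w t))) \<le> 2 * budget / (st_Delta (state w T))\<^sup>2"
proof -
  let ?s = "state w T"
  have v: "valid T ?s" by (rule valid_state) simp
  have "valid_V T ?s" by (rule valid_V_state) (use assms in \<open>auto simp: ctx_bounded_def\<close>)
  then have "real (st_Nk ?s) + used ?s \<le> budget / (st_Delta ?s)\<^sup>2"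
    using v by (intro batch_total[of _ T]) (auto simp: valid_def)
  moreover have "budget * (1 / (st_Delta ?s)\<^sup>2 - 1 / \<Delta>1\<^sup>2) \<le> budget * (1 / (st_Delta ?s)\<^sup>2)"
    using budget_nonneg by (intro mult_left_mono) auto
  ultimately show ?thesis
    using sum_cost_le_potential[OF assms, of T] by (simp add: potential_def)
qed

section \<open>A lower bound on the candidate gap of all batches\<close>

abbreviation min_Delta :: "real \<Rightarrow> real" where
  "min_Delta D \<equiv> min \<Delta>1 (D / (4 * sqrt 2))"

text \<open>The induction carries a second claim: once \<open>4 \<Delta> < D\<close>, each increment
  of the counter is charged to a near round. Such a batch cannot end, so the last reset happened at
  some \<open>\<Delta> \<ge> D / 4\<close>; the extra \<open>sqrt 2\<close> in
  \<open>min_Delta\<close> is that reset.\<close>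

lemma Delta_lower_bound:
  assumes b: "ctx_bounded w" and conf: "\<And>n. n < T \<Longrightarrow> confident (state w n)" and D: "D > 0"
    and cnt: "real (card {t\<in>{1..T}. near D (fst (w t))}) \<le> 3 * logT / D\<^sup>2"
  shows "n \<le> T \<Longrightarrow> min_Delta D \<le> st_Delta (state w n) \<and>
     (4 * st_Delta (state w n) < D \<longrightarrow> st_Nk (state w n) \<le> card {t\<in>{1..n}. near D (fst (w t))})"
proof (induction n)
  case 0
  then show ?case by (simp add: batch_init_def)
next
  case (Suc n)
  define s c e where "s = state w n" and "c = fst (w (Suc n))" and "e = snd (w (Suc n))"
  have st: "state w (Suc n) = step s c e" unfolding s_def c_def e_def by (rule state_Suc)
  have v: "valid n s" "valid_V n s" "confident s"
    using Suc.prems valid_state[of n w] valid_V_state[of w n] conf[of n] b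
    by (auto simp: s_def ctx_bounded_def)
  let ?N = "\<lambda>n. card {t\<in>{1..n}. near D (fst (w t))}"
  have "{t\<in>{1..Suc n}. near D (fst (w t))} =
      (if near D c then insert (Suc n) {t\<in>{1..n}. near D (fst (w t))} else {t\<in>{1..n}. near D (fst (w t))})"
    by (auto simp: c_def le_Suc_eq)
  then have NS: "?N (Suc n) = ?N n + (if near D c then 1 else 0)" by simp
  have IH: "min_Delta D \<le> st_Delta s" "4 * st_Delta s < D \<Longrightarrow> st_Nk s \<le> ?N n"
    using Suc by (auto simp: s_def)
  have mid: "st_Nk (mid s c e) \<le> ?N (Suc n)" if "4 * st_Delta s < D"
  proof -
    have "st_Nk (mid s c e) = st_Nk s + (if expl s c = {} \<and> close s c then 1 else 0)"
      by (simp add: mid_def)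
    also have "\<dots> \<le> ?N n + (if near D c then 1 else 0)"
      using close_near[OF v(2,3) _ _ that, of c] by (intro add_mono IH(2)[OF that]) simp
    finally show ?thesis unfolding NS .
  qed
  show ?case
  proof (cases "real (st_Nk (mid s c e)) > threshold (st_Delta s)")
    case False
    then have "step s c e = mid s c e" by (simp add: step_def)
    then show ?thesis using IH(1) mid unfolding st by simp
  next
    case True
    have "\<not> 4 * st_Delta s < D"
    proof
      assume lt: "4 * st_Delta s < D"
      have D0: "0 < st_Delta s" using v by (simp add: valid_def)
      have "(4 * st_Delta s)\<^sup>2 \<le> D\<^sup>2" using lt D0 by (intro power_mono) auto
      then have "3 * logT / D\<^sup>2 \<le> 3 * logT / (4 * st_Delta s)\<^sup>2"
        using lnT D0 D by (intro divide_left_mono mult_pos_pos zero_less_power) auto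
      \<comment> \<open>The 16 in the end-of-batch test is the square of the 4 in
        \<open>4 * st_Delta s < D\<close>.\<close>
      also have "\<dots> = threshold (st_Delta s)" by (simp add: threshold_def power_mult_distrib)
      also have "\<dots> < real (?N (Suc n))" using True mid[OF lt] by linarith
      also have "\<dots> \<le> real (?N T)"
        using Suc.prems by (intro of_nat_mono card_mono) auto
      finally show False using cnt by linarith
    qed
    then have "D / 4 / sqrt 2 \<le> st_Delta s / sqrt 2" by (intro divide_right_mono) auto
    then show ?thesis using True unfolding st by (simp add: step_def batch_init_def min.coboundedI2)
  qed
qed

lemma regret_good_path:
  assumes b: "ctx_bounded w" and conf: "\<And>n. n < T \<Longrightarrow> confident (state w n)" and D: "D > 0"
    and cnt: "real (card {t\<in>{1..T}. near D (fst (w t))}) \<le> 3 * logT / D\<^sup>2" and i: "i < N"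
  shows "total_gap i w \<le> 2 * budget / (min_Delta D)\<^sup>2"
proof -
  have "total_gap i w \<le> (\<Sum>t\<in>{1..T}. cost (state w (t - 1)) (fst (w t)))"
  proof (intro sum_mono)
    fix t assume t: "t \<in> {1..T}"
    show "gap (state w (t - 1)) (fst (w t)) i \<le> cost (state w (t - 1)) (fst (w t))"
      using t b by (intro gap_le_cost[of "t - 1"] valid_V_state conf i) (auto simp: ctx_bounded_def)
  qed
  also have "\<dots> \<le> 2 * budget / (st_Delta (state w T))\<^sup>2" by (rule sum_cost_le[OF b])
  also have "\<dots> \<le> 2 * budget / (min_Delta D)\<^sup>2"
  proof -
    have p: "0 < min_Delta D" using D \<Delta>1 by simp
    have le: "min_Delta D \<le> st_Delta (state w T)"
      using Delta_lower_bound[OF b conf D cnt, of T] by simp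
    then have "(min_Delta D)\<^sup>2 \<le> (st_Delta (state w T))\<^sup>2"
      using p by (intro power_mono) auto
    moreover have "0 < (st_Delta (state w T))\<^sup>2 * (min_Delta D)\<^sup>2"
      using p le by (intro mult_pos_pos zero_less_power) linarith+
    ultimately show ?thesis using budget_nonneg by (intro divide_left_mono) auto
  qed
  finally show ?thesis .
qed

lemma regret_any_path:
  assumes b: "ctx_bounded w" and i: "i < N"
  shows "total_gap i w \<le> real T"
proof -
  have "total_gap i w \<le> (\<Sum>t\<in>{1..T}. 1)"
    using b i by (intro sum_mono gap_le_1) (auto simp: ctx_bounded_def)
  then show ?thesis by simp
qed

end

section \<open>The sample space and the mixture supermartingale\<close>

lemma gauss_mix_measurable:
  fixes V :: "'a \<Rightarrow> real^'d^'d"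
  assumes [measurable]: "V \<in> borel_measurable M" "S \<in> borel_measurable M"
  shows "(\<lambda>w. gauss_mix (V w) (S w)) \<in> borel_measurable M"
proof -
  have "(\<lambda>z. V (fst z) *v snd z) \<in> borel_measurable (M \<Otimes>\<^sub>M lborel)"
    by (intro borel_measurable_matrix_vector_mult) measurable
  then have "(\<lambda>z. snd z \<bullet> S (fst z) - quad (V (fst z)) (snd z) / 2) \<in> borel_measurable (M \<Otimes>\<^sub>M lborel)"
    unfolding quad_def by measurable
  then have "(\<lambda>(w, x). ennreal (exp (x \<bullet> S w - quad (V w) x / 2))) \<in> borel_measurable (M \<Otimes>\<^sub>M lborel)"
    by (simp add: split_beta')
  then show ?thesis unfolding gauss_mix_def by (rule lborel.borel_measurable_nn_integral)
qed

locale barb_env = barb N K rk \<theta> mm plist T eta lam \<Delta>1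
  for N K rk and \<theta> :: "nat \<Rightarrow> real^'d" and mm plist T eta lam \<Delta>1 +
  fixes Dx :: "(nat \<Rightarrow> real^'d) measure" and De :: "real measure"
  assumes prob_Dx: "prob_space Dx" and sets_Dx: "sets Dx = sets (\<Pi>\<^sub>M j\<in>{..<K}. (borel :: (real^'d) measure))"
    and prob_De: "prob_space De" and sets_De: "sets De = sets (borel :: real measure)"
    and De_int: "integrable De (\<lambda>x. x)" and De_mean: "(\<integral>x. x \<partial>De) = 0"
begin

abbreviation noise_space :: "(nat \<times> nat \<Rightarrow> real) measure" where
  "noise_space \<equiv> (\<Pi>\<^sub>M ij\<in>{..<N} \<times> {..<K}. De)"

abbreviation regret :: "nat \<Rightarrow> real" where
  "regret \<equiv> barb_regret N K rk \<theta> mm plist T eta lam \<Delta>1 Dx De"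

abbreviation one_round :: "((nat \<Rightarrow> real^'d) \<times> (nat \<times> nat \<Rightarrow> real)) measure" where
  "one_round \<equiv> round_space N K Dx De"

abbreviation \<Omega> :: "'d outcome measure" where
  "\<Omega> \<equiv> sample_space T N K Dx De"

lemma prob_noise: "prob_space noise_space"
  by (intro prob_space_PiM prob_De)

lemma prob_round: "prob_space one_round"
  unfolding round_space_def
proof -
  interpret D: prob_space Dx by (rule prob_Dx)
  interpret E: prob_space noise_space by (rule prob_noise)
  interpret pair_prob_space Dx noise_space ..
  show "prob_space (Dx \<Otimes>\<^sub>M noise_space)" by (rule prob_space_axioms)
qed

lemma prob_\<Omega>: "prob_space \<Omega>"
  unfolding sample_space_def by (intro prob_space_PiM prob_round)

lemma ctx_measurable: "j < K \<Longrightarrow> (\<lambda>c. c j) \<in> borel_measurable Dx"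
  unfolding measurable_cong_sets[OF sets_Dx refl] by (rule measurable_component_singleton) simp

lemma noise_measurable: "i < N \<Longrightarrow> j < K \<Longrightarrow> (\<lambda>e. e (i, j)) \<in> borel_measurable noise_space"
  using measurable_component_singleton[of "(i, j)" "{..<N} \<times> {..<K}" "\<lambda>_. De"]
  by (simp add: measurable_cong_sets[OF refl sets_De])

lemma round_measurable:
  "j < K \<Longrightarrow> (\<lambda>r. fst r j) \<in> borel_measurable one_round"
  "i < N \<Longrightarrow> j < K \<Longrightarrow> (\<lambda>r. snd r (i, j)) \<in> borel_measurable one_round"
  unfolding round_space_def
  by (auto intro: measurable_compose[OF measurable_fst ctx_measurable]
      measurable_compose[OF measurable_snd noise_measurable])

lemma \<Omega>_component: "t \<in> {1..T} \<Longrightarrow> (\<lambda>w. w t) \<in> measurable \<Omega> one_round"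
  unfolding sample_space_def by (rule measurable_component_singleton)

lemma state_measurable_\<Omega>:
  assumes "n \<le> T"
  shows "state_measurable \<Omega> (\<lambda>w. state w n)"
proof (rule state_measurable_state)
  fix t j assume "t \<in> {1..n}" "j < K"
  then show "(\<lambda>w. fst (w t) j) \<in> borel_measurable \<Omega>"
    using assms by (intro measurable_compose[OF \<Omega>_component round_measurable(1)]) auto
next
  fix t i j assume "t \<in> {1..n}" "i < N" "j < K"
  then show "(\<lambda>w. snd (w t) (i, j)) \<in> borel_measurable \<Omega>"
    using assms by (intro measurable_compose[OF \<Omega>_component round_measurable(2)]) auto
qed

lemma state_cong:
  "(\<And>t. t \<in> {1..n} \<Longrightarrow> w t = w' t) \<Longrightarrow> state w n = state w' n"
  by (induction n) (simp_all add: state_Suc del: barb_states.simps(2))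

text \<open>Independence of the rounds: if \<open>G\<close> ignores coordinate \<open>t\<close> of
  its path, that coordinate may be replaced by a fresh round. The product is split at
  \<open>t\<close>, and the ignored coordinate is integrated back in with mass 1.\<close>

lemma nn_integral_round:
  assumes t: "t \<in> {1..T}" and G: "(\<lambda>(w, r). G w r) \<in> borel_measurable (\<Omega> \<Otimes>\<^sub>M one_round)"
    and indep: "\<And>w r r'. G (fun_upd w t r') r = G w r"
  shows "(\<integral>\<^sup>+w. G w (w t) \<partial>\<Omega>) = (\<integral>\<^sup>+w. \<integral>\<^sup>+r. G w r \<partial>one_round \<partial>\<Omega>)"
proof -
  interpret r: prob_space one_round by (rule prob_round)
  interpret P: product_sigma_finite "\<lambda>_. one_round" by standard
  let ?J = "{1..T} - {t}"
  have ins: "insert t ?J = {1..T}" using t by auto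
  have \<Omega>: "\<Omega> = PiM (insert t ?J) (\<lambda>_. one_round)" unfolding ins sample_space_def ..
  have m1: "(\<lambda>w. G w (w t)) \<in> borel_measurable \<Omega>"
    using measurable_compose[OF measurable_Pair[OF measurable_ident \<Omega>_component[OF t]] G] by simp
  have m2: "(\<lambda>w. \<integral>\<^sup>+r. G w r \<partial>one_round) \<in> borel_measurable \<Omega>"
    by (rule r.borel_measurable_nn_integral[OF G])
  have "(\<integral>\<^sup>+w. G w (w t) \<partial>\<Omega>)
      = (\<integral>\<^sup>+x. \<integral>\<^sup>+y. G (x(t := y)) ((x(t := y)) t) \<partial>one_round \<partial>PiM ?J (\<lambda>_. one_round))"
    using m1 unfolding \<Omega> by (intro P.product_nn_integral_insert) auto
  also have "\<dots> = (\<integral>\<^sup>+x. \<integral>\<^sup>+y. G x y \<partial>one_round \<partial>PiM ?J (\<lambda>_. one_round))"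
    by (simp add: indep)
  also have "\<dots> = (\<integral>\<^sup>+x. \<integral>\<^sup>+y. \<integral>\<^sup>+r. G (x(t := y)) r \<partial>one_round \<partial>one_round \<partial>PiM ?J (\<lambda>_. one_round))"
    by (simp add: indep r.emeasure_space_1)
  also have "\<dots> = (\<integral>\<^sup>+w. \<integral>\<^sup>+r. G w r \<partial>one_round \<partial>\<Omega>)"
    using m2 unfolding \<Omega> by (intro P.product_nn_integral_insert[symmetric]) auto
  finally show ?thesis .
qed

end

locale barb_prob = barb_bounded N K rk \<theta> mm plist T eta lam \<Delta>1 R Bx B\<theta>
    + barb_env N K rk \<theta> mm plist T eta lam \<Delta>1 Dx De
  for N K rk and \<theta> :: "nat \<Rightarrow> real^'d" and mm plist T eta lam \<Delta>1 R Bx B\<theta> Dx De +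
  assumes Dx_bounded: "AE c in Dx. \<forall>j<K. norm (c j) \<le> Bx" and De_sub: "subgaussian R De"
begin

section \<open>The Gaussian mixture and its maximal inequality\<close>

lemma noise_sum_batch_init [simp]: "noise_sum (batch_init lam D) i = 0"
  by (simp add: noise_sum_def batch_init_def mat_mult_vec)

lemma noise_sum_mid:
  "noise_sum (mid s c e) i = noise_sum s i + (if expl s c = {} then 0
     else case mm (expl s c) i of None \<Rightarrow> 0 | Some j \<Rightarrow> e (i, j) *\<^sub>R c j)"
  by (auto simp: noise_sum_def mid_def matrix_vector_mult_add_rdistrib outer_prod_mult_vec
      algebra_simps inner_commute split: option.split)

text \<open>Dividing by \<open>R\<close> makes the noise 1-subgaussian, and the denominator
  normalises the value at the start of a batch to 1.\<close>

definition mix :: "nat \<Rightarrow> 'd barb_state \<Rightarrow> ennreal" where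
  "mix i s = gauss_mix (st_V s i) ((1 / R) *\<^sub>R noise_sum s i) / gauss_integral V0"

text \<open>A reset decreases \<open>batches_left\<close> by one and sets \<open>mix\<close> to one, so \<open>W\<close> does not increase.\<close>

definition max_batches :: real where
  "max_batches = log 2 (\<Delta>1\<^sup>2 / min (\<Delta>1\<^sup>2) (3 * logT / (32 * real T)))"

definition batches_left :: "'d barb_state \<Rightarrow> real" where
  "batches_left s = max_batches - log 2 (\<Delta>1\<^sup>2 / (st_Delta s)\<^sup>2)"

definition W :: "nat \<Rightarrow> 'd barb_state \<Rightarrow> ennreal" where
  "W i s = mix i s + ennreal (batches_left s)"

lemma gauss_mat_pos: "0 < gauss_integral V0" "gauss_integral V0 < top"
  using lam by (simp_all add: gauss_integral_mat)

lemma mix_batch_init [simp]: "mix i (batch_init lam D) = 1"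
proof -
  have "gauss_mix V 0 = gauss_integral V" for V :: "real^'d^'d"
    by (simp add: gauss_mix_def gauss_integral_def)
  moreover have "st_V (batch_init lam D :: 'd barb_state) i = mat lam" by (simp add: batch_init_def)
  ultimately show ?thesis using gauss_mat_pos unfolding mix_def
    by (simp add: ennreal_divide_self)
qed

lemma batches_left_nonneg:
  assumes "valid n s"
  shows "batches_left s \<ge> 0"
proof -
  have p: "0 < min (\<Delta>1\<^sup>2) (3 * logT / (32 * real T))" using \<Delta>1 lnT T2 by simp
  have D: "0 < (st_Delta s)\<^sup>2" "min (\<Delta>1\<^sup>2) (3 * logT / (32 * real T)) \<le> (st_Delta s)\<^sup>2"
    using assms by (auto simp: valid_def)
  have "\<Delta>1\<^sup>2 / (st_Delta s)\<^sup>2 \<le> \<Delta>1\<^sup>2 / min (\<Delta>1\<^sup>2) (3 * logT / (32 * real T))"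
    using p D by (intro divide_left_mono) auto
  moreover have "0 < \<Delta>1\<^sup>2 / (st_Delta s)\<^sup>2" using \<Delta>1 D by simp
  ultimately show ?thesis unfolding batches_left_def max_batches_def by (simp add: log_mono)
qed

lemma W_step_le:
  assumes s: "valid n s" and n: "n < T"
  shows "W i (step s c e) \<le> mix i (mid s c e) + ennreal (batches_left s)"
proof (cases "real (st_Nk (mid s c e)) > threshold (st_Delta s)")
  case False
  then have "step s c e = mid s c e" by (simp add: step_def)
  then show ?thesis by (simp add: W_def batches_left_def)
next
  case True
  then have st: "step s c e = batch_init lam (st_Delta s / sqrt 2)" by (simp add: step_def)
  have D: "0 < st_Delta s" using s by (simp add: valid_def)
  have "\<Delta>1\<^sup>2 / (st_Delta s / sqrt 2)\<^sup>2 = 2 * (\<Delta>1\<^sup>2 / (st_Delta s)\<^sup>2)" by (simp add: power_divide)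
  moreover have "log 2 (2 * (\<Delta>1\<^sup>2 / (st_Delta s)\<^sup>2)) = 1 + log 2 (\<Delta>1\<^sup>2 / (st_Delta s)\<^sup>2)"
    using D \<Delta>1 by (subst log_mult) auto
  ultimately have b: "batches_left (step s c e) = batches_left s - 1"
    unfolding st by (simp add: batches_left_def batch_init_def)
  have "0 \<le> batches_left (step s c e)" by (rule batches_left_nonneg[OF valid_step[OF s n]])
  then have "1 + ennreal (batches_left (step s c e)) = ennreal (batches_left s)"
    by (subst ennreal_1[symmetric], subst ennreal_plus[symmetric]) (simp_all add: b)
  then show ?thesis unfolding W_def st by (simp add: add_increasing)
qed

text \<open>The matching is determined by \<open>s\<close> and \<open>c\<close>, before the noise.
  After exchanging the integrals, for each \<open>y\<close> the subgaussian bound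
  \<open>exp ((x \<bullet> y)^2 / 2)\<close> cancels the Gaussian factor contributed by the new
  outer product.\<close>

lemma mix_mid_integral:
  assumes R0: "R > 0" and i: "i < N"
  shows "(\<integral>\<^sup>+e. mix i (mid s c e) \<partial>noise_space) \<le> mix i s"
proof -
  interpret E: prob_space noise_space by (rule prob_noise)
  show ?thesis
  proof (cases "\<exists>j. expl s c \<noteq> {} \<and> mm (expl s c) i = Some j")
    case False
    then have "noise_sum (mid s c e) i = noise_sum s i" for e
      unfolding noise_sum_mid by (auto split: option.split)
    moreover from False have "st_V (mid s c e) i = st_V s i" for e
      by (auto simp: mid_def split: option.split)
    ultimately have "mix i (mid s c e) = mix i s" for e
      by (simp only: mix_def)
    then show ?thesis by (simp add: E.emeasure_space_1)
  next
    case True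
    then obtain j where ne: "expl s c \<noteq> {}" and j: "mm (expl s c) i = Some j" by blast
    have jK: "j < K" using mm_Some[OF j] by (simp add: expl_def)
    let ?V = "st_V s i" and ?S = "(1 / R) *\<^sub>R noise_sum s i" and ?x = "c j"
    let ?g = "\<lambda>e y. ennreal (exp (y \<bullet> ?S - quad ?V y / 2)) * (ennreal (exp (- (?x \<bullet> y)\<^sup>2 / 2))
         * ennreal (exp ((?x \<bullet> y) / R * e (i, j))))"
    note [measurable] = noise_measurable[OF i jK]
    have "mix i (mid s c e) = (\<integral>\<^sup>+y. ?g e y \<partial>lborel) / gauss_integral V0" for e
    proof -
      have V: "st_V (mid s c e) i = ?V + outer_prod ?x" using ne j by (simp add: mid_def)
      have S: "noise_sum (mid s c e) i = noise_sum s i + e (i, j) *\<^sub>R ?x" using ne j by (simp add: noise_sum_mid)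
      show ?thesis unfolding mix_def V S gauss_mix_def
        by (simp add: ennreal_mult'[symmetric] exp_add[symmetric] quad_add_outer inner_add_right
            scaleR_add_right inner_commute add_divide_distrib algebra_simps)
    qed
    then have "(\<integral>\<^sup>+e. mix i (mid s c e) \<partial>noise_space)
        = (\<integral>\<^sup>+e. (\<integral>\<^sup>+y. ?g e y \<partial>lborel) / gauss_integral V0 \<partial>noise_space)" by simp
    also have "\<dots> = (\<integral>\<^sup>+e. (\<integral>\<^sup>+y. ?g e y \<partial>lborel) \<partial>noise_space) / gauss_integral V0"
      by (rule nn_integral_divide) measurable
    also have "(\<integral>\<^sup>+e. (\<integral>\<^sup>+y. ?g e y \<partial>lborel) \<partial>noise_space) = (\<integral>\<^sup>+y. (\<integral>\<^sup>+e. ?g e y \<partial>noise_space) \<partial>lborel)"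
    proof -
      interpret pair_sigma_finite lborel noise_space ..
      show ?thesis by (rule Fubini') measurable
    qed
    also have "\<dots> \<le> (\<integral>\<^sup>+y. ennreal (exp (y \<bullet> ?S - quad ?V y / 2)) \<partial>lborel)"
    proof (rule nn_integral_mono)
      fix y
      let ?a = "(?x \<bullet> y) / R"
      have int: "integrable De (\<lambda>x. exp (?a * x))" and le: "(\<integral>x. exp (?a * x) \<partial>De) \<le> exp (?a\<^sup>2 * R\<^sup>2 / 2)"
        using De_sub unfolding subgaussian_def by blast+
      have "(\<integral>\<^sup>+e. ennreal (exp (?a * e (i, j))) \<partial>noise_space)
          = (\<integral>\<^sup>+z. ennreal (exp (?a * z)) \<partial>distr noise_space De (\<lambda>e. e (i, j)))"
        using i jK
        by (intro nn_integral_distr[symmetric] measurable_component_singleton)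
           (auto simp: measurable_cong_sets[OF sets_De refl])
      also have "distr noise_space De (\<lambda>e. e (i, j)) = De"
        using i jK by (intro distr_PiM_component prob_De) auto
      also have "(\<integral>\<^sup>+z. ennreal (exp (?a * z)) \<partial>De) = ennreal (\<integral>x. exp (?a * x) \<partial>De)"
        by (rule nn_integral_eq_integral[OF int]) simp
      also have "\<dots> \<le> ennreal (exp ((?x \<bullet> y)\<^sup>2 / 2))"
        using le R0 by (simp add: power_divide)
      finally have E1: "(\<integral>\<^sup>+e. ennreal (exp (?a * e (i, j))) \<partial>noise_space) \<le> ennreal (exp ((?x \<bullet> y)\<^sup>2 / 2))" .
      have "(\<integral>\<^sup>+e. ?g e y \<partial>noise_space) = ennreal (exp (y \<bullet> ?S - quad ?V y / 2)) * (ennreal (exp (- (?x \<bullet> y)\<^sup>2 / 2))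
         * (\<integral>\<^sup>+e. ennreal (exp (?a * e (i, j))) \<partial>noise_space))"
        by (subst nn_integral_cmult, measurable, subst nn_integral_cmult, measurable)
      also have "\<dots> \<le> ennreal (exp (y \<bullet> ?S - quad ?V y / 2)) * (ennreal (exp (- (?x \<bullet> y)\<^sup>2 / 2))
         * ennreal (exp ((?x \<bullet> y)\<^sup>2 / 2)))"
        by (intro mult_left_mono E1) auto
      also have "\<dots> = ennreal (exp (y \<bullet> ?S - quad ?V y / 2))"
        by (simp add: ennreal_mult'[symmetric] exp_add[symmetric])
      finally show "(\<integral>\<^sup>+e. ?g e y \<partial>noise_space) \<le> ennreal (exp (y \<bullet> ?S - quad ?V y / 2))" .
    qed
    finally show ?thesis unfolding mix_def gauss_mix_def by (simp add: divide_right_mono_ennreal)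
  qed
qed

lemma mix_measurable:
  assumes "state_measurable M X"
  shows "(\<lambda>w. mix i (X w)) \<in> borel_measurable M"
proof -
  note [measurable] = state_measurableD[OF assms]
  have [measurable]: "(\<lambda>w. st_V (X w) i *v \<theta> i) \<in> borel_measurable M"
    by (intro borel_measurable_matrix_vector_mult) measurable
  have S: "(\<lambda>w. (1 / R) *\<^sub>R noise_sum (X w) i) \<in> borel_measurable M"
    unfolding noise_sum_def by measurable
  show ?thesis
    unfolding mix_def
    by (rule borel_measurable_divide_ennreal[OF gauss_mix_measurable[OF _ S]]) measurable
qed

lemma W_measurable:
  assumes "state_measurable M X"
  shows "(\<lambda>w. W i (X w)) \<in> borel_measurable M"
proof -
  note [measurable] = mix_measurable[OF assms] state_measurableD(1)[OF assms]
  show ?thesis unfolding W_def batches_left_def log_def by measurable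
qed

lemma W_step_integral:
  assumes R0: "R > 0" and i: "i < N" and s: "valid n s" and n: "n < T"
  shows "(\<integral>\<^sup>+r. W i (step s (fst r) (snd r)) \<partial>one_round) \<le> W i s"
proof -
  interpret D: prob_space Dx by (rule prob_Dx)
  interpret E: prob_space noise_space by (rule prob_noise)
  have const: "state_measurable M (\<lambda>_. s)" for M :: "'z measure" by (simp add: state_measurable_def)
  have m: "(\<lambda>r. W i (step s (fst r) (snd r))) \<in> borel_measurable (Dx \<Otimes>\<^sub>M noise_space)"
    using round_measurable unfolding round_space_def
    by (intro W_measurable step_measurable const) auto
  have mm: "(\<lambda>e. mix i (mid s c e)) \<in> borel_measurable noise_space" for c
    by (intro mix_measurable mid_measurable const noise_measurable) auto
  have "(\<integral>\<^sup>+r. W i (step s (fst r) (snd r)) \<partial>one_round)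
      = (\<integral>\<^sup>+c. \<integral>\<^sup>+e. W i (step s c e) \<partial>noise_space \<partial>Dx)"
    unfolding round_space_def by (subst E.nn_integral_fst[OF m, symmetric]) simp
  also have "\<dots> \<le> (\<integral>\<^sup>+c. \<integral>\<^sup>+e. mix i (mid s c e) + ennreal (batches_left s) \<partial>noise_space \<partial>Dx)"
    by (intro nn_integral_mono W_step_le[OF s n])
  also have "\<dots> = (\<integral>\<^sup>+c. (\<integral>\<^sup>+e. mix i (mid s c e) \<partial>noise_space) + ennreal (batches_left s) \<partial>Dx)"
    using mm by (simp add: nn_integral_add E.emeasure_space_1)
  also have "\<dots> \<le> (\<integral>\<^sup>+c. W i s \<partial>Dx)"
    unfolding W_def by (intro nn_integral_mono add_right_mono mix_mid_integral[OF R0 i])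
  also have "\<dots> = W i s" by (simp add: D.emeasure_space_1)
  finally show ?thesis .
qed

definition fail :: "nat \<Rightarrow> nat \<Rightarrow> 'd outcome \<Rightarrow> bool" where
  "fail i n w \<longleftrightarrow> (\<exists>m\<in>{..n}. ennreal (real T) \<le> mix i (state w m))"

lemma fail_measurable: "n \<le> T \<Longrightarrow> Measurable.pred \<Omega> (fail i n)"
proof -
  assume n: "n \<le> T"
  have "Measurable.pred \<Omega> (\<lambda>w. ennreal (real T) \<le> mix i (state w m))" if "m \<in> {..n}" for m
  proof -
    from that n have "m \<le> T" by simp
    note [measurable] = mix_measurable[OF state_measurable_\<Omega>[OF this], of i]
    show ?thesis by measurable
  qed
  then show ?thesis unfolding fail_def[abs_def] by (intro pred_intros_finite(4)) auto
qed

abbreviation failure :: "nat \<Rightarrow> 'd outcome set" where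
  "failure i \<equiv> {w \<in> space \<Omega>. fail i T w}"

text \<open>From the first failure on the process is frozen at the level \<open>T\<close>, not at
  the larger current value of \<open>W\<close>. Markov's inequality at the final time then controls
  a failure at any time.\<close>

definition stopped :: "nat \<Rightarrow> nat \<Rightarrow> 'd outcome \<Rightarrow> ennreal" where
  "stopped i n w = (if fail i n w then ennreal (real T) else W i (state w n))"

lemma stopped_supermartingale:
  assumes R0: "R > 0" and i: "i < N" and n: "n < T"
  shows "(\<integral>\<^sup>+w. stopped i (Suc n) w \<partial>\<Omega>) \<le> (\<integral>\<^sup>+w. stopped i n w \<partial>\<Omega>)"
proof -
  interpret r: prob_space one_round by (rule prob_round)
  \<comment> \<open>Round \<open>Suc n\<close> is played with a separate outcome \<open>r\<close>,
    which is the shape required by \<open>nn_integral_round\<close>.\<close>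
  let ?G = "\<lambda>w r. if fail i n w then ennreal (real T) else W i (step (state w n) (fst r) (snd r))"
  have sub: "fail i n w \<Longrightarrow> fail i (Suc n) w" for w unfolding fail_def by auto
  have "stopped i (Suc n) w \<le> ?G w (w (Suc n))" for w
  proof (cases "fail i n w")
    case True
    then show ?thesis using sub[OF True] by (simp add: stopped_def)
  next
    case False
    show ?thesis
    proof (cases "fail i (Suc n) w")
      case True
      with False have "ennreal (real T) \<le> mix i (state w (Suc n))"
        unfolding fail_def by (auto simp: le_Suc_eq simp del: barb_states.simps(2))
      then have "ennreal (real T) \<le> W i (state w (Suc n))" unfolding W_def by (rule order_trans) simp
      then show ?thesis using True False by (simp add: stopped_def state_Suc del: barb_states.simps(2))
    next
      case F: False
      then show ?thesis using False by (simp add: stopped_def state_Suc del: barb_states.simps(2))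
    qed
  qed
  then have "(\<integral>\<^sup>+w. stopped i (Suc n) w \<partial>\<Omega>) \<le> (\<integral>\<^sup>+w. ?G w (w (Suc n)) \<partial>\<Omega>)"
    by (intro nn_integral_mono)
  also have "\<dots> = (\<integral>\<^sup>+w. \<integral>\<^sup>+r. ?G w r \<partial>one_round \<partial>\<Omega>)"
  proof (rule nn_integral_round[where t = "Suc n" and G = ?G])
    show "Suc n \<in> {1..T}" using n by simp
    have X: "state_measurable (\<Omega> \<Otimes>\<^sub>M one_round) (\<lambda>z. state (fst z) n)"
      using n by (intro state_measurable_state)
        (auto intro!: measurable_compose[OF measurable_compose[OF measurable_fst \<Omega>_component] round_measurable(1)]
          measurable_compose[OF measurable_compose[OF measurable_fst \<Omega>_component] round_measurable(2)])
    have "(\<lambda>z. W i (step (state (fst z) n) (fst (snd z)) (snd (snd z)))) \<in> borel_measurable (\<Omega> \<Otimes>\<^sub>M one_round)"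
      by (intro W_measurable step_measurable X measurable_compose[OF measurable_snd round_measurable(1)]
          measurable_compose[OF measurable_snd round_measurable(2)])
    moreover have "Measurable.pred (\<Omega> \<Otimes>\<^sub>M one_round) (\<lambda>z. fail i n (fst z))"
      using n by (intro measurable_compose[OF measurable_fst fail_measurable]) simp
    ultimately show "(\<lambda>(w, r). ?G w r) \<in> borel_measurable (\<Omega> \<Otimes>\<^sub>M one_round)"
      unfolding split_beta' by (intro measurable_If) (auto simp: pred_def)
    fix w r r'
    have st: "state (fun_upd w (Suc n) r') m = state w m" if "m \<le> n" for m
      by (rule state_cong) (use that in auto)
    then have "fail i n (fun_upd w (Suc n) r') = fail i n w" by (simp add: fail_def)
    then show "?G (fun_upd w (Suc n) r') r = ?G w r" by (simp add: st)
  qed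
  also have "\<dots> \<le> (\<integral>\<^sup>+w. stopped i n w \<partial>\<Omega>)"
  proof (intro nn_integral_mono)
    fix w
    show "(\<integral>\<^sup>+r. ?G w r \<partial>one_round) \<le> stopped i n w"
      using W_step_integral[OF R0 i valid_state n, of w] n
      by (cases "fail i n w") (simp_all add: stopped_def r.emeasure_space_1)
  qed
  finally show ?thesis .
qed

lemma batches_left_init: "batches_left (batch_init lam \<Delta>1) = max_batches"
  using \<Delta>1 by (simp add: batches_left_def batch_init_def)

lemma max_batches_nonneg: "max_batches \<ge> 0"
  using batches_left_nonneg[OF valid_init] by (simp add: batches_left_init)

text \<open>\<open>T\<close> times the probability of failure is at most the final expectation of
  \<open>stopped\<close>, hence at most its initial value. At time 0 nothing has failed, because the
  mixture is 1 and \<open>T \<ge> 2\<close>.\<close>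

lemma prob_fail:
  assumes R0: "R > 0" and i: "i < N"
  shows "measure \<Omega> (failure i) \<le> (1 + max_batches) / real T"
proof -
  interpret P: prob_space \<Omega> by (rule prob_\<Omega>)
  have F: "(failure i) \<in> sets \<Omega>" using fail_measurable[of T i] by (simp add: pred_def)
  have 0: "(\<integral>\<^sup>+w. stopped i 0 w \<partial>\<Omega>) \<le> ennreal (1 + max_batches)"
  proof -
    have "stopped i 0 w = ennreal (1 + max_batches)" for w
      using T2 max_batches_nonneg
      by (simp add: stopped_def fail_def W_def batches_left_init ennreal_plus flip: ennreal_1)
    then show ?thesis by (simp add: P.emeasure_space_1)
  qed
  have "(\<integral>\<^sup>+w. stopped i n w \<partial>\<Omega>) \<le> ennreal (1 + max_batches)" if "n \<le> T" for n
    using that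
  proof (induction n)
    case (Suc n)
    have "(\<integral>\<^sup>+w. stopped i (Suc n) w \<partial>\<Omega>) \<le> (\<integral>\<^sup>+w. stopped i n w \<partial>\<Omega>)"
      by (rule stopped_supermartingale[OF R0 i]) (use Suc.prems in simp)
    also have "\<dots> \<le> ennreal (1 + max_batches)" by (rule Suc.IH) (use Suc.prems in simp)
    finally show ?case .
  qed (rule 0)
  from this[of T] have le: "(\<integral>\<^sup>+w. stopped i T w \<partial>\<Omega>) \<le> ennreal (1 + max_batches)" by simp
  have "ennreal (real T) * emeasure \<Omega> (failure i)
      = (\<integral>\<^sup>+w. ennreal (real T) * indicator (failure i) w \<partial>\<Omega>)"
    using F by (simp add: nn_integral_cmult_indicator)
  also have "\<dots> \<le> (\<integral>\<^sup>+w. stopped i T w \<partial>\<Omega>)"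
    by (intro nn_integral_mono) (auto simp: stopped_def indicator_def)
  also note le
  finally have "ennreal (real T * measure \<Omega> (failure i)) \<le> ennreal (1 + max_batches)"
    by (simp add: P.emeasure_eq_measure ennreal_mult')
  then have "real T * measure \<Omega> (failure i) \<le> 1 + max_batches"
    using max_batches_nonneg by (subst (asm) ennreal_le_iff) auto
  then show ?thesis using T2 by (simp add: pos_le_divide_eq mult.commute)
qed

text \<open>Taking logarithms in \<open>mix < T\<close> bounds the squared norm of the noise sum,
  divided by \<open>R^2\<close>, by \<open>2 ln T\<close> plus \<open>d ln (u / lam)\<close>, the
  bound for the logarithm of the determinant ratio.\<close>

lemma not_fail_confident:
  assumes R0: "R > 0" and V: "valid_V n s" "n \<le> T" and nf: "\<And>i. i < N \<Longrightarrow> mix i s < ennreal (real T)"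
  shows "confident s"
  unfolding confident_def
proof (intro allI impI)
  fix i assume i: "i < N"
  let ?V = "st_V s i" and ?S = "noise_sum s i"
  define u where "u = lam + real n * Bx\<^sup>2"
  have Vi: "sym_between lam u ?V" using V by (simp add: valid_V_def u_def)
  have u: "u > 0" "u \<ge> lam" using lam by (simp_all add: u_def add_pos_nonneg)
  define v where "v = vnorm_inv ?V ?S"
  define g where "g = enn2real (gauss_integral ?V)"
  define g0 where "g0 = sqrt (2 * pi / lam) ^ CARD('d)"
  have g: "gauss_integral ?V = ennreal g" "g > 0" "sqrt (2 * pi / u) ^ CARD('d) \<le> g"
    using gauss_integral_finite[OF Vi u(1)] by (simp_all add: g_def)
  have g0: "gauss_integral V0 = ennreal g0" "g0 > 0"
    using lam by (simp_all add: gauss_integral_mat g0_def)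
  have q: "((1 / R) *\<^sub>R ?S) \<bullet> (matrix_inv ?V *v ((1 / R) *\<^sub>R ?S)) = v\<^sup>2 / R\<^sup>2"
    using sym_between_Cauchy_Schwarz(3)[OF Vi, of ?S]
    by (simp add: v_def matrix_vector_mult_scaleR power2_eq_square)
  have "mix i s = ennreal (exp (v\<^sup>2 / R\<^sup>2 / 2)) * ennreal g / ennreal g0"
    unfolding mix_def gauss_mix_eq[OF Vi] q g(1) g0(1) ..
  also have "\<dots> = ennreal (exp (v\<^sup>2 / R\<^sup>2 / 2) * g / g0)"
    using g(2) g0(2) by (simp add: ennreal_mult'[symmetric] divide_ennreal)
  finally have "ennreal (exp (v\<^sup>2 / R\<^sup>2 / 2) * g / g0) < ennreal (real T)"
    using nf[OF i] by (simp only:)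
  moreover have "0 \<le> exp (v\<^sup>2 / R\<^sup>2 / 2) * g / g0" using g(2) g0(2) by simp
  ultimately have "exp (v\<^sup>2 / R\<^sup>2 / 2) * g / g0 < real T"
    by (simp only: ennreal_less_iff)
  then have lt: "exp (v\<^sup>2 / R\<^sup>2 / 2) * g < real T * g0" using g0(2) by (simp add: pos_divide_less_eq)
  have "ln (exp (v\<^sup>2 / R\<^sup>2 / 2) * g) < ln (real T * g0)"
    by (rule ln_less_cancel_iff[THEN iffD2]) (use lt g g0 T2 in \<open>auto intro!: mult_pos_pos\<close>)
  then have 1: "v\<^sup>2 / R\<^sup>2 / 2 + ln g < logT + ln g0"
    using g(2) g0(2) T2 by (simp add: ln_mult)
  have lnp: "ln (sqrt (2 * pi / x) ^ CARD('d)) = real CARD('d) * (ln (2 * pi / x) / 2)" if "x > 0" for x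
    using that by (simp add: ln_realpow ln_sqrt)
  have "ln (sqrt (2 * pi / u) ^ CARD('d)) \<le> ln g"
    by (rule ln_mono) (use g u in auto)
  then have 2: "real CARD('d) * (ln (2 * pi / u) / 2) \<le> ln g" by (simp add: lnp[OF u(1)])
  have 3: "ln g0 = real CARD('d) * (ln (2 * pi / lam) / 2)" unfolding g0_def by (rule lnp[OF lam])
  have 4: "ln (2 * pi / lam) - ln (2 * pi / u) = ln (u / lam)" using u(1) lam by (simp add: ln_div)
  have "v\<^sup>2 / R\<^sup>2 / 2 \<le> logT + real CARD('d) * (ln (2 * pi / lam) / 2) - real CARD('d) * (ln (2 * pi / u) / 2)"
    using 1 2 3 by linarith
  also have "\<dots> = logT + real CARD('d) * ((ln (2 * pi / lam) - ln (2 * pi / u)) / 2)"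
    by (simp add: algebra_simps diff_divide_distrib)
  also have "\<dots> = logT + real CARD('d) * (ln (u / lam) / 2)" unfolding 4 ..
  finally have 5: "v\<^sup>2 / R\<^sup>2 \<le> 2 * logT + real CARD('d) * ln (u / lam)" by simp
  have d1: "1 \<le> real CARD('d)"
    using zero_less_card_finite[where 'a = 'd] by linarith
  have p: "growth > 0" using lam by (simp add: add_pos_nonneg)
  have "real n * Bx\<^sup>2 \<le> real T * Bx\<^sup>2" using V(2) by (intro mult_right_mono) auto
  then have "u / lam \<le> growth"
    using lam by (simp add: u_def add_divide_distrib divide_right_mono)
  then have "ln (u / lam) \<le> ln growth"
    using u lam by (intro ln_mono) auto
  then have "real CARD('d) * ln (u / lam) \<le> real CARD('d) * ln growth"
    by (intro mult_left_mono) auto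
  \<comment> \<open>As \<open>d \<ge> 1\<close>, the term \<open>2 ln T\<close> fits under the
    factor \<open>d\<close> of the prescribed radius, where it becomes
    \<open>ln (1 / \<delta>)\<close>.\<close>
  moreover have "2 * logT \<le> real CARD('d) * (2 * logT)"
    using mult_right_mono[OF d1, of "2 * logT"] lnT by simp
  ultimately have "v\<^sup>2 / R\<^sup>2 \<le> real CARD('d) * (ln growth + 2 * logT)"
    using 5 unfolding distrib_left by linarith
  also have "ln growth + 2 * logT = ln (growth * (real T)\<^sup>2)"
    using p T2 by (simp add: ln_mult ln_realpow)
  finally have "v\<^sup>2 / R\<^sup>2 \<le> real CARD('d) * ln (growth * (real T)\<^sup>2)" .
  then have "sqrt (v\<^sup>2 / R\<^sup>2) \<le> radius" unfolding radius_def by (rule real_sqrt_le_mono)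
  moreover have "sqrt (v\<^sup>2 / R\<^sup>2) = v / R"
    using R0 sym_between_Cauchy_Schwarz(2)[OF Vi] by (simp add: real_sqrt_divide v_def)
  ultimately show "vnorm_inv ?V ?S \<le> R * radius"
    using R0 by (simp add: v_def pos_divide_le_eq mult.commute)
qed

lemma not_fail_imp_confident:
  assumes "R > 0" "ctx_bounded w" "\<And>i. i < N \<Longrightarrow> \<not> fail i T w" "n < T"
  shows "confident (state w n)"
proof (rule not_fail_confident[OF assms(1)])
  show "valid_V n (state w n)" using assms(2,4) by (intro valid_V_state) (auto simp: ctx_bounded_def)
  show "mix i (state w n) < ennreal (real T)" if "i < N" for i
    using assms(3)[OF that] assms(4) by (auto simp: fail_def not_le)
qed (use assms(4) in simp)

text \<open>Takes the place of the mixture argument for \<open>R = 0\<close>, where the rescaling by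
  \<open>1 / R\<close> carries no information.\<close>

lemma noise_free_confident:
  assumes R0: "R = 0" and e0: "\<And>t i j. t \<in> {1..T} \<Longrightarrow> i < N \<Longrightarrow> j < K \<Longrightarrow> snd (w t) (i, j) = 0"
    and n: "n \<le> T"
  shows "confident (state w n)"
proof -
  have "noise_sum (state w n) i = 0" if "i < N" for i
    using n
  proof (induction n)
    case (Suc n)
    have "(case mm E i of None \<Rightarrow> 0 | Some j \<Rightarrow> snd (w (Suc n)) (i, j) *\<^sub>R fst (w (Suc n)) j) = 0"
      if "E = expl (state w n) (fst (w (Suc n)))" for E
    proof (cases "mm E i")
      case (Some j)
      then have "j < K" using mm_Some unfolding that expl_def by blast
      then show ?thesis using e0[of "Suc n" i j] Suc.prems \<open>i < N\<close> Some by simp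
    qed simp
    then show ?case using Suc by (simp add: state_Suc step_def noise_sum_mid del: barb_states.simps(2))
  qed simp
  moreover have "0 \<le> R * radius" by (simp only: R0 mult_zero_left order_refl)
  ultimately show ?thesis by (simp add: confident_def vnorm_inv_def)
qed

end

section \<open>Noise, close contexts and expected regret\<close>

context barb_env
begin

definition played :: "nat \<Rightarrow> nat \<Rightarrow> nat \<Rightarrow> 'd outcome \<Rightarrow> real" where
  "played i j t w = (if play (state w (t - 1)) (fst (w t)) i = Some j then 1 else 0)"

definition pair_noise :: "(nat \<Rightarrow> nat option) \<Rightarrow> (nat \<times> nat \<Rightarrow> real) \<Rightarrow> nat \<Rightarrow> real" where
  "pair_noise \<mu> e i = (case \<mu> i of None \<Rightarrow> 0 | Some j \<Rightarrow> e (i, j))"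

definition obs_noise :: "nat \<Rightarrow> nat \<Rightarrow> 'd outcome \<Rightarrow> real" where
  "obs_noise i t w = pair_noise (play (state w (t - 1)) (fst (w t))) (snd (w t)) i"

definition part_regret :: "nat \<Rightarrow> nat \<Rightarrow> 'd outcome \<Rightarrow> real" where
  "part_regret i t w = (\<Sum>s\<in>{1..t}. gap (state w (s - 1)) (fst (w s)) i - obs_noise i s w)"

definition noise_unit :: "nat \<times> nat \<Rightarrow> nat \<times> nat \<Rightarrow> real" where
  "noise_unit q = (\<lambda>p\<in>{..<N} \<times> {..<K}. if p = q then 1 else 0)"

definition noise_zero :: "nat \<times> nat \<Rightarrow> real" where
  "noise_zero = (\<lambda>p\<in>{..<N} \<times> {..<K}. 0)"

lemma noise_unit_space: "noise_unit q \<in> space noise_space" "noise_zero \<in> space noise_space"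
proof -
  have "space De = UNIV" using sets_eq_imp_space_eq[OF sets_De] by simp
  then show "noise_unit q \<in> space noise_space" "noise_zero \<in> space noise_space"
    by (auto simp: space_PiM noise_unit_def noise_zero_def)
qed

lemma state_upd: "n < t \<Longrightarrow> state (fun_upd w t r) n = state w n"
  by (rule state_cong) auto

lemma part_regret_upd:
  assumes "t \<in> {1..T}"
  shows "part_regret i t (fun_upd w t (c, e)) = part_regret i (t - 1) w
    + (gap (state w (t - 1)) c i - pair_noise (play (state w (t - 1)) c) e i)"
proof -
  obtain n where t: "t = Suc n" using assms by (cases t) auto
  have "(\<Sum>s\<in>{1..n}. gap (state (fun_upd w t (c, e)) (s - 1)) (fst (fun_upd w t (c, e) s)) i - obs_noise i s (fun_upd w t (c, e)))
      = part_regret i n w"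
    unfolding part_regret_def
    by (intro sum.cong) (auto simp: t obs_noise_def state_upd)
  then show ?thesis
    by (simp add: part_regret_def t obs_noise_def state_upd)
qed

lemma match_util_play:
  "match_util U (play s c) i = (\<Sum>j<K. (if play s c i = Some j then 1 else 0) * U i j)"
proof (cases "play s c i")
  case (Some j)
  then have "j < K" by (rule play_lessK)
  then show ?thesis using Some by (simp add: match_util_def if_distrib[where f = "\<lambda>x. x * _"] cong: if_cong)
qed (simp add: match_util_def)

lemma obs_noise_eq: "obs_noise i t w = (\<Sum>j<K. played i j t w * snd (w t) (i, j))"
  using match_util_play[of "\<lambda>i j. snd (w t) (i, j)" "state w (t - 1)" "fst (w t)" i]
  by (simp add: obs_noise_def pair_noise_def match_util_def played_def)

lemma upd_measurable:
  assumes t: "t \<in> {1..T}" and f: "f \<in> measurable M \<Omega>" and g: "g \<in> measurable M one_round"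
  shows "(\<lambda>x. fun_upd (f x) t (g x)) \<in> measurable M \<Omega>"
  using f g t unfolding sample_space_def
  by (intro measurable_fun_upd[where J = "{1..T}"]) auto

lemma pair_round_measurable:
  assumes "f \<in> measurable M Dx" "e \<in> space noise_space"
  shows "(\<lambda>x. (f x, e)) \<in> measurable M one_round"
  unfolding round_space_def using assms by (intro measurable_Pair measurable_const)

lemma fst_measurable: "t \<in> {1..T} \<Longrightarrow> (\<lambda>w. fst (w t)) \<in> measurable \<Omega> Dx"
  using \<Omega>_component[of t] unfolding round_space_def by (rule measurable_compose[OF _ measurable_fst])

text \<open>The tie-breaking rule may be an arbitrary function, so the played matching need not be
  measurable a priori. Measurability of the total regret forces it: changing the last noise from
  \<open>noise_zero\<close> to \<open>noise_unit (i, j)\<close> alters the regret exactly when \<open>i\<close> is matched to \<open>j\<close>.\<close>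

lemma played_measurable_last:
  assumes t: "t \<in> {1..T}" and ij: "i < N" "j < K" and m: "part_regret i t \<in> borel_measurable \<Omega>"
  shows "played i j t \<in> borel_measurable \<Omega>"
proof -
  have "(\<lambda>w. part_regret i t (fun_upd w t (fst (w t), e))) \<in> borel_measurable \<Omega>"
    if "e \<in> space noise_space" for e
    by (rule measurable_compose[OF upd_measurable[OF t _ pair_round_measurable[OF fst_measurable[OF t] that]] m])
       simp
  from this[OF noise_unit_space(2)] this[OF noise_unit_space(1)[of "(i, j)"]]
  have "(\<lambda>w. part_regret i t (fun_upd w t (fst (w t), noise_zero))
      - part_regret i t (fun_upd w t (fst (w t), noise_unit (i, j)))) \<in> borel_measurable \<Omega>"
    by (rule borel_measurable_diff)
  also have "(\<lambda>w. part_regret i t (fun_upd w t (fst (w t), noise_zero))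
      - part_regret i t (fun_upd w t (fst (w t), noise_unit (i, j)))) = played i j t"
    using ij play_lessK
    by (auto simp: fun_eq_iff part_regret_upd[OF t] played_def pair_noise_def noise_zero_def
        noise_unit_def split: option.split)
  finally show ?thesis .
qed

text \<open>Step of a backward induction over the rounds. Fixing the context \<open>c\<close> and
  zero noise in round \<open>t\<close> turns the optimal share of that round into a constant. The
  last summand is then measurable through \<open>played\<close> and can be subtracted.\<close>

lemma part_regret_measurable_pred:
  assumes t: "t \<in> {1..T}" and i: "i < N" and m: "part_regret i t \<in> borel_measurable \<Omega>"
  shows "part_regret i (t - 1) \<in> borel_measurable \<Omega>"
proof -
  interpret D: prob_space Dx by (rule prob_Dx)
  obtain c where c: "c \<in> space Dx" using D.not_empty by blast
  let ?u = "\<lambda>w. fun_upd w t (c, noise_zero)"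
  have u: "?u \<in> measurable \<Omega> \<Omega>"
    by (rule upd_measurable[OF t _ pair_round_measurable[OF measurable_const[OF c] noise_unit_space(2)]])
       simp
  have pm: "(\<lambda>w. played i j t (?u w)) \<in> borel_measurable \<Omega>" if "j < K" for j
    by (rule measurable_compose[OF u played_measurable_last[OF t i that m]])
  have "t - 1 < t" using t by auto
  then have eq: "part_regret i (t - 1) w = part_regret i t (?u w)
      - (opt_stable_util N K rk (util c) i - (\<Sum>j<K. played i j t (?u w) * util c i j))" for w
    using i play_lessK
    by (auto simp: part_regret_upd[OF t] gap_def match_util_play played_def state_upd pair_noise_def
        noise_zero_def split: option.split)
  have "(\<lambda>w. part_regret i t (?u w)
      - (opt_stable_util N K rk (util c) i - (\<Sum>j<K. played i j t (?u w) * util c i j))) \<in> borel_measurable \<Omega>"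
    by (intro borel_measurable_diff borel_measurable_const borel_measurable_sum borel_measurable_times
        pm measurable_compose[OF u m]) auto
  then show ?thesis unfolding eq[symmetric] .
qed

lemma played_measurable:
  assumes m: "part_regret i T \<in> borel_measurable \<Omega>" and i: "i < N" and j: "j < K" and t: "t \<in> {1..T}"
  shows "played i j t \<in> borel_measurable \<Omega>"
proof -
  have "part_regret i (T - n) \<in> borel_measurable \<Omega>" if "n \<le> T" for n
    using that
  proof (induction n)
    case (Suc n)
    then show ?case using part_regret_measurable_pred[OF _ i, of "T - n"] by simp
  qed (use m in simp)
  from this[of "T - t"] t show ?thesis by (intro played_measurable_last i j) auto
qed

section \<open>The observed noise has mean zero along the play\<close>

lemma De_pos_neg:
  "(\<integral>\<^sup>+x. ennreal x \<partial>De) = (\<integral>\<^sup>+x. ennreal (- x) \<partial>De)" "(\<integral>\<^sup>+x. ennreal x \<partial>De) < \<infinity>"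
proof -
  have f: "(\<integral>\<^sup>+x. ennreal x \<partial>De) \<noteq> \<infinity>" "(\<integral>\<^sup>+x. ennreal (- x) \<partial>De) \<noteq> \<infinity>"
    using De_int by (auto simp: real_integrable_def)
  then show "(\<integral>\<^sup>+x. ennreal x \<partial>De) < \<infinity>" by (simp add: top.not_eq_extremum)
  have "enn2real (\<integral>\<^sup>+x. ennreal x \<partial>De) = enn2real (\<integral>\<^sup>+x. ennreal (- x) \<partial>De)"
    using real_lebesgue_integral_def[OF De_int] De_mean by simp
  then show "(\<integral>\<^sup>+x. ennreal x \<partial>De) = (\<integral>\<^sup>+x. ennreal (- x) \<partial>De)"
    using f by (metis ennreal_enn2real infinity_ennreal_def less_top)
qed

text \<open>The matching of round \<open>t\<close> does not see the noise of round \<open>t\<close>.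
  Hence the positive and the negative part of the product have the same finite integral, a common
  weight times the corresponding part of the noise.\<close>

lemma played_noise_integral:
  assumes t: "t \<in> {1..T}" and ij: "i < N" "j < K" and m: "played i j t \<in> borel_measurable \<Omega>"
  shows "integrable \<Omega> (\<lambda>w. played i j t w * snd (w t) (i, j))"
    and "(\<integral>w. played i j t w * snd (w t) (i, j) \<partial>\<Omega>) = 0"
proof -
  interpret D: prob_space Dx by (rule prob_Dx)
  interpret E: prob_space noise_space by (rule prob_noise)
  interpret P: prob_space \<Omega> by (rule prob_\<Omega>)
  \<comment> \<open>\<open>played\<close> with the context of round \<open>t\<close> as a separate
    argument; inserting \<open>noise_zero\<close> is harmless and yields joint measurability from
    that of \<open>played\<close>.\<close>
  define Q where "Q w c = played i j t (fun_upd w t (c, noise_zero))" for w c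
  have Q: "Q w c = (if play (state w (t - 1)) c i = Some j then 1 else 0)" for w c
    using t by (simp add: Q_def played_def state_upd)
  have Qm: "(\<lambda>x. Q (f x) (g x)) \<in> borel_measurable M"
    if "f \<in> measurable M \<Omega>" "g \<in> measurable M Dx" for f g and M :: "'z measure"
    unfolding Q_def
    by (rule measurable_compose[OF upd_measurable[OF t that(1) pair_round_measurable[OF that(2)]] m])
       (rule noise_unit_space)
  \<comment> \<open>The conditional probability, given the earlier rounds, that \<open>i\<close> is
    matched to \<open>j\<close> in round \<open>t\<close>.\<close>
  define \<kappa> where "\<kappa> w = (\<integral>\<^sup>+c. ennreal (Q w c) \<partial>Dx)" for w
  have \<kappa>1: "\<kappa> w \<le> 1" for w
  proof -
    have "\<kappa> w \<le> (\<integral>\<^sup>+c. 1 \<partial>Dx)" unfolding \<kappa>_def by (intro nn_integral_mono) (simp add: Q)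
    then show ?thesis by (simp add: D.emeasure_space_1)
  qed
  have key: "(\<integral>\<^sup>+w. ennreal (played i j t w) * h (snd (w t) (i, j)) \<partial>\<Omega>) = (\<integral>\<^sup>+w. \<kappa> w * (\<integral>\<^sup>+x. h x \<partial>De) \<partial>\<Omega>)"
    if h: "h \<in> borel_measurable borel" for h :: "real \<Rightarrow> ennreal"
  proof -
    let ?G = "\<lambda>w r. ennreal (Q w (fst r)) * h (snd r (i, j))"
    have "(\<integral>\<^sup>+w. ennreal (played i j t w) * h (snd (w t) (i, j)) \<partial>\<Omega>) = (\<integral>\<^sup>+w. ?G w (w t) \<partial>\<Omega>)"
      by (simp add: Q played_def)
    also have "\<dots> = (\<integral>\<^sup>+w. \<integral>\<^sup>+r. ?G w r \<partial>one_round \<partial>\<Omega>)"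
    proof (rule nn_integral_round[OF t])
      have fst_r: "fst \<in> measurable one_round Dx" unfolding round_space_def by (rule measurable_fst)
      have "(\<lambda>z. Q (fst z) (fst (snd z))) \<in> borel_measurable (\<Omega> \<Otimes>\<^sub>M one_round)"
        by (intro Qm measurable_fst measurable_compose[OF measurable_snd fst_r])
      moreover have "(\<lambda>z. h (snd (snd z) (i, j))) \<in> borel_measurable (\<Omega> \<Otimes>\<^sub>M one_round)"
        by (intro measurable_compose[OF measurable_compose[OF measurable_snd round_measurable(2)[OF ij]] h])
      ultimately show "(\<lambda>(w, r). ?G w r) \<in> borel_measurable (\<Omega> \<Otimes>\<^sub>M one_round)"
        unfolding split_beta' by (intro borel_measurable_times_ennreal measurable_compose[OF _ measurable_ennreal])
      show "?G (fun_upd w t r') r = ?G w r" for w r r' by (simp add: Q_def)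
    qed
    also have "\<dots> = (\<integral>\<^sup>+w. \<kappa> w * (\<integral>\<^sup>+x. h x \<partial>De) \<partial>\<Omega>)"
    proof (intro nn_integral_cong)
      fix w assume w: "w \<in> space \<Omega>"
      have hm: "(\<lambda>e. h (e (i, j))) \<in> borel_measurable noise_space"
        by (rule measurable_compose[OF noise_measurable[OF ij] h])
      have qm: "(\<lambda>c. ennreal (Q w c)) \<in> borel_measurable Dx"
        using Qm[of "\<lambda>_. w" Dx "\<lambda>c. c"] w by simp
      have Gm: "?G w \<in> borel_measurable (Dx \<Otimes>\<^sub>M noise_space)"
        by (intro borel_measurable_times_ennreal measurable_compose[OF measurable_fst qm]
            measurable_compose[OF measurable_snd hm])
      have "(\<integral>\<^sup>+e. h (e (i, j)) \<partial>noise_space) = (\<integral>\<^sup>+x. h x \<partial>distr noise_space De (\<lambda>e. e (i, j)))"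
        using ij h by (intro nn_integral_distr[symmetric] measurable_component_singleton)
          (auto simp: measurable_cong_sets[OF sets_De refl])
      also have "distr noise_space De (\<lambda>e. e (i, j)) = De"
        using ij by (intro distr_PiM_component prob_De) auto
      finally have hD: "(\<integral>\<^sup>+e. h (e (i, j)) \<partial>noise_space) = (\<integral>\<^sup>+x. h x \<partial>De)" .
      have "(\<integral>\<^sup>+r. ?G w r \<partial>one_round) = (\<integral>\<^sup>+c. \<integral>\<^sup>+e. ?G w (c, e) \<partial>noise_space \<partial>Dx)"
        unfolding round_space_def by (rule E.nn_integral_fst[OF Gm, symmetric])
      also have "\<dots> = (\<integral>\<^sup>+c. ennreal (Q w c) * (\<integral>\<^sup>+x. h x \<partial>De) \<partial>Dx)"
        using hm by (simp add: nn_integral_cmult hD)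
      also have "\<dots> = \<kappa> w * (\<integral>\<^sup>+x. h x \<partial>De)"
        unfolding \<kappa>_def by (rule nn_integral_multc[OF qm])
      finally show "(\<integral>\<^sup>+r. ?G w r \<partial>one_round) = \<kappa> w * (\<integral>\<^sup>+x. h x \<partial>De)" .
    qed
    finally show ?thesis .
  qed
  let ?f = "\<lambda>w. played i j t w * snd (w t) (i, j)"
  have pp: "played i j t w \<ge> 0" for w by (simp add: played_def)
  have pos: "(\<integral>\<^sup>+w. ennreal (?f w) \<partial>\<Omega>) = (\<integral>\<^sup>+w. \<kappa> w * (\<integral>\<^sup>+x. ennreal x \<partial>De) \<partial>\<Omega>)"
    using key[of ennreal] by (simp add: ennreal_mult'[OF pp])
  have neg: "(\<integral>\<^sup>+w. ennreal (- ?f w) \<partial>\<Omega>) = (\<integral>\<^sup>+w. \<kappa> w * (\<integral>\<^sup>+x. ennreal x \<partial>De) \<partial>\<Omega>)"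
    using key[of "\<lambda>x. ennreal (- x)"] unfolding De_pos_neg(1)
    by (simp add: ennreal_mult'[OF pp, symmetric])
  have "(\<integral>\<^sup>+w. \<kappa> w * (\<integral>\<^sup>+x. ennreal x \<partial>De) \<partial>\<Omega>) \<le> (\<integral>\<^sup>+w. 1 * (\<integral>\<^sup>+x. ennreal x \<partial>De) \<partial>\<Omega>)"
    by (intro nn_integral_mono mult_right_mono \<kappa>1) simp
  also have "\<dots> < \<infinity>" using De_pos_neg(2) by (simp add: P.emeasure_space_1)
  finally have fin: "(\<integral>\<^sup>+w. \<kappa> w * (\<integral>\<^sup>+x. ennreal x \<partial>De) \<partial>\<Omega>) < \<infinity>" .
  have fm: "?f \<in> borel_measurable \<Omega>"
    by (intro borel_measurable_times m measurable_compose[OF \<Omega>_component[OF t] round_measurable(2)[OF ij]])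
  show int: "integrable \<Omega> ?f"
    unfolding real_integrable_def pos neg using fm fin by simp
  show "(\<integral>w. ?f w \<partial>\<Omega>) = 0"
    unfolding real_lebesgue_integral_def[OF int] pos neg by simp
qed

text \<open>The sign condition on \<open>H\<close> serves the case of a non-integrable regret, whose
  integral is 0 by convention. Otherwise every \<open>played\<close> is measurable and the noise
  drops out of the expectation.\<close>

lemma regret_le:
  assumes i: "i < N" and H: "integrable \<Omega> H" and H0: "0 \<le> (\<integral>w. H w \<partial>\<Omega>)"
    and le: "AE w in \<Omega>. total_gap i w \<le> H w"
  shows "regret i \<le> (\<integral>w. H w \<partial>\<Omega>)"
proof -
  let ?gaps = "\<lambda>w. \<Sum>t\<in>{1..T}. gap (state w (t - 1)) (fst (w t)) i"
  have "opt_stable_util N K rk (\<lambda>i' j. \<theta> i' \<bullet> fst (w t) j) i - barb_obs N K rk \<theta> mm plist T eta lam \<Delta>1 w t i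
      = gap (state w (t - 1)) (fst (w t)) i - obs_noise i t w" for w t
  proof -
    have "(\<lambda>i' j. \<theta> i' \<bullet> fst (w t) j) = util (fst (w t))" by (simp add: util_def fun_eq_iff)
    then show ?thesis
      by (simp add: gap_def barb_obs_def barb_matching_eq obs_noise_def pair_noise_def match_util_def
          util_def split: option.split)
  qed
  then have reg: "regret i = (\<integral>w. part_regret i T w \<partial>\<Omega>)"
    by (simp add: barb_regret_def part_regret_def)
  show ?thesis
  proof (cases "integrable \<Omega> (part_regret i T)")
    case False
    then show ?thesis unfolding reg using H0 by (simp add: not_integrable_integral_eq)
  next
    case True
    then have m: "part_regret i T \<in> borel_measurable \<Omega>" by simp
    have n1: "integrable \<Omega> (obs_noise i t)" and n2: "(\<integral>w. obs_noise i t w \<partial>\<Omega>) = 0" if "t \<in> {1..T}" for t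
    proof -
      have 1: "integrable \<Omega> (\<lambda>w. played i j t w * snd (w t) (i, j))"
        and 2: "(\<integral>w. played i j t w * snd (w t) (i, j) \<partial>\<Omega>) = 0" if "j \<in> {..<K}" for j
        using played_noise_integral[OF \<open>t \<in> {1..T}\<close> i _ played_measurable[OF m i _ \<open>t \<in> {1..T}\<close>]] that
        by auto
      show "integrable \<Omega> (obs_noise i t)"
        unfolding obs_noise_eq[abs_def] by (rule Bochner_Integration.integrable_sum[OF 1])
      show "(\<integral>w. obs_noise i t w \<partial>\<Omega>) = 0"
      proof -
        have "(\<integral>w. obs_noise i t w \<partial>\<Omega>) = (\<Sum>j<K. \<integral>w. played i j t w * snd (w t) (i, j) \<partial>\<Omega>)"
          unfolding obs_noise_eq by (rule Bochner_Integration.integral_sum) (rule 1)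
        also have "\<dots> = 0" by (rule sum.neutral) (use 2 in blast)
        finally show ?thesis .
      qed
    qed
    let ?n = "\<lambda>w. \<Sum>t\<in>{1..T}. obs_noise i t w"
    have ni: "integrable \<Omega> ?n" by (rule Bochner_Integration.integrable_sum) (rule n1)
    have "(\<integral>w. ?n w \<partial>\<Omega>) = (\<Sum>t\<in>{1..T}. \<integral>w. obs_noise i t w \<partial>\<Omega>)"
      by (rule Bochner_Integration.integral_sum) (rule n1)
    also have "\<dots> = 0" by (rule sum.neutral) (use n2 in blast)
    finally have n0: "(\<integral>w. ?n w \<partial>\<Omega>) = 0" .
    have eq: "?gaps = (\<lambda>w. part_regret i T w + ?n w)"
      by (simp add: part_regret_def sum_subtractf fun_eq_iff)
    have gi: "integrable \<Omega> ?gaps" unfolding eq using True ni by simp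
    have "(\<integral>w. part_regret i T w \<partial>\<Omega>) = (\<integral>w. ?gaps w \<partial>\<Omega>)"
      unfolding eq using True ni n0 by simp
    also have "\<dots> \<le> (\<integral>w. H w \<partial>\<Omega>)" by (rule integral_mono_AE[OF gi H le])
    finally show ?thesis unfolding reg .
  qed
qed

lemma AE_round_\<Omega>:
  assumes "AE r in one_round. P r"
  shows "AE w in \<Omega>. \<forall>t\<in>{1..T}. P (w t)"
  unfolding sample_space_def
  by (intro AE_finite_allI AE_PiM_component prob_round assms) auto

lemma AE_ctx_\<Omega>:
  assumes "AE c in Dx. P c"
  shows "AE w in \<Omega>. \<forall>t\<in>{1..T}. P (fst (w t))"
proof (rule AE_round_\<Omega>)
  show "AE r in one_round. P (fst r)"
    unfolding round_space_def
    by (rule AE_distrD[OF measurable_fst], subst prob_space.distr_pair_fst[OF prob_noise]) (rule assms)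
qed

end

context barb_prob
begin

section \<open>Rounds with a small true gap\<close>

lemma near_measurable: "Measurable.pred Dx (near D)"
proof -
  have eq: "near D = (\<lambda>c. \<exists>i\<in>{..<N}. \<exists>j\<in>{..<K}. \<exists>j'\<in>{..<K}. j \<noteq> j' \<and> \<bar>\<theta> i \<bullet> (c j - c j')\<bar> < D)"
    unfolding near_def[abs_def] by (auto simp: fun_eq_iff)
  have m: "Measurable.pred Dx (\<lambda>c. j \<noteq> j' \<and> \<bar>\<theta> i \<bullet> (c j - c j')\<bar> < D)"
    if "j \<in> {..<K}" "j' \<in> {..<K}" for i j j'
  proof -
    note [measurable] = ctx_measurable[of j] ctx_measurable[of j']
    have [measurable]: "(\<lambda>c. c j) \<in> borel_measurable Dx" "(\<lambda>c. c j') \<in> borel_measurable Dx"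
      using that by (auto intro: ctx_measurable)
    show ?thesis by measurable
  qed
  show ?thesis unfolding eq
    by (rule pred_intros_finite(4), simp, rule pred_intros_finite(4), simp, rule pred_intros_finite(4), simp, rule m)
qed

abbreviation prob_near :: "real \<Rightarrow> real" where
  "prob_near D \<equiv> measure Dx {c \<in> space Dx. near D c}"

definition near_count :: "real \<Rightarrow> 'd outcome \<Rightarrow> real" where
  "near_count D w = real (card {t\<in>{1..T}. near D (fst (w t))})"

lemma near_\<Omega>_measurable: "t \<in> {1..T} \<Longrightarrow> Measurable.pred \<Omega> (\<lambda>w. near D (fst (w t)))"
  by (rule measurable_compose[OF fst_measurable near_measurable])

lemma near_count_measurable: "near_count D \<in> borel_measurable \<Omega>"
proof -
  have "near_count D = (\<lambda>w. \<Sum>t\<in>{1..T}. if near D (fst (w t)) then 1 else 0)"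
    by (simp add: near_count_def fun_eq_iff sum.If_cases Int_def)
  also have "\<dots> \<in> borel_measurable \<Omega>"
    using near_\<Omega>_measurable by (intro borel_measurable_sum measurable_If) (auto simp: pred_def)
  finally show ?thesis .
qed

text \<open>Chernoff bound with parameter \<open>ln 3\<close>: the moment generating function of the count is the
  product of the one-round values \<open>1 + 2 p\<close>.\<close>

lemma prob_near_count:
  assumes D: "0 < D" "D \<le> 1"
    and p: "prob_near D \<le> logT / (real T * D\<^sup>2)"
  shows "measure \<Omega> {w \<in> space \<Omega>. 3 * logT / D\<^sup>2 < near_count D w} \<le> 1 / real T"
proof -
  interpret D: prob_space Dx by (rule prob_Dx)
  interpret E: prob_space noise_space by (rule prob_noise)
  interpret r: prob_space one_round by (rule prob_round)
  interpret P: prob_space \<Omega> by (rule prob_\<Omega>)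
  interpret PS: product_sigma_finite "\<lambda>_. one_round" by standard
  define X where "X = logT / D\<^sup>2"
  \<comment> \<open>Here \<open>D \<le> 1\<close> enters; it turns the final tail
    \<open>exp (- X)\<close> into at most \<open>1 / T\<close>.\<close>
  have X0: "X \<ge> logT"
  proof -
    have "D\<^sup>2 \<le> 1" using D by (simp add: power_le_one)
    then show ?thesis using lnT D by (simp add: X_def le_divide_eq)
  qed
  define q where "q = prob_near D"
  have q0: "q \<ge> 0" by (simp add: q_def)
  have qX: "real T * q \<le> X"
    using mult_left_mono[OF p, of "real T"] T2 by (simp add: q_def X_def)
  define wt where "wt c = (if near D c then 3 else 1 :: ennreal)" for c
  have wm: "wt \<in> borel_measurable Dx"
    unfolding wt_def using near_measurable by (intro measurable_If) (auto simp: pred_def)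
  have wr: "(\<lambda>r. wt (fst r)) \<in> borel_measurable one_round"
    unfolding round_space_def by (rule measurable_compose[OF measurable_fst wm])
  have "(\<integral>\<^sup>+r. wt (fst r) \<partial>one_round) = (\<integral>\<^sup>+c. \<integral>\<^sup>+e. wt (fst (c, e)) \<partial>noise_space \<partial>Dx)"
    using wr unfolding round_space_def by (rule E.nn_integral_fst[symmetric])
  also have "\<dots> = (\<integral>\<^sup>+c. 1 + 2 * indicator {c \<in> space Dx. near D c} c \<partial>Dx)"
    by (intro nn_integral_cong) (simp add: E.emeasure_space_1 wt_def indicator_def)
  also have "\<dots> = 1 + 2 * ennreal q"
    using near_measurable
    by (subst nn_integral_add)
       (auto simp: pred_def nn_integral_cmult_indicator D.emeasure_space_1 q_def D.emeasure_eq_measure D.prob_space)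
  also have "\<dots> = ennreal (1 + 2 * q)" using q0 by (simp add: ennreal_plus ennreal_mult' flip: ennreal_numeral)
  finally have one: "(\<integral>\<^sup>+r. wt (fst r) \<partial>one_round) = ennreal (1 + 2 * q)" .
  have "(\<integral>\<^sup>+w. (\<Prod>t\<in>{1..T}. wt (fst (w t))) \<partial>\<Omega>) = (\<Prod>t\<in>{1..T}. \<integral>\<^sup>+r. wt (fst r) \<partial>one_round)"
    unfolding sample_space_def using wr by (intro PS.product_nn_integral_prod) auto
  also have "\<dots> = ennreal ((1 + 2 * q) ^ T)"
    using q0 unfolding one by (simp add: ennreal_power del: ennreal_plus)
  also have "\<dots> \<le> ennreal (exp (2 * X))"
  proof (rule ennreal_leI)
    have "(1 + 2 * q) ^ T \<le> exp (2 * q) ^ T"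
      using q0 by (intro power_mono exp_ge_add_one_self) auto
    also have "\<dots> = exp (real T * (2 * q))" by (rule exp_of_nat_mult[symmetric])
    also have "\<dots> \<le> exp (2 * X)" using qX by simp
    finally show "(1 + 2 * q) ^ T \<le> exp (2 * X)" .
  qed
  finally have mgf: "(\<integral>\<^sup>+w. (\<Prod>t\<in>{1..T}. wt (fst (w t))) \<partial>\<Omega>) \<le> ennreal (exp (2 * X))" .
  let ?A = "{w \<in> space \<Omega>. 3 * X < near_count D w}"
  have A: "?A \<in> sets \<Omega>" using near_count_measurable[of D] by measurable
  \<comment> \<open>Weights of 3 instead of \<open>exp 1\<close> keep the generating function
    simple. The tail is taken at \<open>exp (3 X)\<close> against an expectation of at most
    \<open>exp (2 X)\<close>, which leaves \<open>exp (- X)\<close>.\<close>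
  have prod: "ennreal (exp (near_count D w)) \<le> (\<Prod>t\<in>{1..T}. wt (fst (w t)))" for w
  proof -
    let ?n = "card {t\<in>{1..T}. near D (fst (w t))}"
    have "exp (near_count D w) = exp 1 ^ ?n" by (simp add: near_count_def exp_of_nat_mult[symmetric])
    also have "\<dots> \<le> 3 ^ ?n" by (intro power_mono exp_le) simp
    finally have "ennreal (exp (near_count D w)) \<le> ennreal (3 ^ ?n)" by (rule ennreal_leI)
    also have "\<dots> = (\<Prod>t\<in>{1..T}. wt (fst (w t)))"
      by (simp add: wt_def prod.If_cases Int_def ennreal_power[symmetric])
    finally show ?thesis .
  qed
  have "ennreal (exp (3 * X)) * emeasure \<Omega> ?A = (\<integral>\<^sup>+w. ennreal (exp (3 * X)) * indicator ?A w \<partial>\<Omega>)"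
    by (rule nn_integral_cmult_indicator[OF A, symmetric])
  also have "\<dots> \<le> (\<integral>\<^sup>+w. (\<Prod>t\<in>{1..T}. wt (fst (w t))) \<partial>\<Omega>)"
  proof (intro nn_integral_mono)
    fix w
    show "ennreal (exp (3 * X)) * indicator ?A w \<le> (\<Prod>t\<in>{1..T}. wt (fst (w t)))"
    proof (cases "w \<in> ?A")
      case True
      then have "ennreal (exp (3 * X)) \<le> ennreal (exp (near_count D w))" by (intro ennreal_leI) simp
      also note prod
      finally show ?thesis using True by simp
    qed simp
  qed
  also note mgf
  finally have "ennreal (exp (3 * X) * measure \<Omega> ?A) \<le> ennreal (exp (2 * X))"
    by (simp add: P.emeasure_eq_measure ennreal_mult')
  then have "exp (3 * X) * measure \<Omega> ?A \<le> exp (2 * X)" by (simp only: ennreal_le_iff[OF exp_ge_zero])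
  then have "measure \<Omega> ?A \<le> exp (2 * X) / exp (3 * X)" by (simp add: pos_le_divide_eq mult.commute)
  also have "\<dots> = exp (- X)" by (simp add: exp_diff[symmetric])
  also have "\<dots> \<le> exp (- logT)" using X0 by simp
  also have "\<dots> = 1 / real T" using T2 by (simp add: exp_minus inverse_eq_divide)
  finally show ?thesis by (simp add: X_def)
qed

text \<open>For \<open>R = 0\<close>, subgaussianity at the parameters 1 and -1 makes the
  expectation of \<open>exp x + exp (- x) - 2\<close> nonpositive. This function is a square that
  vanishes only at 0.\<close>

lemma noise_zero_AE:
  assumes "R = 0"
  shows "AE w in \<Omega>. \<forall>t\<in>{1..T}. \<forall>p\<in>{..<N} \<times> {..<K}. snd (w t) p = 0"
proof (rule AE_round_\<Omega>)
  interpret E: prob_space De by (rule prob_De)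
  interpret Dx: prob_space Dx by (rule prob_Dx)
  interpret NS: prob_space noise_space by (rule prob_noise)
  interpret pair_sigma_finite Dx noise_space ..
  have sub: "integrable De (\<lambda>x. exp (s * x))" "(\<integral>x. exp (s * x) \<partial>De) \<le> 1" for s
    using De_sub assms unfolding subgaussian_def by (auto simp del: mult_eq_0_iff)
  let ?f = "\<lambda>x. exp (1 * x) + exp (- 1 * x) - 2 :: real"
  have f: "?f x = (exp (x / 2) - exp (- (x / 2)))\<^sup>2" for x
  proof -
    have "exp (x / 2) * exp (x / 2) = exp x" "exp (- (x / 2)) * exp (- (x / 2)) = exp (- x)"
      "exp (x / 2) * exp (- (x / 2)) = 1" by (simp_all add: exp_add[symmetric])
    then show ?thesis by (simp add: power2_eq_square algebra_simps)
  qed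
  have nn: "0 \<le> ?f x" for x unfolding f by simp
  have f0: "x = 0" if "?f x = 0" for x using that unfolding f by simp
  have int: "integrable De ?f" using sub(1)[of 1] sub(1)[of "- 1"] by simp
  have "(\<integral>x. ?f x \<partial>De) = (\<integral>x. exp (1 * x) \<partial>De) + (\<integral>x. exp (- 1 * x) \<partial>De) - 2"
    using sub(1)[of 1] sub(1)[of "- 1"] by (simp add: E.prob_space)
  then have "(\<integral>x. ?f x \<partial>De) \<le> 0" using sub(2)[of 1] sub(2)[of "- 1"] by linarith
  moreover have "(\<integral>x. ?f x \<partial>De) \<ge> 0" unfolding f by (rule integral_nonneg_AE) simp
  ultimately have "(\<integral>x. ?f x \<partial>De) = 0" by simp
  then have "AE x in De. ?f x = 0"
    by (rule integral_nonneg_eq_0_iff_AE[OF int AE_I2[OF nn], THEN iffD1])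
  then have De0: "AE x in De. x = 0" by eventually_elim (rule f0)
  have "AE e in noise_space. \<forall>p\<in>{..<N} \<times> {..<K}. e p = 0"
    by (intro AE_finite_allI AE_PiM_component prob_De De0) auto
  moreover have "Measurable.pred (Dx \<Otimes>\<^sub>M noise_space) (\<lambda>r. \<forall>p\<in>{..<N} \<times> {..<K}. snd r p = 0)"
  proof (rule pred_intros_finite(3))
    fix p assume "p \<in> {..<N} \<times> {..<K}"
    then have "(\<lambda>e. e p) \<in> borel_measurable noise_space" using noise_measurable by (cases p) auto
    from measurable_compose[OF measurable_snd this]
    have [measurable]: "(\<lambda>r. snd r p) \<in> borel_measurable (Dx \<Otimes>\<^sub>M noise_space)" .
    show "Measurable.pred (Dx \<Otimes>\<^sub>M noise_space) (\<lambda>r. snd r p = 0)" by measurable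
  qed simp
  ultimately have "AE r in Dx \<Otimes>\<^sub>M noise_space. \<forall>p\<in>{..<N} \<times> {..<K}. snd r p = 0"
    by (intro AE_pair_measure) (simp_all add: pred_def)
  then show "AE r in one_round. \<forall>p\<in>{..<N} \<times> {..<K}. snd r p = 0"
    unfolding round_space_def .
qed

text \<open>For \<open>R = 0\<close> the mixture says nothing, as \<open>1 / R\<close> is 0 by
  convention; confidence then holds almost surely and contributes no bad event.\<close>

definition bad :: "real \<Rightarrow> 'd outcome set" where
  "bad D = {w \<in> space \<Omega>. 3 * logT / D\<^sup>2 < near_count D w}
     \<union> (if R > 0 then (\<Union>i<N. (failure i)) else {})"

lemma prob_bad:
  assumes D: "0 < D" "D \<le> 1"
    and p: "prob_near D \<le> logT / (real T * D\<^sup>2)"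
  shows "bad D \<in> sets \<Omega>" "measure \<Omega> (bad D) \<le> (real N * (1 + max_batches) + 1) / real T"
proof -
  interpret P: prob_space \<Omega> by (rule prob_\<Omega>)
  let ?A = "{w \<in> space \<Omega>. 3 * logT / D\<^sup>2 < near_count D w}"
  let ?F = "if R > 0 then (\<Union>i<N. (failure i)) else {}"
  have A: "?A \<in> sets \<Omega>" using near_count_measurable[of D] by measurable
  have Fi: "(failure i) \<in> sets \<Omega>" for i using fail_measurable[of T i] by (simp add: pred_def)
  then have F: "?F \<in> sets \<Omega>" by auto
  show "bad D \<in> sets \<Omega>" unfolding bad_def using A F by (rule sets.Un)
  have "measure \<Omega> ?F \<le> real N * ((1 + max_batches) / real T)"
  proof (cases "R > 0")
    case True
    have "measure \<Omega> (\<Union>i<N. (failure i)) \<le> (\<Sum>i<N. measure \<Omega> (failure i))"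
      using Fi by (intro P.finite_measure_subadditive_finite) auto
    also have "\<dots> \<le> (\<Sum>i<N. (1 + max_batches) / real T)"
      by (intro sum_mono prob_fail True) simp
    finally show ?thesis using True by simp
  next
    case False
    then show ?thesis using max_batches_nonneg by simp
  qed
  moreover have "measure \<Omega> (bad D) \<le> measure \<Omega> ?A + measure \<Omega> ?F"
    unfolding bad_def by (rule measure_Un_le[OF A F])
  ultimately show "measure \<Omega> (bad D) \<le> (real N * (1 + max_batches) + 1) / real T"
    using prob_near_count[OF assms]
    unfolding add_divide_distrib[of "real N * (1 + max_batches)" 1] times_divide_eq_right by linarith
qed

lemma regret_bound:
  assumes D: "0 < D" "D \<le> 1"
    and p: "prob_near D \<le> logT / (real T * D\<^sup>2)" and i: "i < N"
  shows "regret i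
    \<le> 2 * budget / (min_Delta D)\<^sup>2 + (real N * (1 + max_batches) + 1)"
proof -
  interpret P: prob_space \<Omega> by (rule prob_\<Omega>)
  note B = prob_bad[OF D p]
  define b where "b = 2 * budget / (min_Delta D)\<^sup>2"
  have b0: "b \<ge> 0" unfolding b_def using budget_nonneg by simp
  \<comment> \<open>On a bad path the trivial bound \<open>T\<close> is charged; the probability of
    \<open>bad D\<close> carries a factor \<open>1 / T\<close>, so only its numerator
    remains.\<close>
  let ?H = "\<lambda>w. b + real T * indicator (bad D) w"
  have int: "integrable \<Omega> ?H" using B(1) by (simp add: P.emeasure_eq_measure)
  have eq: "(\<integral>w. ?H w \<partial>\<Omega>) = b + real T * measure \<Omega> (bad D)"
    using B(1) by (simp add: P.prob_space P.emeasure_eq_measure)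
  have ctx: "AE w in \<Omega>. ctx_bounded w"
    unfolding ctx_bounded_def bounded_ctx_def by (rule AE_ctx_\<Omega>[OF Dx_bounded])
  have nz: "AE w in \<Omega>. R = 0 \<longrightarrow> (\<forall>t\<in>{1..T}. \<forall>p\<in>{..<N} \<times> {..<K}. snd (w t) p = 0)"
    using noise_zero_AE by (cases "R = 0") auto
  have le: "AE w in \<Omega>. total_gap i w \<le> ?H w"
    using ctx nz AE_space
  proof eventually_elim
    case (elim w)
    show ?case
    proof (cases "w \<in> bad D")
      case True
      then show ?thesis using regret_any_path[OF elim(1) i] b0 by simp
    next
      case False
      have conf: "confident (state w n)" if "n < T" for n
      proof (cases "R > 0")
        case True
        then show ?thesis
          using False elim(3) by (intro not_fail_imp_confident[OF _ elim(1) _ that]) (auto simp: bad_def)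
      next
        case F: False
        then have "R = 0" using R by simp
        then show ?thesis using elim(2) that by (intro noise_free_confident) auto
      qed
      have "near_count D w \<le> 3 * logT / D\<^sup>2"
        using False elim(3) by (auto simp: bad_def not_less)
      then have "total_gap i w \<le> b"
        unfolding b_def near_count_def by (intro regret_good_path elim(1) conf D(1) i)
      then show ?thesis using False by simp
    qed
  qed
  have "regret i \<le> (\<integral>w. ?H w \<partial>\<Omega>)"
    by (rule regret_le[OF i int _ le]) (unfold eq, use b0 in simp)
  also have "\<dots> \<le> b + (real N * (1 + max_batches) + 1)"
  proof -
    have "real T * measure \<Omega> (bad D) \<le> real T * ((real N * (1 + max_batches) + 1) / real T)"
      by (rule mult_left_mono[OF B(2)]) simp
    then show ?thesis unfolding eq using T2 by simp
  qed
  finally show ?thesis unfolding b_def .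
qed

end

section \<open>Constants and the final bound\<close>

text \<open>In this and the following constants the divisions by \<open>ln 2\<close> come from
  \<open>T \<ge> 2\<close>: a constant \<open>c \<ge> 0\<close> is at most
  \<open>c / ln 2 * ln T\<close>.\<close>

definition log_const :: "real \<Rightarrow> real \<Rightarrow> real" where
  "log_const Bx lam = 1 + ln (1 + Bx\<^sup>2 / lam) / ln 2"

definition eta_const :: "nat \<Rightarrow> real \<Rightarrow> real \<Rightarrow> real \<Rightarrow> real \<Rightarrow> real" where
  "eta_const d R Bx B\<theta> lam = 2 * R\<^sup>2 * (real d * (log_const Bx lam + 2)) + 2 * lam * B\<theta>\<^sup>2 / ln 2"

definition budget_const :: "nat \<Rightarrow> nat \<Rightarrow> real \<Rightarrow> real \<Rightarrow> real \<Rightarrow> real \<Rightarrow> real \<Rightarrow> real" where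
  "budget_const N d R Bx B\<theta> lam \<Delta>1 = 3 / (16 * ln 2) + \<Delta>1\<^sup>2 / (ln 2)\<^sup>2
     + (\<Delta>1\<^sup>2 / ln 2 + eta_const d R Bx B\<theta> lam) * (real N * (real d * log_const Bx lam))"

definition batch_const :: "real \<Rightarrow> real" where
  "batch_const \<Delta>1 = (1 + ln (1 + 32 * \<Delta>1\<^sup>2 / (3 * ln 2)) / ln 2) / ln 2"

text \<open>The 8 is twice the 4 of \<open>min_Delta\<close>, since the argument runs at some
  \<open>D\<close> above half the minimum preference gap. The second summand pays for the bad
  event.\<close>

definition regret_const :: "nat \<Rightarrow> nat \<Rightarrow> real \<Rightarrow> real \<Rightarrow> real \<Rightarrow> real \<Rightarrow> real \<Rightarrow> real" where
  "regret_const N d R Bx B\<theta> lam \<Delta>1 = 2 * budget_const N d R Bx B\<theta> lam \<Delta>1 / (min \<Delta>1 (1 / (8 * sqrt 2)))\<^sup>2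
     + (real N * (1 / (ln 2)\<^sup>2 + batch_const \<Delta>1 / ln 2) + 1 / (ln 2)\<^sup>2)"

lemma log_const_ge_1: "lam > 0 \<Longrightarrow> log_const Bx lam \<ge> 1"
  by (simp add: log_const_def)

lemma const_nonneg:
  assumes "lam > 0"
  shows "eta_const d R Bx B\<theta> lam \<ge> 0" "budget_const N d R Bx B\<theta> lam \<Delta>1 \<ge> 0" "batch_const \<Delta>1 \<ge> 0"
    "regret_const N d R Bx B\<theta> lam \<Delta>1 \<ge> 0"
proof -
  note lc = log_const_ge_1[OF assms, of Bx]
  show e: "eta_const d R Bx B\<theta> lam \<ge> 0" using lc assms unfolding eta_const_def by simp
  show b: "budget_const N d R Bx B\<theta> lam \<Delta>1 \<ge> 0" using lc e unfolding budget_const_def by simp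
  show m: "batch_const \<Delta>1 \<ge> 0" unfolding batch_const_def by simp
  show "regret_const N d R Bx B\<theta> lam \<Delta>1 \<ge> 0"
    unfolding regret_const_def using b m by (intro add_nonneg_nonneg mult_nonneg_nonneg divide_nonneg_nonneg) auto
qed

text \<open>For \<open>B\<theta> = 0\<close>: all utilities of the player vanish, so no matching
  costs it anything, whatever \<open>eta\<close> is.\<close>

lemma (in barb) gap_nonpos_zero:
  assumes "\<theta> i = 0" "i < N" shows "gap s c i \<le> 0"
proof -
  have "opt_stable_util N K rk (util c) i \<le> 0"
    by (rule opt_stable_util_le[OF N_le_K rk_inj assms(2)]) (simp_all add: util_def assms)
  moreover have "match_util (util c) (play s c) i = 0"
    by (simp add: match_util_def util_def assms split: option.split)
  ultimately show ?thesis by (simp add: gap_def)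
qed

text \<open>With a single arm the set under the supremum in \<open>min_pref_gap\<close> contains all
  positive reals, so its \<open>Sup\<close> carries no information. But then there is one player,
  and every round matches it to that arm.\<close>

lemma (in barb) gap_nonpos_single:
  assumes K: "K = 1" and i: "i < N" shows "gap s c i \<le> 0"
proof -
  have i0: "i = 0" and N: "N = 1" using K i N_le_K by auto
  obtain j where j: "play s c i = Some j"
  proof (cases "expl s c = {}")
    case True
    interpret gs_market N K rk "plist (est_util s c)" by (rule gs_market_plist)
    obtain m where "gale_shapley N K rk (plist (est_util s c)) i = Some (plist (est_util s c) i ! m)"
      using gale_shapley_last_proposal[OF i] .
    then show ?thesis using that True by (simp add: play_def)
  next
    case False
    then obtain i' j where ij: "mm (expl s c) i' = Some j" using mm_nonempty by blast
    have "i' < N" using mm_Some[OF ij] by (simp add: expl_def)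
    then have "i' = i" using i0 N by simp
    then show ?thesis using that ij False by (simp add: play_def)
  qed
  then have "match_util (util c) (play s c) i = util c i 0"
    using play_lessK[OF j] K by (simp add: match_util_def)
  moreover have "opt_stable_util N K rk (util c) i \<le> util c i 0"
    by (rule opt_stable_util_le[OF N_le_K rk_inj i]) (use K in simp_all)
  ultimately show ?thesis by (simp add: gap_def)
qed

lemma (in barb_env) regret_nonpos:
  assumes "i < N" "\<And>s c. gap s c i \<le> 0"
  shows "regret i \<le> 0"
proof -
  have "regret i \<le> (\<integral>w. 0 \<partial>\<Omega>)"
    using assms by (intro regret_le) (auto intro!: sum_nonpos AE_I2)
  then show ?thesis by simp
qed

context barb_prob
begin

lemma ln2_le_lnT: "ln 2 \<le> logT"
  using T2 by simp

lemma ln_growth: "ln growth \<le> log_const Bx lam * logT"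
proof -
  have p: "1 + Bx\<^sup>2 / lam \<ge> 1" "1 + Bx\<^sup>2 / lam > 0" using lam by (simp_all add: add_pos_nonneg)
  have "growth \<le> real T * (1 + Bx\<^sup>2 / lam)" using T2 by (simp add: distrib_left)
  moreover have "growth > 0" using lam by (simp add: add_pos_nonneg)
  ultimately have "ln growth \<le> ln (real T * (1 + Bx\<^sup>2 / lam))" by (intro ln_mono)
  also have "\<dots> = logT + ln (1 + Bx\<^sup>2 / lam)" using T2 p(2) by (simp add: ln_mult)
  also have "ln (1 + Bx\<^sup>2 / lam) \<le> ln (1 + Bx\<^sup>2 / lam) / ln 2 * logT"
  proof -
    have "ln (1 + Bx\<^sup>2 / lam) / ln 2 * ln 2 \<le> ln (1 + Bx\<^sup>2 / lam) / ln 2 * logT"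
      using p(1) ln2_le_lnT by (intro mult_left_mono) auto
    then show ?thesis by simp
  qed
  finally show ?thesis by (simp add: log_const_def distrib_right)
qed

lemma one_le_lnT: "1 \<le> logT / ln 2" "1 \<le> (logT)\<^sup>2 / (ln 2)\<^sup>2"
    "logT \<le> (logT)\<^sup>2 / ln 2"
proof -
  show 1: "1 \<le> logT / ln 2" using ln2_le_lnT by (simp add: le_divide_eq)
  then have "1\<^sup>2 \<le> (logT / ln 2)\<^sup>2" by (intro power_mono) auto
  then show "1 \<le> (logT)\<^sup>2 / (ln 2)\<^sup>2" by (simp add: power_divide)
  have "logT * 1 \<le> logT * (logT / ln 2)"
    using 1 lnT by (intro mult_left_mono) auto
  then show "logT \<le> (logT)\<^sup>2 / ln 2" by (simp add: power2_eq_square)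
qed

lemma eta_square_le: "eta\<^sup>2 \<le> eta_const CARD('d) R Bx B\<theta> lam * logT"
proof -
  let ?a = "R * radius" and ?b = "sqrt lam * B\<theta>"
  have p: "growth > 0" using lam by (simp add: add_pos_nonneg)
  have l: "ln (growth * (real T)\<^sup>2) = ln growth + 2 * logT"
    using p T2 by (simp add: ln_mult ln_realpow)
  have l0: "ln growth \<ge> 0" using lam by simp
  have r2: "radius\<^sup>2 = real CARD('d) * (ln growth + 2 * logT)"
    unfolding radius_def l using l0 lnT by (intro real_sqrt_pow2 mult_nonneg_nonneg) auto
  have "real CARD('d) * (ln growth + 2 * logT)
      \<le> real CARD('d) * ((log_const Bx lam + 2) * logT)"
    using ln_growth by (intro mult_left_mono) (auto simp: distrib_right)
  then have r3: "R\<^sup>2 * radius\<^sup>2 \<le> R\<^sup>2 * (real CARD('d) * ((log_const Bx lam + 2) * logT))"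
    unfolding r2 by (intro mult_left_mono) auto
  \<comment> \<open>This yields the bound of the square of a sum by twice the sum of the squares,
    which separates the noise part of \<open>eta\<close> from the bias part.\<close>
  have "0 \<le> (?a - ?b)\<^sup>2" by simp
  then have "eta\<^sup>2 \<le> 2 * ?a\<^sup>2 + 2 * ?b\<^sup>2"
    unfolding eta_eq radius_def[symmetric] power2_sum power2_diff by linarith
  also have "\<dots> = 2 * (R\<^sup>2 * radius\<^sup>2) + 2 * (lam * B\<theta>\<^sup>2) * 1"
    using lam by (simp add: power_mult_distrib)
  also have "\<dots> \<le> 2 * (R\<^sup>2 * (real CARD('d) * ((log_const Bx lam + 2) * logT)))
      + 2 * (lam * B\<theta>\<^sup>2) * (logT / ln 2)"
    using lam by (intro add_mono mult_left_mono[OF r3] mult_left_mono[OF one_le_lnT(1)]) auto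
  also have "\<dots> = eta_const CARD('d) R Bx B\<theta> lam * logT"
    by (simp add: eta_const_def algebra_simps)
  finally show ?thesis .
qed

lemma budget_le: "budget \<le> budget_const N CARD('d) R Bx B\<theta> lam \<Delta>1 * (logT)\<^sup>2"
proof -
  let ?E = "eta_const CARD('d) R Bx B\<theta> lam" and ?L = "real N * (real CARD('d) * log_const Bx lam)"
  let ?l = "logT"
  have E0: "?E \<ge> 0" by (rule const_nonneg(1)[OF lam])
  have ld: "log_dim \<le> ?L * ?l"
  proof -
    have "log_dim \<le> real N * (real CARD('d) * (log_const Bx lam * ?l))"
      unfolding log_dim_def by (intro mult_left_mono ln_growth) auto
    then show ?thesis by (simp add: mult.assoc)
  qed
  have "\<Delta>1\<^sup>2 + eta\<^sup>2 \<le> \<Delta>1\<^sup>2 * (?l / ln 2) + ?E * ?l"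
    using mult_left_mono[OF one_le_lnT(1), of "\<Delta>1\<^sup>2"] eta_square_le by simp
  also have "\<dots> = (\<Delta>1\<^sup>2 / ln 2 + ?E) * ?l" by (simp add: distrib_right)
  finally have "(\<Delta>1\<^sup>2 + eta\<^sup>2) * log_dim \<le> ((\<Delta>1\<^sup>2 / ln 2 + ?E) * ?l) * (?L * ?l)"
    using ld log_dim_nonneg E0 lnT by (intro mult_mono) auto
  then have 1: "(\<Delta>1\<^sup>2 + eta\<^sup>2) * log_dim \<le> (\<Delta>1\<^sup>2 / ln 2 + ?E) * ?L * ?l\<^sup>2"
    by (simp add: power2_eq_square mult_ac)
  have 2: "3 * ?l / 16 \<le> 3 / (16 * ln 2) * ?l\<^sup>2" using one_le_lnT(3) by simp
  have 3: "\<Delta>1\<^sup>2 \<le> \<Delta>1\<^sup>2 / (ln 2)\<^sup>2 * ?l\<^sup>2"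
    using mult_left_mono[OF one_le_lnT(2), of "\<Delta>1\<^sup>2"] by simp
  show ?thesis unfolding budget_def budget_const_def distrib_right[of _ _ "?l\<^sup>2"] using 1 2 3 by linarith
qed

lemma max_batches_le: "max_batches \<le> batch_const \<Delta>1 * logT"
proof -
  define c where "c = 1 + 32 * \<Delta>1\<^sup>2 / (3 * ln 2)"
  have c1: "c \<ge> 1" by (simp add: c_def)
  define m where "m = 3 * logT / (32 * real T)"
  have m0: "m > 0" using lnT T2 by (simp add: m_def)
  have "\<Delta>1\<^sup>2 / min (\<Delta>1\<^sup>2) m \<le> real T * c"
  proof (cases "\<Delta>1\<^sup>2 \<le> m")
    case True
    then show ?thesis using \<Delta>1 T2 c1 mult_mono[of 1 "real T" 1 c] by (simp add: min_def)
  next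
    case False
    have "\<Delta>1\<^sup>2 / m = 32 * \<Delta>1\<^sup>2 / (3 * logT) * real T" using T2 by (simp add: m_def)
    also have "\<dots> \<le> 32 * \<Delta>1\<^sup>2 / (3 * ln 2) * real T"
      using ln2_le_lnT lnT by (intro mult_right_mono divide_left_mono mult_pos_pos) auto
    also have "\<dots> \<le> c * real T" unfolding c_def by (intro mult_right_mono) auto
    finally show ?thesis using False by (simp add: min_def mult.commute)
  qed
  moreover have "0 < \<Delta>1\<^sup>2 / min (\<Delta>1\<^sup>2) m" using \<Delta>1 m0 by simp
  ultimately have "max_batches \<le> log 2 (real T * c)"
    unfolding max_batches_def m_def[symmetric] by (intro log_mono) auto
  also have "\<dots> = (logT + ln c) / ln 2" using T2 c1 by (simp add: log_def ln_mult)
  also have "\<dots> \<le> (logT + ln c / ln 2 * logT) / ln 2"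
  proof (intro divide_right_mono add_left_mono)
    have "ln c / ln 2 * ln 2 \<le> ln c / ln 2 * logT"
      using c1 ln2_le_lnT by (intro mult_left_mono) auto
    then show "ln c \<le> ln c / ln 2 * logT" by simp
  qed simp
  also have "\<dots> = batch_const \<Delta>1 * logT"
    by (simp add: batch_const_def c_def[symmetric] distrib_right)
  finally show ?thesis .
qed

text \<open>The set under the supremum is nonempty and bounded by 1, so the supremum is genuine and
  positive, and some member exceeds half of it.\<close>

lemma min_pref_gap_approx:
  assumes K: "2 \<le> K" and i: "i < N"
  obtains D where "0 < min_pref_gap N K \<theta> Dx T" "min_pref_gap N K \<theta> Dx T \<le> 1"
    "min_pref_gap N K \<theta> Dx T / 2 < D" "D \<le> 1"
    "prob_near D \<le> logT / (real T * D\<^sup>2)"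
proof -
  interpret D: prob_space Dx by (rule prob_Dx)
  define S where "S = {\<Delta>. \<Delta> > 0 \<and>
            measure Dx {c \<in> space Dx. \<forall>i<N. \<forall>j<K. \<forall>j'<K. j \<noteq> j' \<longrightarrow> \<bar>\<theta> i \<bullet> (c j - c j')\<bar> \<ge> \<Delta>}
              \<ge> 1 - logT / (real T * \<Delta>\<^sup>2)}"
  have gap: "min_pref_gap N K \<theta> Dx T = Sup S" by (simp add: min_pref_gap_def S_def)
  have far: "{c \<in> space Dx. \<forall>i<N. \<forall>j<K. \<forall>j'<K. j \<noteq> j' \<longrightarrow> \<bar>\<theta> i \<bullet> (c j - c j')\<bar> \<ge> \<Delta>}
      = space Dx - {c \<in> space Dx. near \<Delta> c}" for \<Delta>
    by (rule set_eqI) (simp add: near_def not_less[symmetric], blast)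
  have ns: "{c \<in> space Dx. near \<Delta> c} \<in> sets Dx" for \<Delta>
    using near_measurable[of \<Delta>] by (simp add: pred_def)
  have S: "\<Delta> \<in> S \<longleftrightarrow> \<Delta> > 0 \<and> prob_near \<Delta> \<le> logT / (real T * \<Delta>\<^sup>2)" for \<Delta>
    unfolding S_def mem_Collect_eq far D.prob_compl[OF ns] by linarith
  \<comment> \<open>At this value the tolerated probability is exactly 1, so membership is
    automatic.\<close>
  define \<Delta>0 where "\<Delta>0 = sqrt (logT / real T)"
  have \<Delta>0: "\<Delta>0 > 0" "\<Delta>0\<^sup>2 = logT / real T" using lnT T2 by (simp_all add: \<Delta>0_def)
  have eq1: "logT / (real T * \<Delta>0\<^sup>2) = 1" unfolding \<Delta>0(2) using lnT T2 by simp
  have mem: "\<Delta>0 \<in> S" unfolding S eq1 using \<Delta>0(1) D.prob_le_1 by blast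
  \<comment> \<open>Utilities of two arms differ by at most \<open>2 B\<theta> Bx \<le> 1\<close>,
    so a gap above 1 is almost surely missed, whereas the tolerated probability is then below
    1.\<close>
  have le1: "\<Delta> \<le> 1" if "\<Delta> \<in> S" for \<Delta>
  proof (rule ccontr)
    assume "\<not> \<Delta> \<le> 1"
    then have \<Delta>: "\<Delta> > 1" by simp
    have "AE c in Dx. near \<Delta> c"
      using Dx_bounded
    proof eventually_elim
      case (elim c)
      have "\<bar>\<theta> i \<bullet> (c 0 - c 1)\<bar> \<le> norm (\<theta> i) * norm (c 0 - c 1)" by (rule Cauchy_Schwarz_ineq2)
      also have "\<dots> \<le> B\<theta> * (2 * Bx)"
      proof (intro mult_mono \<theta>_le i B\<theta>)
        have "norm (c 0 - c 1) \<le> norm (c 0) + norm (c 1)" by (rule norm_triangle_ineq4)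
        moreover have "norm (c 0) \<le> Bx" "norm (c 1) \<le> Bx" using elim K by auto
        ultimately show "norm (c 0 - c 1) \<le> 2 * Bx" by linarith
      qed simp
      also have "B\<theta> * (2 * Bx) = 2 * B\<theta> * Bx" by simp
      also have "\<dots> < \<Delta>" using BB \<Delta> by linarith
      finally have "\<bar>\<theta> i \<bullet> (c 0 - c 1)\<bar> < \<Delta>" .
      moreover have "0 < K" "1 < K" using K by auto
      ultimately show ?case unfolding near_def
        by (intro exI[of _ i] exI[of _ 0] exI[of _ 1] conjI i) simp_all
    qed
    then have "prob_near \<Delta> = 1" by (rule D.prob_Collect_eq_1[THEN iffD2, OF ns])
    moreover have "prob_near \<Delta> \<le> logT / (real T * \<Delta>\<^sup>2)"
      using that unfolding S by (rule conjunct2)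
    ultimately have "1 \<le> logT / (real T * \<Delta>\<^sup>2)" by linarith
    moreover have "0 < real T * \<Delta>\<^sup>2" using T2 \<Delta> by (intro mult_pos_pos zero_less_power) auto
    ultimately have "real T * \<Delta>\<^sup>2 \<le> logT" by (simp only: pos_le_divide_eq mult_1)
    also have "\<dots> < real T" using T2 by (intro ln_less_self) simp
    finally have "\<Delta>\<^sup>2 < 1" using T2 by simp
    then show False using one_less_power[OF \<Delta>, of 2] by simp
  qed
  have bdd: "bdd_above S" using le1 by (intro bdd_aboveI)
  have "\<Delta>0 \<le> Sup S" by (rule cSup_upper[OF mem bdd])
  then have pos: "0 < Sup S" using \<Delta>0(1) by linarith
  have sup1: "Sup S \<le> 1" using mem le1 by (intro cSup_least) auto
  have "Sup S / 2 < Sup S" using pos by simp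
  moreover have "S \<noteq> {}" using mem by blast
  ultimately obtain D where D: "D \<in> S" "Sup S / 2 < D" using less_cSupE[of "Sup S / 2" S] by blast
  have "prob_near D \<le> logT / (real T * D\<^sup>2)"
    using D(1) unfolding S by (rule conjunct2)
  with pos sup1 D(2) le1[OF D(1)] show thesis unfolding gap[symmetric] by (rule that)
qed

lemma regret_order:
  assumes K: "2 \<le> K" and i: "i < N"
  shows "regret i
    \<le> regret_const N CARD('d) R Bx B\<theta> lam \<Delta>1 * (logT)\<^sup>2 / (min_pref_gap N K \<theta> Dx T)\<^sup>2"
proof -
  define g where "g = min_pref_gap N K \<theta> Dx T"
  obtain D where g: "0 < g" "g \<le> 1" and D: "g / 2 < D" "D \<le> 1"
    "prob_near D \<le> logT / (real T * D\<^sup>2)"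
    unfolding g_def using min_pref_gap_approx[OF assms] .
  let ?l = "(logT)\<^sup>2" and ?B = "budget_const N CARD('d) R Bx B\<theta> lam \<Delta>1"
  define \<rho> where "\<rho> = min \<Delta>1 (1 / (8 * sqrt 2))"
  define G where "G = real N * (1 / (ln 2)\<^sup>2 + batch_const \<Delta>1 / ln 2) + 1 / (ln 2)\<^sup>2"
  have \<rho>: "\<rho> > 0" using \<Delta>1 by (simp add: \<rho>_def)
  have D0: "0 < D" using g D by linarith
  have g2: "0 < g\<^sup>2" "g\<^sup>2 \<le> 1" using g by (auto simp: power_le_one)
  have "\<rho> * g \<le> min_Delta D"
  proof (rule min.boundedI)
    have "\<rho> * g \<le> \<Delta>1 * 1" using g \<Delta>1 by (intro mult_mono) (auto simp: \<rho>_def)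
    then show "\<rho> * g \<le> \<Delta>1" by simp
    have "\<rho> * g \<le> 1 / (8 * sqrt 2) * g" using g by (intro mult_right_mono) (auto simp: \<rho>_def)
    also have "\<dots> = (g / 2) / (4 * sqrt 2)" by simp
    also have "\<dots> \<le> D / (4 * sqrt 2)" using D by (intro divide_right_mono) auto
    finally show "\<rho> * g \<le> D / (4 * sqrt 2)" .
  qed
  moreover have rg: "0 < \<rho> * g" using \<rho> g by simp
  ultimately have sq: "(\<rho> * g)\<^sup>2 \<le> (min_Delta D)\<^sup>2"
    by (intro power_mono) auto
  have pos: "0 < min_Delta D" using \<Delta>1 D0 by simp
  have "2 * budget / (min_Delta D)\<^sup>2 \<le> 2 * budget / (\<rho> * g)\<^sup>2"
    using sq budget_nonneg by (intro divide_left_mono mult_pos_pos zero_less_power rg pos) auto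
  also have "\<dots> \<le> 2 * (?B * ?l) / (\<rho> * g)\<^sup>2"
    using budget_le by (intro divide_right_mono) auto
  also have "\<dots> = 2 * ?B / \<rho>\<^sup>2 * ?l / g\<^sup>2" by (simp add: power_mult_distrib)
  finally have 1: "2 * budget / (min_Delta D)\<^sup>2 \<le> 2 * ?B / \<rho>\<^sup>2 * ?l / g\<^sup>2" .
  have "batch_const \<Delta>1 * logT \<le> batch_const \<Delta>1 * (?l / ln 2)"
    using one_le_lnT(3) const_nonneg(3)[OF lam] by (intro mult_left_mono)
  then have "1 + max_batches \<le> ?l / (ln 2)\<^sup>2 + batch_const \<Delta>1 * (?l / ln 2)"
    using max_batches_le one_le_lnT(2) by linarith
  also have "\<dots> = (1 / (ln 2)\<^sup>2 + batch_const \<Delta>1 / ln 2) * ?l" by (simp add: distrib_right)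
  finally have "real N * (1 + max_batches) \<le> real N * ((1 / (ln 2)\<^sup>2 + batch_const \<Delta>1 / ln 2) * ?l)"
    by (intro mult_left_mono) auto
  moreover have "G * ?l = real N * ((1 / (ln 2)\<^sup>2 + batch_const \<Delta>1 / ln 2) * ?l) + ?l / (ln 2)\<^sup>2"
    by (simp add: G_def algebra_simps)
  ultimately have "real N * (1 + max_batches) + 1 \<le> G * ?l"
    using one_le_lnT(2) by linarith
  also have "\<dots> \<le> G * ?l / g\<^sup>2"
  proof -
    have "0 \<le> G * ?l" using const_nonneg(3)[OF lam, of \<Delta>1]
      unfolding G_def by (intro mult_nonneg_nonneg add_nonneg_nonneg divide_nonneg_nonneg) auto
    then show ?thesis using g2 by (simp add: le_divide_eq mult_left_le)
  qed
  finally have 2: "real N * (1 + max_batches) + 1 \<le> G * ?l / g\<^sup>2" .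
  have "regret i \<le> 2 * ?B / \<rho>\<^sup>2 * ?l / g\<^sup>2 + G * ?l / g\<^sup>2"
    using regret_bound[OF D0 D(2,3) i] 1 2 by linarith
  also have "\<dots> = (2 * ?B / \<rho>\<^sup>2 + G) * ?l / g\<^sup>2" by (simp add: distrib_right add_divide_distrib)
  finally show ?thesis by (simp add: regret_const_def \<rho>_def G_def g_def)
qed

end

theorem theorem3p1:
  "\<forall>(N::nat) (R::real) (Bx::real) (B\<theta>::real) (lam::real) (\<Delta>1::real).
     R \<ge> 0 \<and> Bx \<ge> 0 \<and> B\<theta> \<ge> 0 \<and> 2 * B\<theta> * Bx \<le> 1 \<and> lam > 0 \<and> \<Delta>1 > 0 \<longrightarrow>
     (\<exists>C::real. \<forall>(K::nat) (\<theta>::nat \<Rightarrow> real^'d) (rk::nat \<Rightarrow> nat \<Rightarrow> nat)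
          (Dx::(nat \<Rightarrow> real^'d) measure) (De::real measure) mm plist (T::nat) (i::nat).
        N \<le> K \<and> (\<forall>i'<N. norm (\<theta> i') \<le> B\<theta>) \<and> (\<forall>j<K. inj_on (rk j) {..<N}) \<and>
        prob_space Dx \<and> sets Dx = sets (\<Pi>\<^sub>M j\<in>{..<K}. (borel :: (real^'d) measure)) \<and>
        (AE c in Dx. \<forall>j<K. norm (c j) \<le> Bx) \<and>
        prob_space De \<and> sets De = sets (borel :: real measure) \<and>
        integrable De (\<lambda>x. x) \<and> (\<integral>x. x \<partial>De) = 0 \<and> subgaussian R De \<and>
        mm_oracle N K mm \<and> pref_lists_ok N K plist \<and> 2 \<le> T \<and> i < N \<longrightarrow>
        (let \<delta> = 1 / (real T)\<^sup>2;
             eta = R * sqrt (real CARD('d) * ln ((1 + real T * Bx\<^sup>2 / lam) / \<delta>)) + sqrt lam * B\<theta>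
         in barb_regret N K rk \<theta> mm plist T eta lam \<Delta>1 Dx De i
              \<le> C * (ln (real T))\<^sup>2 / (min_pref_gap N K \<theta> Dx T)\<^sup>2))"
  (is "\<forall>N R Bx B\<theta> lam \<Delta>1. _ \<longrightarrow> (\<exists>C. ?bound C N R Bx B\<theta> lam \<Delta>1)")
proof (intro allI impI, elim conjE)
  fix N :: nat and R Bx B\<theta> lam \<Delta>1 :: real
  assume par: "R \<ge> 0" "Bx \<ge> 0" "B\<theta> \<ge> 0" "2 * B\<theta> * Bx \<le> 1" "lam > 0" "\<Delta>1 > 0"
  show "\<exists>C. ?bound C N R Bx B\<theta> lam \<Delta>1"
  \<comment> \<open>The witness is fixed before \<open>K\<close>, the distributions and
    \<open>T\<close>, hence is uniform in all of them.\<close>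
  proof (rule exI[of _ "regret_const N CARD('d) R Bx B\<theta> lam \<Delta>1"], intro allI impI, elim conjE)
    fix K :: nat and \<theta> :: "nat \<Rightarrow> real^'d" and rk :: "nat \<Rightarrow> nat \<Rightarrow> nat"
      and Dx :: "(nat \<Rightarrow> real^'d) measure" and De :: "real measure" and mm plist
      and T i :: nat
    assume h: "N \<le> K" "\<forall>i'<N. norm (\<theta> i') \<le> B\<theta>" "\<forall>j<K. inj_on (rk j) {..<N}"
      "prob_space Dx" "sets Dx = sets (\<Pi>\<^sub>M j\<in>{..<K}. (borel :: (real^'d) measure))"
      "AE c in Dx. \<forall>j<K. norm (c j) \<le> Bx" "prob_space De" "sets De = sets (borel :: real measure)"
      "integrable De (\<lambda>x. x)" "(\<integral>x. x \<partial>De) = 0" "subgaussian R De"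
      "mm_oracle N K mm" "pref_lists_ok N K plist" "2 \<le> T" "i < N"
    define eta where
      "eta = R * sqrt (real CARD('d) * ln ((1 + real T * Bx\<^sup>2 / lam) * (real T)\<^sup>2)) + sqrt lam * B\<theta>"
    let ?C = "regret_const N CARD('d) R Bx B\<theta> lam \<Delta>1"
    interpret barb_env N K rk \<theta> mm plist T eta lam \<Delta>1 Dx De
    proof (intro barb_env.intro barb.intro barb_env_axioms.intro)
      show "inj_on (rk j) {..<N}" if "j < K" for j using h(3) that by simp
    qed (rule h par)+
    have rhs: "0 \<le> ?C * (ln (real T))\<^sup>2 / (min_pref_gap N K \<theta> Dx T)\<^sup>2"
      using const_nonneg(4)[OF par(5)] by simp
    have "1 \<le> (1 + real T * Bx\<^sup>2 / lam) * (real T)\<^sup>2"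
      using par(5) h(14) mult_mono[of 1 "1 + real T * Bx\<^sup>2 / lam" 1 "(real T)\<^sup>2"] by simp
    then have "0 \<le> R * sqrt (real CARD('d) * ln ((1 + real T * Bx\<^sup>2 / lam) * (real T)\<^sup>2))"
      using par(1) by simp
    moreover have "0 < sqrt lam * B\<theta>" if "B\<theta> \<noteq> 0" using that par by simp
    ultimately have eta: "eta > 0" if "B\<theta> \<noteq> 0" using that unfolding eta_def by linarith
    have "regret i
        \<le> ?C * (ln (real T))\<^sup>2 / (min_pref_gap N K \<theta> Dx T)\<^sup>2"
    \<comment> \<open>In both exceptional cases every single gap is nonpositive, so the regret is at
      most 0 and the nonnegative right-hand side suffices. Outside them \<open>eta > 0\<close> and
      \<open>2 \<le> K\<close>.\<close>
    proof (cases "B\<theta> = 0 \<or> K = 1")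
      case True
      have "gap s c i \<le> 0" for s c
      proof (cases "K = 1")
        case True
        then show ?thesis by (rule gap_nonpos_single[OF _ h(15)])
      next
        case False
        with \<open>B\<theta> = 0 \<or> K = 1\<close> h(2,15) have "\<theta> i = 0" by auto
        then show ?thesis by (rule gap_nonpos_zero[OF _ h(15)])
      qed
      then have "regret i \<le> 0"
        by (rule regret_nonpos[OF h(15)])
      then show ?thesis using rhs by linarith
    next
      case False
      interpret barb_prob N K rk \<theta> mm plist T eta lam \<Delta>1 R Bx B\<theta> Dx De
      proof (intro barb_prob.intro barb_bounded.intro barb_bounded_axioms.intro barb_prob_axioms.intro)
        show "barb N K rk mm plist T lam \<Delta>1" by unfold_locales
        show "barb_env N K rk mm plist T lam \<Delta>1 Dx De" by unfold_locales
        show "norm (\<theta> i') \<le> B\<theta>" if "i' < N" for i' using h(2) that by simp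
        show "eta > 0" using eta False by simp
      qed (rule h par eta_def)+
      show ?thesis by (rule regret_order) (use False h(1,15) in auto)
    qed
    moreover have "(1 + real T * Bx\<^sup>2 / lam) / (1 / (real T)\<^sup>2) = (1 + real T * Bx\<^sup>2 / lam) * (real T)\<^sup>2" by simp
    ultimately show "let \<delta> = 1 / (real T)\<^sup>2;
             eta = R * sqrt (real CARD('d) * ln ((1 + real T * Bx\<^sup>2 / lam) / \<delta>)) + sqrt lam * B\<theta>
         in barb_regret N K rk \<theta> mm plist T eta lam \<Delta>1 Dx De i
              \<le> ?C * (ln (real T))\<^sup>2 / (min_pref_gap N K \<theta> Dx T)\<^sup>2"
      by (simp only: Let_def eta_def)
  qed
qed

end
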